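(* Let $\Gamma$ be a Coxeter graph with finite vertex set and let $(W,S)$ be the Coxeter system of type $\Gamma$. Write $W=W_{X_1}\times\cdots\times W_{X_b}\times W_{Z_3}$, where $W_{X_1},\dots,W_{X_b}$ are the non-spherical irreducible components of $W$ and $W_{Z_3}$ is the finite part of $W$, and let $W_{Z_3}=H_1\times\cdots\times H_q$ be a Remak decomposition of $W_{Z_3}$. Let $W=G_1\times\cdots\times G_m$ be a Remak decomposition of $W$. Then $m=b+q$ and there exist a permutation $\sigma\in\mathrm{Sym}_m$ and a central automorphism $\varphi:W\to W$ such that $\varphi(W_{X_i})=G_{\sigma(i)}$ for all $1\le i\le b$ and $\varphi(H_j)=G_{\sigma(b+j)}$ for all $1\le j\le q$.
   Context: A Coxeter matrix over a finite set $S$ is a matrix $(m_{s\,t})_{s,t\in S}$ with $m_{s\,s}=1$ and $m_{s\,t}=m_{t\,s}\in\{2,3,\dots,+\infty\}$ for $s\neq t$. Its Coxeter graph $\Gamma$ has vertex set $S$, with an edge between $s$ and $t$ if $m_{s\,t}\ge 3$, labeled by $m_{s\,t}$ if $m_{s\,t}\ge 4$. The Coxeter system of type $\Gamma$ is $(W,S)$, where $W=W_\Gamma$ is the group generated by $S$ with relations $s^2=1$ for $s\in S$ and $(st)^{m_{s\,t}}=1$ for $s\ne t$, $m_{s\,t}<+\infty$. $\Gamma$ is of spherical type if $W_\Gamma$ is finite (equivalently, its canonical form, the bilinear form on $\bigoplus_{s\in S}\mathbb{R}\alpha_s$ with $\langle\alpha_s,\alpha_t\rangle=-\cos(\pi/m_{s\,t})$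 for $m_{s\,t}<+\infty$ and $-1$ for $m_{s\,t}=+\infty$, is positive definite). For $X\subset S$, $W_X$ is the subgroup of $W$ generated by $X$. If $\Gamma_1,\dots,\Gamma_l$ are the connected components of $\Gamma$ with vertex sets $X_1,\dots,X_l$, then $W=W_{X_1}\times\cdots\times W_{X_l}$, and the $W_{X_i}$ are the irreducible components of $W$. Number them so that $\Gamma_1,\dots,\Gamma_b$ are non-spherical and $\Gamma_{b+1},\dots,\Gamma_l$ are of spherical type; with $Z_3=X_{b+1}\cup\cdots\cup X_l$, the finite group $W_{Z_3}$ is the finite part of $W$. A group is indecomposable if it has no proper non-trivial direct factor. A Remak decomposition of a group $G$ is a decomposition of $G$ as a direct product of finitely many non-trivial indecomposable subgroups (empty product allowed when $G$ is trivial). An automorphism $\varphi:G\to G$ is central if $g^{-1}\varphi(g)\in Z(G)$ for all $g\in G$, where $Z(G)$ is the center of $G$. *)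

theory Defs
  imports
    "HOL-Algebra.Product_Groups"
    "HOL-Combinatorics.Permutations"
    "HOL-Library.Extended_Nat"
begin

section \<open>Groups given by generators and relations\<close>

text \<open>A letter \<open>(s, True)\<close> stands for the generator \<open>s\<close> and \<open>(s, False)\<close> for its formal inverse.\<close>

type_synonym 's word = "('s \<times> bool) list"

definition words :: "'s set \<Rightarrow> 's word set" where
  "words S = lists (S \<times> UNIV)"

definition word_step :: "'s set \<Rightarrow> 's word set \<Rightarrow> 's word rel" where
  "word_step S R = {(u @ v, u @ r @ v) | u v r. u \<in> words S \<and> v \<in> words S \<and>
     r \<in> R \<union> {[(s, e), (s, \<not> e)] | s e. s \<in> S}}"

definition word_eq :: "'s set \<Rightarrow> 's word set \<Rightarrow> 's word rel" where
  "word_eq S R = (word_step S R \<union> (word_step S R)\<inverse>)\<^sup>*"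

text \<open>The group \<open>\<langle>S | r = 1 (r \<in> R)\<rangle>\<close>, for a set \<open>R \<subseteq> words S\<close> of relators.\<close>

definition presented_group :: "'s set \<Rightarrow> 's word set \<Rightarrow> 's word set monoid" where
  "presented_group S R =
     \<lparr>carrier = words S // word_eq S R,
      monoid.mult = (\<lambda>A B. \<Union>u\<in>A. \<Union>v\<in>B. word_eq S R `` {u @ v}),
      one = word_eq S R `` {[]}\<rparr>"


section \<open>Coxeter groups\<close>

definition coxeter_matrix :: "'s set \<Rightarrow> ('s \<Rightarrow> 's \<Rightarrow> enat) \<Rightarrow> bool" where
  "coxeter_matrix S M \<longleftrightarrow> finite S \<and> (\<forall>s\<in>S. M s s = 1) \<and>
     (\<forall>s\<in>S. \<forall>t\<in>S. s \<noteq> t \<longrightarrow> M s t = M t s \<and> M s t \<ge> 2)"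

definition coxeter_relators :: "'s set \<Rightarrow> ('s \<Rightarrow> 's \<Rightarrow> enat) \<Rightarrow> 's word set" where
  "coxeter_relators S M =
     {[(s, True), (s, True)] | s. s \<in> S} \<union>
     {concat (replicate k [(s, True), (t, True)]) | s t k.
        s \<in> S \<and> t \<in> S \<and> s \<noteq> t \<and> M s t = enat k}"

definition coxeter_group :: "'s set \<Rightarrow> ('s \<Rightarrow> 's \<Rightarrow> enat) \<Rightarrow> 's word set monoid" where
  "coxeter_group S M = presented_group S (coxeter_relators S M)"

definition coxeter_generator :: "'s set \<Rightarrow> ('s \<Rightarrow> 's \<Rightarrow> enat) \<Rightarrow> 's \<Rightarrow> 's word set" where
  "coxeter_generator S M s = word_eq S (coxeter_relators S M) `` {[(s, True)]}"

text \<open>The subgroup \<open>W\<^sub>X\<close> of \<open>W\<close> generated by \<open>X \<subseteq> S\<close>.\<close>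

definition standard_parabolic :: "'s set \<Rightarrow> ('s \<Rightarrow> 's \<Rightarrow> enat) \<Rightarrow> 's set \<Rightarrow> 's word set set" where
  "standard_parabolic S M X = generate (coxeter_group S M) (coxeter_generator S M ` X)"

definition coxeter_edges :: "'s set \<Rightarrow> ('s \<Rightarrow> 's \<Rightarrow> enat) \<Rightarrow> 's rel" where
  "coxeter_edges S M = {(s, t). s \<in> S \<and> t \<in> S \<and> s \<noteq> t \<and> M s t \<ge> 3}"

text \<open>A component is represented by its vertex set.\<close>

definition coxeter_components :: "'s set \<Rightarrow> ('s \<Rightarrow> 's \<Rightarrow> enat) \<Rightarrow> 's set set" where
  "coxeter_components S M = S // (coxeter_edges S M)\<^sup>*"

text \<open>For \<open>X \<subseteq> S\<close>, \<open>spherical X M\<close> says that the full subgraph on \<open>X\<close> is of spherical type: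
  the group in question is the abstract Coxeter group of that subgraph.\<close>

definition spherical :: "'s set \<Rightarrow> ('s \<Rightarrow> 's \<Rightarrow> enat) \<Rightarrow> bool" where
  "spherical S M \<longleftrightarrow> finite (carrier (coxeter_group S M))"

definition spherical_part :: "'s set \<Rightarrow> ('s \<Rightarrow> 's \<Rightarrow> enat) \<Rightarrow> 's set" where
  "spherical_part S M = \<Union>{X \<in> coxeter_components S M. spherical X M}"

definition finite_part :: "'s set \<Rightarrow> ('s \<Rightarrow> 's \<Rightarrow> enat) \<Rightarrow> 's word set set" where
  "finite_part S M = standard_parabolic S M (spherical_part S M)"


section \<open>Direct products of subgroups\<close>

text \<open>\<open>G\<close> is the internal direct product of its subgroups \<open>H 0, \<dots>, H (n - 1)\<close>:
  \<open>(h\<^sub>0, \<dots>, h\<^sub>n\<^sub>-\<^sub>1) \<mapsto> h\<^sub>0 \<cdots> h\<^sub>n\<^sub>-\<^sub>1\<close> is an isomorphism from their external direct product.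
  For \<open>n = 0\<close> this says that \<open>G\<close> is trivial.\<close>

definition internal_direct_product ::
    "('a, 'b) monoid_scheme \<Rightarrow> nat \<Rightarrow> (nat \<Rightarrow> 'a set) \<Rightarrow> bool" where
  "internal_direct_product G n H \<longleftrightarrow> (\<forall>i<n. subgroup (H i) G) \<and>
     (\<lambda>h. foldr (\<lambda>i x. h i \<otimes>\<^bsub>G\<^esub> x) [0..<n] \<one>\<^bsub>G\<^esub>)
       \<in> iso (product_group {..<n} (\<lambda>i. G\<lparr>carrier := H i\<rparr>)) G"

definition direct_factor :: "('a, 'b) monoid_scheme \<Rightarrow> 'a set \<Rightarrow> bool" where
  "direct_factor G H \<longleftrightarrow> subgroup H G \<and> (\<exists>K. subgroup K G \<and>
     (\<lambda>(h, k). h \<otimes>\<^bsub>G\<^esub> k) \<in> iso (G\<lparr>carrier := H\<rparr> \<times>\<times> G\<lparr>carrier := K\<rparr>) G)"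

definition indecomposable :: "('a, 'b) monoid_scheme \<Rightarrow> bool" where
  "indecomposable G \<longleftrightarrow> (\<forall>H. direct_factor G H \<longrightarrow> H = {\<one>\<^bsub>G\<^esub>} \<or> H = carrier G)"

definition remak_decomposition ::
    "('a, 'b) monoid_scheme \<Rightarrow> nat \<Rightarrow> (nat \<Rightarrow> 'a set) \<Rightarrow> bool" where
  "remak_decomposition G n H \<longleftrightarrow> internal_direct_product G n H \<and>
     (\<forall>i<n. H i \<noteq> {\<one>\<^bsub>G\<^esub>} \<and> indecomposable (G\<lparr>carrier := H i\<rparr>))"


section \<open>Central automorphisms\<close>

definition group_center :: "('a, 'b) monoid_scheme \<Rightarrow> 'a set" where
  "group_center G = {z \<in> carrier G. \<forall>g\<in>carrier G. z \<otimes>\<^bsub>G\<^esub> g = g \<otimes>\<^bsub>G\<^esub> z}"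

definition central_automorphism :: "('a, 'b) monoid_scheme \<Rightarrow> ('a \<Rightarrow> 'a) \<Rightarrow> bool" where
  "central_automorphism G \<phi> \<longleftrightarrow> \<phi> \<in> iso G G \<and>
     (\<forall>g\<in>carrier G. inv\<^bsub>G\<^esub> g \<otimes>\<^bsub>G\<^esub> \<phi> g \<in> group_center G)"

end

theory Submission
  imports Defs
begin

text \<open>
  The theorem combines an exchange argument for direct decompositions of an arbitrary group with one
  fact about Coxeter groups: an infinite irreducible Coxeter group has trivial centre and is
  indecomposable.

  \<^bold>\<open>Exchange.\<close> An infinite Coxeter group violates the descending chain condition on normal
  subgroups, so the classical Krull-Remak-Schmidt theorem does not apply. What its proof needs from a factor is only that its
  normal endomorphisms behave like a local ring: if two of them have commuting images and their
  pointwise product is the identity, then one of them is bijective (\<open>local_endos\<close>). A finite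
  indecomposable group has this property by Fitting's lemma. So has an indecomposable group with
  trivial centre: the two images are normal subgroups which commute and generate the group, hence meet
  in the centre, hence are complementary. Now let a group be decomposed into factors \<open>D i\<close> with this
  property, with projections \<open>e i\<close>, and into indecomposable factors \<open>E j\<close>, with projections \<open>\<epsilon> j\<close>. The
  identity of \<open>D k\<close> is the pointwise product of the maps \<open>e k \<circ> \<epsilon> j\<close>, so one of these is bijective on
  \<open>D k\<close>. Then \<open>\<epsilon> j (D k)\<close> is a direct factor of \<open>E j\<close>, hence all of it, and \<open>D k\<close> and \<open>E j\<close> have the same
  complement, namely the kernel of \<open>e k\<close>. The automorphism which fixes this complement and carries
  \<open>D k\<close> to \<open>E j\<close> along it is central (lemma \<open>exchange\<close>). Composing these automorphisms over all \<open>k\<close> proves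
  \<open>krull_remak_schmidt\<close>.

  \<^bold>\<open>Infinite irreducible Coxeter groups.\<close> The tool is the geometric representation together with the
  positivity of roots (\<open>root_positive\<close>): if multiplying \<open>w\<close> by \<open>s\<close> on the right does not shorten it, then
  \<open>w\<close> maps the simple root of \<open>s\<close> to a nonnegative combination of simple roots. Consequently an element
  which multiplies all roots by one scalar is trivial if the group is infinite (\<open>scalar_trivial\<close>):
  if the scalar is positive, no letter shortens the element; if it is negative, every letter that
  lengthens \<open>y\<close> shortens \<open>w y\<close>, so no element is longer than \<open>w\<close>. An element of the centre fixes the line
  of each simple root and is covered by this.

  Suppose \<open>W = A \<times> B\<close>, and let \<open>\<alpha>\<close> be the root of a generator \<open>s\<close>. For \<open>a \<in> A\<close> and \<open>b \<in> B\<close> one has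
  \<open>(a b) s (a b)\<^sup>-\<^sup>1 = (a s a\<^sup>-\<^sup>1) s (b s b\<^sup>-\<^sup>1)\<close>, so the product of the reflections in \<open>a \<alpha>\<close>, \<open>\<alpha>\<close> and \<open>b \<alpha>\<close> is again
  a reflection. This forces the three roots to be linearly dependent (\<open>three_reflections\<close>, \<open>parallel_orbit\<close>); as the
  invariant form may be degenerate, this is read off from affine deformations of the representation. If some
  \<open>a \<alpha>\<close> and some \<open>b \<alpha>\<close> lie off the line of \<open>\<alpha>\<close>, it follows that the whole orbit of \<open>\<alpha>\<close> lies in one plane, so
  that there are at most two generators, and the infinite dihedral group is treated by hand
  (\<open>dihedral_indecomposable\<close>). Otherwise one factor, say \<open>A\<close>, preserves the line of \<open>\<alpha>\<close>; since it commutes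
  with \<open>B\<close>, each of its elements acts on the whole orbit of \<open>\<alpha>\<close> by a scalar, and \<open>A\<close> is trivial.

  Finally, retractions that kill all generators outside a union of components show that \<open>W\<close> is the direct
  product of its non-spherical components and its finite part, and that each component is isomorphic
  to its abstract Coxeter group.
\<close>

section \<open>Direct factors and normal endomorphisms\<close>

definition complementary :: "('a, 'b) monoid_scheme \<Rightarrow> 'a set \<Rightarrow> 'a set \<Rightarrow> bool" where
  "complementary G A B \<longleftrightarrow> subgroup A G \<and> subgroup B G \<and>
     (\<forall>a\<in>A. \<forall>b\<in>B. a \<otimes>\<^bsub>G\<^esub> b = b \<otimes>\<^bsub>G\<^esub> a) \<and> A \<inter> B = {\<one>\<^bsub>G\<^esub>} \<and>
     (\<forall>x\<in>carrier G. \<exists>a\<in>A. \<exists>b\<in>B. x = a \<otimes>\<^bsub>G\<^esub> b)"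

text \<open>Normal endomorphisms are those which commute with all inner automorphisms. Projections onto direct
  factors are normal, and normal endomorphisms map normal subgroups to normal subgroups.\<close>
definition normal_endo :: "('a, 'b) monoid_scheme \<Rightarrow> ('a \<Rightarrow> 'a) \<Rightarrow> bool" where
  "normal_endo G f \<longleftrightarrow> f \<in> hom G G \<and>
     (\<forall>x\<in>carrier G. \<forall>y\<in>carrier G.
        f (x \<otimes>\<^bsub>G\<^esub> y \<otimes>\<^bsub>G\<^esub> inv\<^bsub>G\<^esub> x) = x \<otimes>\<^bsub>G\<^esub> f y \<otimes>\<^bsub>G\<^esub> inv\<^bsub>G\<^esub> x)"

text \<open>The pointwise product of two normal endomorphisms with commuting images is their sum in the sense
  of ring theory. The condition says that the identity is not a sum of two non-invertible
  endomorphisms, as in a local ring; it is the property of a factor on which the exchange rests.\<close>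
definition local_endos :: "('a, 'b) monoid_scheme \<Rightarrow> bool" where
  "local_endos G \<longleftrightarrow> (\<forall>f g. normal_endo G f \<longrightarrow> normal_endo G g \<longrightarrow>
     (\<forall>x\<in>carrier G. \<forall>y\<in>carrier G. f x \<otimes>\<^bsub>G\<^esub> g y = g y \<otimes>\<^bsub>G\<^esub> f x) \<longrightarrow>
     (\<forall>x\<in>carrier G. f x \<otimes>\<^bsub>G\<^esub> g x = x) \<longrightarrow>
     bij_betw f (carrier G) (carrier G) \<or> bij_betw g (carrier G) (carrier G))"

context group
begin

lemma complementary_imp_direct_factor:
  assumes "complementary G A B"
  shows "direct_factor G A"
proof -
  have A: "subgroup A G" and B: "subgroup B G" and
    comm: "\<And>a b. a \<in> A \<Longrightarrow> b \<in> B \<Longrightarrow> a \<otimes> b = b \<otimes> a" and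
    int: "A \<inter> B = {\<one>}" and gen: "\<And>x. x \<in> carrier G \<Longrightarrow> \<exists>a\<in>A. \<exists>b\<in>B. x = a \<otimes> b"
    using assms unfolding complementary_def by auto
  interpret A: subgroup A G by (rule A)
  interpret B: subgroup B G by (rule B)
  have "(\<lambda>(h, k). h \<otimes> k) \<in> iso (G\<lparr>carrier := A\<rparr> \<times>\<times> G\<lparr>carrier := B\<rparr>) G"
    unfolding iso_def bij_betw_def
  proof (intro CollectI conjI)
    show "(\<lambda>(h, k). h \<otimes> k) \<in> hom (G\<lparr>carrier := A\<rparr> \<times>\<times> G\<lparr>carrier := B\<rparr>) G"
    proof (rule homI; clarsimp simp: DirProd_def)
      fix a b a' b' assume *: "a \<in> A" "b \<in> B" "a' \<in> A" "b' \<in> B"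
      have "a \<otimes> a' \<otimes> (b \<otimes> b') = a \<otimes> (a' \<otimes> b) \<otimes> b'"
        using * by (simp add: m_assoc)
      also have "\<dots> = a \<otimes> (b \<otimes> a') \<otimes> b'"
        using comm[of a' b] * by simp
      also have "\<dots> = a \<otimes> b \<otimes> (a' \<otimes> b')"
        using * by (simp add: m_assoc)
      finally show "a \<otimes> a' \<otimes> (b \<otimes> b') = a \<otimes> b \<otimes> (a' \<otimes> b')" .
    qed
    show "inj_on (\<lambda>(h, k). h \<otimes> k) (carrier (G\<lparr>carrier := A\<rparr> \<times>\<times> G\<lparr>carrier := B\<rparr>))"
    proof (rule inj_onI; clarsimp simp: DirProd_def)
      fix a b a' b' assume *: "a \<in> A" "b \<in> B" "a' \<in> A" "b' \<in> B" "a \<otimes> b = a' \<otimes> b'"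
      have "inv a' \<otimes> a = inv a' \<otimes> ((a \<otimes> b) \<otimes> inv b)"
        using *(1-4) by (simp add: m_assoc)
      also have "\<dots> = inv a' \<otimes> ((a' \<otimes> b') \<otimes> inv b)"
        using *(5) by simp
      also have "\<dots> = b' \<otimes> inv b"
        using *(1-4) by (simp flip: m_assoc)
      finally have eq: "inv a' \<otimes> a = b' \<otimes> inv b" .
      have "inv a' \<otimes> a \<in> A" "b' \<otimes> inv b \<in> B"
        using * by auto
      with eq have "inv a' \<otimes> a = \<one>" "b' \<otimes> inv b = \<one>"
        using int by auto
      then show "a = a' \<and> b = b'"
        using * by (metis A.mem_carrier B.mem_carrier inv_closed inv_equality inv_inv inv_solve_right' l_one)
    qed
    show "(\<lambda>(h, k). h \<otimes> k) ` carrier (G\<lparr>carrier := A\<rparr> \<times>\<times> G\<lparr>carrier := B\<rparr>) = carrier G"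
      using gen by (auto simp: image_def DirProd_def)
  qed
  then show ?thesis
    using A B unfolding direct_factor_def by blast
qed

lemma direct_factor_imp_complementary:
  assumes "direct_factor G A"
  obtains B where "complementary G A B"
proof -
  obtain B where A: "subgroup A G" and B: "subgroup B G" and
    iso: "(\<lambda>(h, k). h \<otimes> k) \<in> iso (G\<lparr>carrier := A\<rparr> \<times>\<times> G\<lparr>carrier := B\<rparr>) G"
    using assms unfolding direct_factor_def by blast
  interpret A: subgroup A G by (rule A)
  interpret B: subgroup B G by (rule B)
  have mult: "a \<otimes> a' \<otimes> (b \<otimes> b') = a \<otimes> b \<otimes> (a' \<otimes> b')"
    if "a \<in> A" "b \<in> B" "a' \<in> A" "b' \<in> B" for a b a' b'
    using hom_mult[OF iso_imp_homomorphism[OF iso], of "(a, b)" "(a', b')"] that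
    by (simp add: DirProd_def)
  have inj: "a = a' \<and> b = b'"
    if "a \<in> A" "b \<in> B" "a' \<in> A" "b' \<in> B" "a \<otimes> b = a' \<otimes> b'" for a b a' b'
  proof -
    have "inj_on (\<lambda>(h, k). h \<otimes> k) (A \<times> B)"
      using iso unfolding iso_def bij_betw_def by (simp add: DirProd_def)
    from inj_onD[OF this, of "(a, b)" "(a', b')"] that show ?thesis by simp
  qed
  have surj: "\<exists>a\<in>A. \<exists>b\<in>B. x = a \<otimes> b" if "x \<in> carrier G" for x
  proof -
    have "x \<in> (\<lambda>(h, k). h \<otimes> k) ` (A \<times> B)"
      using iso that unfolding iso_def bij_betw_def by (auto simp: DirProd_def)
    then show ?thesis by auto
  qed
  have "complementary G A B"
    unfolding complementary_def
  proof (intro conjI ballI)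
    fix a b assume "a \<in> A" "b \<in> B"
    then show "a \<otimes> b = b \<otimes> a"
      using mult[of \<one> b a \<one>] by simp
  next
    have "x = \<one>" if "x \<in> A" "x \<in> B" for x
    proof -
      have "x \<otimes> \<one> = \<one> \<otimes> x" using that by simp
      then show ?thesis
        using inj[OF that(1) B.one_closed A.one_closed that(2)] by blast
    qed
    then show "A \<inter> B = {\<one>}" by auto
  qed (use A B surj in auto)
  then show ?thesis by (rule that)
qed

text \<open>Complementary pairs are the symmetric form of direct factors, and the only form used from here on.\<close>
lemma indecomposable_iff:
  "indecomposable G \<longleftrightarrow> (\<forall>A B. complementary G A B \<longrightarrow> A = {\<one>} \<or> B = {\<one>})"
proof (intro iffI allI impI)
  fix A B assume "indecomposable G" and AB: "complementary G A B"
  then have "A = {\<one>} \<or> A = carrier G"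
    using complementary_imp_direct_factor unfolding indecomposable_def by blast
  moreover have "B \<subseteq> carrier G"
    using AB unfolding complementary_def by (simp add: subgroup.subset)
  ultimately show "A = {\<one>} \<or> B = {\<one>}"
    using AB unfolding complementary_def by auto
next
  assume *: "\<forall>A B. complementary G A B \<longrightarrow> A = {\<one>} \<or> B = {\<one>}"
  show "indecomposable G"
    unfolding indecomposable_def
  proof (intro allI impI)
    fix A assume "direct_factor G A"
    then obtain B where AB: "complementary G A B"
      using direct_factor_imp_complementary by blast
    have "A = carrier G" if "B = {\<one>}"
      using AB that unfolding complementary_def
      by (auto simp: subgroup.mem_carrier)
    then show "A = {\<one>} \<or> A = carrier G"
      using * AB by blast
  qed
qed

lemma normal_endo_simps:
  assumes "normal_endo G f"
  shows "x \<in> carrier G \<Longrightarrow> f x \<in> carrier G"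
    and "x \<in> carrier G \<Longrightarrow> y \<in> carrier G \<Longrightarrow> f (x \<otimes> y) = f x \<otimes> f y"
    and "f \<one> = \<one>"
    and "x \<in> carrier G \<Longrightarrow> f (inv x) = inv (f x)"
    and "x \<in> carrier G \<Longrightarrow> y \<in> carrier G \<Longrightarrow> f (x \<otimes> y \<otimes> inv x) = x \<otimes> f y \<otimes> inv x"
proof -
  have f: "group_hom G G f"
    using assms group_axioms unfolding normal_endo_def group_hom_def group_hom_axioms_def by blast
  show "x \<in> carrier G \<Longrightarrow> f x \<in> carrier G" "f \<one> = \<one>" "x \<in> carrier G \<Longrightarrow> f (inv x) = inv (f x)"
    "x \<in> carrier G \<Longrightarrow> y \<in> carrier G \<Longrightarrow> f (x \<otimes> y) = f x \<otimes> f y"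
    using f by (simp_all add: group_hom.hom_closed group_hom.hom_one group_hom.hom_inv group_hom.hom_mult)
  show "x \<in> carrier G \<Longrightarrow> y \<in> carrier G \<Longrightarrow> f (x \<otimes> y \<otimes> inv x) = x \<otimes> f y \<otimes> inv x"
    using assms unfolding normal_endo_def by blast
qed

lemma normal_endo_image_subgroup: "normal_endo G f \<Longrightarrow> subgroup (f ` carrier G) G"
  using group_hom.img_is_subgroup group_axioms
  unfolding normal_endo_def group_hom_def group_hom_axioms_def by blast

lemma normal_endo_inj:
  assumes f: "normal_endo G f" and ker: "\<forall>x\<in>carrier G. f x = \<one> \<longrightarrow> x = \<one>"
  shows "inj_on f (carrier G)"
proof (rule inj_onI)
  fix x y assume *: "x \<in> carrier G" "y \<in> carrier G" "f x = f y"
  note fs = normal_endo_simps[OF f]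
  have "f (x \<otimes> inv y) = \<one>"
    using * fs(1) by (simp add: fs(2,4))
  then have "x \<otimes> inv y = \<one>"
    using ker * by blast
  then show "x = y"
    using * by (metis inv_closed inv_equality inv_inv)
qed

text \<open>Conjugation by \<open>x\<close> fixes \<open>y\<close>, hence also \<open>f y\<close>, because \<open>f\<close> commutes with this conjugation.\<close>

lemma normal_endo_commute:
  assumes f: "normal_endo G f" and "x \<in> carrier G" "y \<in> carrier G" "x \<otimes> y = y \<otimes> x"
  shows "x \<otimes> f y = f y \<otimes> x"
proof -
  have "x \<otimes> y \<otimes> inv x = y"
    using assms by (simp add: m_assoc)
  then have "x \<otimes> f y \<otimes> inv x = f y"
    using normal_endo_simps(5)[OF f, of x y] assms by simp
  then show ?thesis
    using assms normal_endo_simps(1)[OF f] by (metis inv_solve_right' m_closed)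
qed

lemma normal_endo_comp:
  assumes "normal_endo G f" "normal_endo G g"
  shows "normal_endo G (\<lambda>x. f (g x))"
  unfolding normal_endo_def
  by (intro conjI ballI homI) (simp_all only: normal_endo_simps[OF assms(1)] normal_endo_simps[OF assms(2)])

lemma normal_endo_mult:
  assumes f: "normal_endo G f" and g: "normal_endo G g"
    and comm: "\<And>x y. x \<in> carrier G \<Longrightarrow> y \<in> carrier G \<Longrightarrow> f x \<otimes> g y = g y \<otimes> f x"
  shows "normal_endo G (\<lambda>x. f x \<otimes> g x)"
  unfolding normal_endo_def
proof (intro conjI ballI homI)
  fix x y assume *: "x \<in> carrier G" "y \<in> carrier G"
  have "f x \<otimes> f y \<otimes> (g x \<otimes> g y) = f x \<otimes> (f y \<otimes> g x) \<otimes> g y"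
    using * normal_endo_simps(1)[OF f] normal_endo_simps(1)[OF g] by (simp add: m_assoc)
  also have "\<dots> = f x \<otimes> g x \<otimes> (f y \<otimes> g y)"
    using * normal_endo_simps(1)[OF f] normal_endo_simps(1)[OF g] comm[of y x] by (simp add: m_assoc)
  finally show "f (x \<otimes> y) \<otimes> g (x \<otimes> y) = f x \<otimes> g x \<otimes> (f y \<otimes> g y)"
    using * by (simp add: normal_endo_simps(2)[OF f] normal_endo_simps(2)[OF g])
  have "x \<otimes> f y \<otimes> inv x \<otimes> (x \<otimes> g y \<otimes> inv x) = x \<otimes> f y \<otimes> (inv x \<otimes> x) \<otimes> g y \<otimes> inv x"
    using * normal_endo_simps(1)[OF f] normal_endo_simps(1)[OF g]
    by (simp only: m_assoc inv_closed m_closed)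
  then show "f (x \<otimes> y \<otimes> inv x) \<otimes> g (x \<otimes> y \<otimes> inv x) = x \<otimes> (f y \<otimes> g y) \<otimes> inv x"
    using * normal_endo_simps(1)[OF f] normal_endo_simps(1)[OF g]
    by (simp only: normal_endo_simps(5)[OF f] normal_endo_simps(5)[OF g])
       (simp add: m_assoc)
qed (use normal_endo_simps[OF f] normal_endo_simps[OF g] in auto)

text \<open>If the sum \<open>h\<close> of \<open>f\<close> and \<open>g\<close> is bijective, then \<open>h\<^sup>-\<^sup>1 \<circ> f\<close> and \<open>h\<^sup>-\<^sup>1 \<circ> g\<close> sum to the identity. This is what
  allows a sum of many endomorphisms to be split off one summand at a time.\<close>
lemma local_endos_bij:
  assumes loc: "local_endos G" and f: "normal_endo G f" and g: "normal_endo G g"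
    and comm: "\<And>x y. x \<in> carrier G \<Longrightarrow> y \<in> carrier G \<Longrightarrow> f x \<otimes> g y = g y \<otimes> f x"
    and bij: "bij_betw (\<lambda>x. f x \<otimes> g x) (carrier G) (carrier G)"
  shows "bij_betw f (carrier G) (carrier G) \<or> bij_betw g (carrier G) (carrier G)"
proof -
  define h where "h x = f x \<otimes> g x" for x
  define k where "k = inv_into (carrier G) h"
  have h: "normal_endo G h"
    using normal_endo_mult[OF f g comm] by (simp add: h_def[abs_def])
  have bijh: "bij_betw h (carrier G) (carrier G)"
    using bij by (simp add: h_def[abs_def])
  then have bijk: "bij_betw k (carrier G) (carrier G)"
    unfolding k_def by (rule bij_betw_inv_into)
  have hk: "h (k x) = x" if "x \<in> carrier G" for x
    using bijh that unfolding k_def bij_betw_def by (simp add: f_inv_into_f)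
  have kh: "k (h x) = x" if "x \<in> carrier G" for x
    using bijh that unfolding k_def bij_betw_def by simp
  have kc: "k x \<in> carrier G" if "x \<in> carrier G" for x
    using bij_betwE[OF bijk] that by blast
  have k: "normal_endo G k"
    unfolding normal_endo_def
  proof (intro conjI ballI homI)
    fix x y assume *: "x \<in> carrier G" "y \<in> carrier G"
    have "k (x \<otimes> y) = k (h (k x \<otimes> k y))"
      using * by (simp add: normal_endo_simps[OF h] hk kc)
    then show "k (x \<otimes> y) = k x \<otimes> k y"
      using * by (simp add: kh kc)
    have "k (x \<otimes> y \<otimes> inv x) = k (h (x \<otimes> k y \<otimes> inv x))"
      using * by (simp add: normal_endo_simps(5)[OF h] hk kc)
    then show "k (x \<otimes> y \<otimes> inv x) = x \<otimes> k y \<otimes> inv x"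
      using * by (simp add: kh kc)
  qed (rule kc)
  have "k (f x) \<otimes> k (g y) = k (g y) \<otimes> k (f x)" if "x \<in> carrier G" "y \<in> carrier G" for x y
    using that comm[OF that]
    by (metis normal_endo_simps(1)[OF f] normal_endo_simps(1)[OF g] normal_endo_simps(2)[OF k])
  moreover have "k (f x) \<otimes> k (g x) = x" if "x \<in> carrier G" for x
    using kh[OF that] normal_endo_simps(2)[OF k normal_endo_simps(1)[OF f that] normal_endo_simps(1)[OF g that]]
    by (simp add: h_def)
  ultimately have "bij_betw (\<lambda>x. k (f x)) (carrier G) (carrier G) \<or>
      bij_betw (\<lambda>x. k (g x)) (carrier G) (carrier G)"
    using loc[unfolded local_endos_def, rule_format, OF normal_endo_comp[OF k f] normal_endo_comp[OF k g]]
    by blast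
  moreover have "bij_betw u (carrier G) (carrier G)"
    if u: "normal_endo G u" and b: "bij_betw (\<lambda>x. k (u x)) (carrier G) (carrier G)" for u
  proof -
    have "bij_betw (h \<circ> (\<lambda>x. k (u x))) (carrier G) (carrier G)"
      using b bijh by (rule bij_betw_trans)
    then show ?thesis
      by (rule bij_betw_cong[THEN iffD1, rotated]) (simp add: hk normal_endo_simps(1)[OF u])
  qed
  ultimately show ?thesis
    using f g by blast
qed

text \<open>The images of \<open>f\<close> and \<open>g\<close> commute and generate the group, so an element of both commutes with
  everything. As the centre is trivial, the images are complementary, and one of them is trivial; the
  other endomorphism is then the identity.\<close>
lemma centreless_indecomposable_imp_local_endos:
  assumes ind: "indecomposable G" and centre: "group_center G \<subseteq> {\<one>}"
  shows "local_endos G"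
  unfolding local_endos_def
proof (intro allI impI)
  fix f g assume f: "normal_endo G f" and g: "normal_endo G g"
    and comm: "\<forall>x\<in>carrier G. \<forall>y\<in>carrier G. f x \<otimes> g y = g y \<otimes> f x"
    and id: "\<forall>x\<in>carrier G. f x \<otimes> g x = x"
  note fs = normal_endo_simps[OF f] and gs = normal_endo_simps[OF g]
  let ?A = "f ` carrier G" and ?B = "g ` carrier G"
  have "?A \<inter> ?B \<subseteq> group_center G"
  proof
    fix z assume z: "z \<in> ?A \<inter> ?B"
    then obtain a b where a: "a \<in> carrier G" "z = f a" and b: "b \<in> carrier G" "z = g b" by auto
    have "z \<otimes> x = x \<otimes> z" if x: "x \<in> carrier G" for x
    proof -
      have cl: "z \<in> carrier G" "f x \<in> carrier G" "g x \<in> carrier G"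
        using a fs(1) gs(1) x by auto
      have "f x \<otimes> z = z \<otimes> f x"
        unfolding b(2) using comm x b(1) by blast
      moreover have "z \<otimes> g x = g x \<otimes> z"
        unfolding a(2) using comm x a(1) by blast
      ultimately have "z \<otimes> (f x \<otimes> g x) = f x \<otimes> g x \<otimes> z"
        using cl by (metis m_assoc)
      then show ?thesis
        using id x by simp
    qed
    then show "z \<in> group_center G"
      using a fs by (auto simp: group_center_def)
  qed
  moreover have "\<one> \<in> ?A" "\<one> \<in> ?B"
    using fs(3) gs(3) by (metis image_eqI one_closed)+
  ultimately have "?A \<inter> ?B = {\<one>}"
    using centre by blast
  moreover have "subgroup ?A G" "subgroup ?B G"
    using normal_endo_image_subgroup f g by blast+
  moreover have "\<exists>a\<in>?A. \<exists>b\<in>?B. x = a \<otimes> b" if "x \<in> carrier G" for x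
    using id that by (metis image_eqI)
  moreover have "\<forall>a\<in>?A. \<forall>b\<in>?B. a \<otimes> b = b \<otimes> a"
    using comm by blast
  ultimately have "complementary G ?A ?B"
    unfolding complementary_def by blast
  then have "?A = {\<one>} \<or> ?B = {\<one>}"
    using ind indecomposable_iff by blast
  then show "bij_betw f (carrier G) (carrier G) \<or> bij_betw g (carrier G) (carrier G)"
  proof
    assume "?A = {\<one>}"
    then have "g x = x" if "x \<in> carrier G" for x
      using id that gs(1) by (metis image_eqI l_one singletonD)
    then show ?thesis
      using bij_betw_cong[of "carrier G" g "\<lambda>x. x"] by (auto simp: bij_betw_def)
  next
    assume "?B = {\<one>}"
    then have "f x = x" if "x \<in> carrier G" for x
      using id that fs(1) by (metis image_eqI r_one singletonD)
    then show ?thesis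
      using bij_betw_cong[of "carrier G" f "\<lambda>x. x"] by (auto simp: bij_betw_def)
  qed
qed

lemma normal_endo_funpow: "normal_endo G f \<Longrightarrow> normal_endo G (f ^^ n)"
proof (induction n)
  case 0
  show ?case by (simp add: normal_endo_def hom_def)
next
  case (Suc n)
  then show ?case
    using normal_endo_comp[of f "f ^^ n"] by (simp add: comp_def)
qed

text \<open>Fitting's lemma: some power of \<open>f\<close> is idempotent, and a normal idempotent splits the group
  into its image and its kernel.\<close>

lemma finite_indecomposable_normal_endo:
  assumes fin: "finite (carrier G)" and ind: "indecomposable G" and f: "normal_endo G f"
  shows "bij_betw f (carrier G) (carrier G) \<or> (\<exists>n. \<forall>x\<in>carrier G. (f ^^ n) x = \<one>)"
proof -
  note fs = normal_endo_simps[OF f]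
  have pow: "(f ^^ n) x \<in> carrier G" if "x \<in> carrier G" for n x
    using normal_endo_simps(1)[OF normal_endo_funpow[OF f]] that .
  \<comment> \<open>Two powers of \<open>f\<close> agree on the finite carrier, so the powers are eventually periodic with some
    period \<open>p\<close> from an index \<open>i\<close> on; the exponent \<open>N = p (i + 1)\<close> is a multiple of \<open>p\<close> and at least \<open>i\<close>, which
    makes the power idempotent.\<close>
  have "\<not> inj (\<lambda>n. restrict (f ^^ n) (carrier G))"
  proof
    assume inj: "inj (\<lambda>n. restrict (f ^^ n) (carrier G))"
    have "range (\<lambda>n. restrict (f ^^ n) (carrier G)) \<subseteq> carrier G \<rightarrow>\<^sub>E carrier G"
      using pow by auto
    then have "finite (range (\<lambda>n. restrict (f ^^ n) (carrier G)))"
      by (rule finite_subset) (intro finite_PiE fin)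
    from finite_imageD[OF this inj] show False
      by simp
  qed
  then obtain i' j' where "i' \<noteq> j'"
    and ij': "restrict (f ^^ i') (carrier G) = restrict (f ^^ j') (carrier G)"
    unfolding inj_def by blast
  then have "\<exists>i j. i < j \<and> restrict (f ^^ i) (carrier G) = restrict (f ^^ j) (carrier G)"
    by (cases i' j' rule: linorder_cases) (blast, simp, metis)
  then obtain i j where "i < j"
    and ij: "restrict (f ^^ i) (carrier G) = restrict (f ^^ j) (carrier G)"
    by blast
  define p where "p = j - i"
  have p: "p > 0" and j: "j = i + p"
    using \<open>i < j\<close> by (simp_all add: p_def)
  have per0: "(f ^^ (i + p)) x = (f ^^ i) x" if "x \<in> carrier G" for x
    using fun_cong[OF ij, of x] that by (simp add: j)
  have per: "(f ^^ (n + i + k * p)) x = (f ^^ (n + i)) x" if "x \<in> carrier G" for x n k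
  proof (induction k)
    case (Suc k)
    have "n + i + Suc k * p = (n + k * p) + (i + p)" "n + i + k * p = (n + k * p) + i"
      by simp_all
    then have "(f ^^ (n + i + Suc k * p)) x = (f ^^ (n + k * p)) ((f ^^ (i + p)) x)"
      by (simp only: funpow_add comp_apply)
    also have "\<dots> = (f ^^ (n + i + k * p)) x"
      unfolding per0[OF that] \<open>n + i + k * p = (n + k * p) + i\<close> by (simp only: funpow_add comp_apply)
    finally show ?case
      using Suc by simp
  qed simp
  define N where "N = p * (i + 1)"
  define e where "e = f ^^ N"
  have "N \<ge> i"
    using p by (simp add: N_def trans_le_add2)
  then obtain n where n: "N = n + i"
    by (metis le_add_diff_inverse2)
  have e: "normal_endo G e"
    unfolding e_def by (rule normal_endo_funpow[OF f])
  note es = normal_endo_simps[OF e]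
  have idem: "e (e x) = e x" if "x \<in> carrier G" for x
  proof -
    have "e (e x) = (f ^^ (N + (i + 1) * p)) x"
      by (simp add: e_def N_def funpow_add mult.commute)
    then show ?thesis
      using per[OF that, of n "i + 1"] by (simp add: e_def n)
  qed
  let ?K = "{x \<in> carrier G. e x = \<one>}"
  have "complementary G (e ` carrier G) ?K"
    unfolding complementary_def
  proof (intro conjI ballI)
    show "subgroup (e ` carrier G) G"
      by (rule normal_endo_image_subgroup[OF e])
    show "subgroup ?K G"
      by (rule subgroup.intro) (auto simp: es)
    show "(e ` carrier G) \<inter> ?K = {\<one>}"
      using idem es by (auto intro!: image_eqI[of _ _ \<one>])
  next
    fix x assume "x \<in> carrier G"
    moreover from this have "inv (e x) \<otimes> x \<in> ?K"
      by (simp add: es idem)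
    moreover have "x = e x \<otimes> (inv (e x) \<otimes> x)"
      using \<open>x \<in> carrier G\<close> es(1) by (simp flip: m_assoc)
    ultimately show "\<exists>a\<in>e ` carrier G. \<exists>b\<in>?K. x = a \<otimes> b"
      by blast
  next
    fix a b assume "a \<in> e ` carrier G" and b: "b \<in> ?K"
    then obtain y where y: "y \<in> carrier G" "a = e y" by blast
    have "e y = e (b \<otimes> y \<otimes> inv b)"
      using b y es(1) by (simp add: es(2-4))
    also have "\<dots> = b \<otimes> e y \<otimes> inv b"
      using b y by (simp add: es(5))
    finally have "e y \<otimes> b = b \<otimes> e y"
      using b y es(1) by (metis (mono_tags, lifting) inv_solve_right m_closed mem_Collect_eq)
    then show "a \<otimes> b = b \<otimes> a"
      using y by simp
  qed
  then have "e ` carrier G = {\<one>} \<or> ?K = {\<one>}"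
    using ind indecomposable_iff by blast
  then show ?thesis
  proof
    assume "e ` carrier G = {\<one>}"
    then have "(f ^^ N) x = \<one>" if "x \<in> carrier G" for x
      using that unfolding e_def by blast
    then show ?thesis by blast
  next
    assume ker: "?K = {\<one>}"
    have "e x = \<one>" if "x \<in> carrier G" "f x = \<one>" for x
    proof -
      have "N > 0" using p by (simp add: N_def)
      then obtain N' where "N = Suc N'" by (cases N) auto
      then have "e x = (f ^^ N') (f x)" by (simp add: e_def funpow_swap1)
      then show ?thesis
        using that normal_endo_simps(3)[OF normal_endo_funpow[OF f]] by simp
    qed
    then have "\<forall>x\<in>carrier G. f x = \<one> \<longrightarrow> x = \<one>"
      using ker by blast
    then have "inj_on f (carrier G)"
      by (rule normal_endo_inj[OF f])
    moreover have "f ` carrier G \<subseteq> carrier G"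
      using fs(1) by auto
    ultimately show ?thesis
      using fin by (auto simp: bij_betw_def endo_inj_surj)
  qed
qed

text \<open>If \<open>f\<close> is nilpotent and \<open>g x = 1\<close>, then \<open>f x = x\<close> and hence \<open>x = 1\<close>: the classical inverse of one
  minus a nilpotent.\<close>
lemma finite_indecomposable_imp_local_endos:
  assumes fin: "finite (carrier G)" and ind: "indecomposable G"
  shows "local_endos G"
  unfolding local_endos_def
proof (intro allI impI)
  fix f g assume f: "normal_endo G f" and g: "normal_endo G g"
    and id: "\<forall>x\<in>carrier G. f x \<otimes> g x = x"
  note fs = normal_endo_simps[OF f] and gs = normal_endo_simps[OF g]
  show "bij_betw f (carrier G) (carrier G) \<or> bij_betw g (carrier G) (carrier G)"
  proof (cases "bij_betw f (carrier G) (carrier G)")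
    case False
    then obtain n where n: "\<forall>x\<in>carrier G. (f ^^ n) x = \<one>"
      using finite_indecomposable_normal_endo[OF fin ind f] by blast
    have ker: "x = \<one>" if x: "x \<in> carrier G" "g x = \<one>" for x
    proof -
      have "f x = x"
        using id x fs(1) by (metis r_one)
      then have "(f ^^ n) x = x"
        by (induction n) auto
      then show ?thesis using n x by simp
    qed
    then have "inj_on g (carrier G)"
      by (intro normal_endo_inj[OF g]) blast
    moreover have "g ` carrier G \<subseteq> carrier G"
      using gs(1) by auto
    ultimately show ?thesis
      using fin by (auto simp: bij_betw_def endo_inj_surj)
  qed simp
qed

end

section \<open>Exchanging factors of direct decompositions\<close>

text \<open>Internal direct products by conditions that are easy to verify: instead of the uniqueness of
  components, the existence of homomorphisms onto the factors is required.\<close>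
definition direct_family :: "('a, 'b) monoid_scheme \<Rightarrow> nat \<Rightarrow> (nat \<Rightarrow> 'a set) \<Rightarrow> bool" where
  "direct_family G n D \<longleftrightarrow> (\<forall>i<n. subgroup (D i) G) \<and>
     (\<forall>i<n. \<forall>k<n. i \<noteq> k \<longrightarrow> (\<forall>x\<in>D i. \<forall>y\<in>D k. x \<otimes>\<^bsub>G\<^esub> y = y \<otimes>\<^bsub>G\<^esub> x)) \<and>
     generate G (\<Union>i<n. D i) = carrier G \<and>
     (\<forall>i<n. \<exists>r\<in>hom G G. (\<forall>x\<in>D i. r x = x) \<and>
        (\<forall>k<n. k \<noteq> i \<longrightarrow> (\<forall>x\<in>D k. r x = \<one>\<^bsub>G\<^esub>)))"

lemma direct_familyD:
  assumes "direct_family G n D"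
  shows "i < n \<Longrightarrow> subgroup (D i) G"
    and "i < n \<Longrightarrow> k < n \<Longrightarrow> i \<noteq> k \<Longrightarrow> x \<in> D i \<Longrightarrow> y \<in> D k \<Longrightarrow> x \<otimes>\<^bsub>G\<^esub> y = y \<otimes>\<^bsub>G\<^esub> x"
    and "generate G (\<Union>i<n. D i) = carrier G"
    and "i < n \<Longrightarrow> \<exists>r\<in>hom G G. (\<forall>x\<in>D i. r x = x) \<and>
        (\<forall>k<n. k \<noteq> i \<longrightarrow> (\<forall>x\<in>D k. r x = \<one>\<^bsub>G\<^esub>))"
  using assms unfolding direct_family_def by simp_all

definition pointwise_prod ::
    "('a, 'b) monoid_scheme \<Rightarrow> (nat \<Rightarrow> 'a \<Rightarrow> 'a) \<Rightarrow> nat list \<Rightarrow> 'a \<Rightarrow> 'a" where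
  "pointwise_prod G e js x = foldr (\<lambda>i z. e i x \<otimes>\<^bsub>G\<^esub> z) js \<one>\<^bsub>G\<^esub>"

lemma pointwise_prod_simps [simp]:
  "pointwise_prod G e [] x = \<one>\<^bsub>G\<^esub>"
  "pointwise_prod G e (i # js) x = e i x \<otimes>\<^bsub>G\<^esub> pointwise_prod G e js x"
  by (simp_all add: pointwise_prod_def)

text \<open>The same decompositions seen from their projections, a complete system of orthogonal idempotents
  among the normal endomorphisms. The exchange argument computes with these.\<close>
definition direct_projections ::
    "('a, 'b) monoid_scheme \<Rightarrow> nat \<Rightarrow> (nat \<Rightarrow> 'a set) \<Rightarrow> (nat \<Rightarrow> 'a \<Rightarrow> 'a) \<Rightarrow> bool" where
  "direct_projections G n D e \<longleftrightarrow>
     (\<forall>i<n. subgroup (D i) G \<and> normal_endo G (e i) \<and> (\<forall>x\<in>carrier G. e i x \<in> D i) \<and>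
        (\<forall>x\<in>D i. e i x = x) \<and> (\<forall>k<n. k \<noteq> i \<longrightarrow> (\<forall>x\<in>D k. e i x = \<one>\<^bsub>G\<^esub>))) \<and>
     (\<forall>x\<in>carrier G. pointwise_prod G e [0..<n] x = x)"

lemma (in group) conj_mult:
  assumes "u \<in> carrier G" "v \<in> carrier G" "z \<in> carrier G"
  shows "(u \<otimes> v) \<otimes> z \<otimes> inv (u \<otimes> v) = u \<otimes> (v \<otimes> z \<otimes> inv v) \<otimes> inv u"
  using assms by (simp add: inv_mult_group m_assoc)

lemma (in group) commute_mult:
  assumes "z \<in> carrier G" "x \<in> carrier G" "y \<in> carrier G" "z \<otimes> x = x \<otimes> z" "z \<otimes> y = y \<otimes> z"
  shows "z \<otimes> (x \<otimes> y) = x \<otimes> y \<otimes> z"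
  using assms by (metis m_assoc)

lemma (in group) normal_endo_pointwise_prod:
  assumes e: "\<And>i. i < n \<Longrightarrow> normal_endo G (e i)"
    and eD: "\<And>i x. i < n \<Longrightarrow> x \<in> carrier G \<Longrightarrow> e i x \<in> D i"
    and D: "\<And>i. i < n \<Longrightarrow> D i \<subseteq> carrier G"
    and comm: "\<And>i k x y. i < n \<Longrightarrow> k < n \<Longrightarrow> i \<noteq> k \<Longrightarrow> x \<in> D i \<Longrightarrow> y \<in> D k \<Longrightarrow> x \<otimes> y = y \<otimes> x"
    and js: "distinct js" "set js \<subseteq> {..<n}"
  shows "normal_endo G (pointwise_prod G e js)"
    and "i < n \<Longrightarrow> i \<notin> set js \<Longrightarrow> z \<in> D i \<Longrightarrow> x \<in> carrier G \<Longrightarrow>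
      z \<otimes> pointwise_prod G e js x = pointwise_prod G e js x \<otimes> z"
proof -
  have "normal_endo G (pointwise_prod G e js) \<and>
    (\<forall>i z x. i < n \<and> i \<notin> set js \<and> z \<in> D i \<and> x \<in> carrier G \<longrightarrow>
      z \<otimes> pointwise_prod G e js x = pointwise_prod G e js x \<otimes> z)"
    using js
  proof (induction js)
    case Nil
    have "normal_endo G (\<lambda>x. \<one>)"
      by (simp add: normal_endo_def hom_def)
    moreover have "pointwise_prod G e [] = (\<lambda>x. \<one>)"
      by (rule ext) simp
    ultimately show ?case
      using D by simp (metis l_one r_one subsetD)
  next
    case (Cons j js)
    let ?p = "pointwise_prod G e js"
    have j: "j < n" "j \<notin> set js"
      using Cons.prems by auto
    have IH: "normal_endo G ?p"
      "\<And>i z x. i < n \<Longrightarrow> i \<notin> set js \<Longrightarrow> z \<in> D i \<Longrightarrow> x \<in> carrier G \<Longrightarrow> z \<otimes> ?p x = ?p x \<otimes> z"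
      using Cons by auto
    have p: "pointwise_prod G e (j # js) = (\<lambda>x. e j x \<otimes> ?p x)"
      by (rule ext) simp
    have "normal_endo G (pointwise_prod G e (j # js))"
      unfolding p by (rule normal_endo_mult[OF e[OF j(1)] IH(1)]) (rule IH(2)[OF j eD[OF j(1)]])
    moreover have "z \<otimes> pointwise_prod G e (j # js) x = pointwise_prod G e (j # js) x \<otimes> z"
      if *: "i < n" "i \<notin> set (j # js)" "z \<in> D i" "x \<in> carrier G" for i z x
    proof -
      have c: "z \<in> carrier G" "e j x \<in> carrier G" "?p x \<in> carrier G"
        using * D j eD normal_endo_simps(1)[OF IH(1)] by (auto dest: subsetD)
      have "z \<otimes> e j x = e j x \<otimes> z"
        by (rule comm[OF *(1) j(1) _ *(3) eD[OF j(1) *(4)]]) (use * in auto)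
      moreover have "z \<otimes> ?p x = ?p x \<otimes> z"
        using IH(2) * by simp
      ultimately show ?thesis
        using commute_mult[OF c] by simp
    qed
    ultimately show ?case by blast
  qed
  then show "normal_endo G (pointwise_prod G e js)"
    and "i < n \<Longrightarrow> i \<notin> set js \<Longrightarrow> z \<in> D i \<Longrightarrow> x \<in> carrier G \<Longrightarrow>
      z \<otimes> pointwise_prod G e js x = pointwise_prod G e js x \<otimes> z"
    by blast+
qed

lemma (in group) pointwise_prod_single:
  assumes "distinct js" "x \<in> carrier G" "e i x = x"
    and "\<And>k. k \<in> set js \<Longrightarrow> k \<noteq> i \<Longrightarrow> e k x = \<one>"
  shows "pointwise_prod G e js x = (if i \<in> set js then x else \<one>)"
  using assms
proof (induction js)
  case (Cons j js)
  show ?case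
  proof (cases "j = i")
    case True
    then show ?thesis using Cons by simp
  next
    case False
    then have "e j x = \<one>" using Cons.prems(4)[of j] by simp
    then show ?thesis using Cons False by simp
  qed
qed simp

lemma (in group) equaliser_subgroup:
  assumes "f \<in> hom G H" "g \<in> hom G H" "group H"
  shows "subgroup {x \<in> carrier G. f x = g x} G"
proof -
  interpret f: group_hom G H f
    using assms group_axioms by (simp add: group_hom_def group_hom_axioms_def)
  interpret g: group_hom G H g
    using assms group_axioms by (simp add: group_hom_def group_hom_axioms_def)
  show ?thesis
    by (rule subgroup.intro) auto
qed

text \<open>Each of the required properties of the given homomorphisms holds for the elements of the factors and
  defines a subgroup, and the factors generate the group. For normality, the property is that \<open>w\<close> and
  its projection act in the same way on the factor by conjugation.\<close>
lemma (in group) direct_family_imp_projections: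
  assumes fam: "direct_family G n D"
  obtains e where "direct_projections G n D e"
proof -
  have D: "subgroup (D i) G" if "i < n" for i
    using direct_familyD(1)[OF fam that] .
  note comm = direct_familyD(2)[OF fam] and gen = direct_familyD(3)[OF fam]
  have "\<forall>i<n. \<exists>r. r \<in> hom G G \<and> (\<forall>x\<in>D i. r x = x) \<and>
        (\<forall>k<n. k \<noteq> i \<longrightarrow> (\<forall>x\<in>D k. r x = \<one>))"
    using direct_familyD(4)[OF fam] by blast
  then obtain e where "\<forall>i<n. e i \<in> hom G G \<and> (\<forall>x\<in>D i. e i x = x) \<and>
        (\<forall>k<n. k \<noteq> i \<longrightarrow> (\<forall>x\<in>D k. e i x = \<one>))"
    by metis
  then have e: "e i \<in> hom G G" and eid: "x \<in> D i \<Longrightarrow> e i x = x"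
    and e1: "k < n \<Longrightarrow> k \<noteq> i \<Longrightarrow> x \<in> D k \<Longrightarrow> e i x = \<one>" if "i < n" for i k x
    using that by blast+
  have ecl: "e i x \<in> carrier G" if "i < n" "x \<in> carrier G" for i x
    using e[OF that(1)] that(2) by (rule hom_in_carrier)
  have DG: "D i \<subseteq> carrier G" if "i < n" for i
    using D[OF that] by (rule subgroup.subset)
  have everywhere: "carrier G \<subseteq> N" if "subgroup N G" "\<And>i. i < n \<Longrightarrow> D i \<subseteq> N" for N
  proof -
    have "generate G (\<Union>i<n. D i) \<subseteq> N"
      by (rule generate_subgroup_incl) (use that in auto)
    then show ?thesis
      by (simp add: gen)
  qed
  have eD: "e i x \<in> D i" if i: "i < n" and x: "x \<in> carrier G" for i x
  proof -
    interpret h: group_hom G G "e i"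
      using e[OF i] group_axioms by (simp add: group_hom_def group_hom_axioms_def)
    interpret Di: subgroup "D i" G by (rule D[OF i])
    have "subgroup {x \<in> carrier G. e i x \<in> D i} G"
      by (rule subgroup.intro) auto
    moreover have "D k \<subseteq> {x \<in> carrier G. e i x \<in> D i}" if "k < n" for k
      using DG[OF that] eid[OF i] e1[OF i that] by (cases "k = i") auto
    ultimately show ?thesis
      using everywhere x by blast
  qed
  have conj: "w \<otimes> z \<otimes> inv w = e i w \<otimes> z \<otimes> inv (e i w)"
    if i: "i < n" and w: "w \<in> carrier G" and z: "z \<in> D i" for i w z
  proof -
    interpret h: group_hom G G "e i"
      using e[OF i] group_axioms by (simp add: group_hom_def group_hom_axioms_def)
    interpret Di: subgroup "D i" G by (rule D[OF i])
    define N where "N = {w \<in> carrier G. \<forall>z\<in>D i. w \<otimes> z \<otimes> inv w = e i w \<otimes> z \<otimes> inv (e i w)}"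
    have N: "w \<otimes> z \<otimes> inv w = e i w \<otimes> z \<otimes> inv (e i w)" if "w \<in> N" "z \<in> D i" for w z
      using that unfolding N_def by blast
    have "subgroup N G"
    proof (rule subgroup.intro)
      show "N \<subseteq> carrier G" by (auto simp: N_def)
      show "\<one> \<in> N" by (simp add: N_def)
    next
      fix u v assume uv: "u \<in> N" "v \<in> N"
      then have c: "u \<in> carrier G" "v \<in> carrier G" by (auto simp: N_def)
      have "(u \<otimes> v) \<otimes> z \<otimes> inv (u \<otimes> v) = e i (u \<otimes> v) \<otimes> z \<otimes> inv (e i (u \<otimes> v))" if z: "z \<in> D i" for z
      proof -
        have "e i v \<otimes> z \<otimes> inv (e i v) \<in> D i"
          using eD[OF i c(2)] z by auto
        then show ?thesis
          using N[OF uv(1)] N[OF uv(2) z] c z by (simp add: conj_mult)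
      qed
      then show "u \<otimes> v \<in> N" using c by (simp add: N_def)
    next
      fix u assume u: "u \<in> N"
      then have c: "u \<in> carrier G" by (auto simp: N_def)
      have "inv u \<otimes> z \<otimes> inv (inv u) = e i (inv u) \<otimes> z \<otimes> inv (e i (inv u))" if z: "z \<in> D i" for z
      proof -
        let ?z = "inv (e i u) \<otimes> z \<otimes> e i u"
        have z': "?z \<in> D i"
          using eD[OF i c] z by auto
        have "u \<otimes> ?z \<otimes> inv u = e i u \<otimes> ?z \<otimes> inv (e i u)"
          by (rule N[OF u z'])
        also have "\<dots> = z"
          using c z by (simp add: m_assoc) (simp flip: m_assoc)
        finally have "inv u \<otimes> (u \<otimes> ?z \<otimes> inv u) \<otimes> u = inv u \<otimes> z \<otimes> u"
          by simp
        moreover have "inv u \<otimes> (u \<otimes> ?z \<otimes> inv u) \<otimes> u = ?z"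
          using c Di.mem_carrier[OF z'] by (simp add: m_assoc) (simp flip: m_assoc)
        ultimately show ?thesis
          using c by simp
      qed
      then show "inv u \<in> N" using c by (simp add: N_def)
    qed
    moreover have "D k \<subseteq> N" if k: "k < n" for k
    proof
      fix u assume u: "u \<in> D k"
      then have c: "u \<in> carrier G" using DG[OF k] by blast
      show "u \<in> N"
      proof (cases "k = i")
        case True
        then show ?thesis using c u eid[OF i] by (simp add: N_def)
      next
        case False
        have "u \<otimes> z \<otimes> inv u = z" if z: "z \<in> D i" for z
          using comm[OF k i False u z] c Di.mem_carrier[OF z] by (simp add: m_assoc)
        then show ?thesis
          using c e1[OF i k False u] by (simp add: N_def)
      qed
    qed
    ultimately have "w \<in> N"
      using everywhere w by blast
    then show ?thesis using N z by blast
  qed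
  have ne: "normal_endo G (e i)" if i: "i < n" for i
    unfolding normal_endo_def
  proof (intro conjI ballI)
    interpret h: group_hom G G "e i"
      using e[OF i] group_axioms by (simp add: group_hom_def group_hom_axioms_def)
    fix x y assume xy: "x \<in> carrier G" "y \<in> carrier G"
    have "x \<otimes> e i y \<otimes> inv x = e i x \<otimes> e i y \<otimes> inv (e i x)"
      by (rule conj[OF i xy(1) eD[OF i xy(2)]])
    moreover have "e i (x \<otimes> y \<otimes> inv x) = e i x \<otimes> e i y \<otimes> inv (e i x)"
      using xy by (simp only: h.hom_mult h.hom_inv m_closed inv_closed)
    ultimately show "e i (x \<otimes> y \<otimes> inv x) = x \<otimes> e i y \<otimes> inv x"
      by (rule trans[OF _ sym, rotated])
  qed (rule e[OF i])
  let ?p = "pointwise_prod G e [0..<n]"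
  have "normal_endo G ?p"
    by (rule normal_endo_pointwise_prod(1)[of n e D]) (use ne eD DG comm in auto)
  then have "?p \<in> hom G G" "(\<lambda>x. x) \<in> hom G G"
    by (auto simp: normal_endo_def hom_def)
  from equaliser_subgroup[OF this is_group] have "subgroup {x \<in> carrier G. ?p x = x} G" .
  moreover have "D i \<subseteq> {x \<in> carrier G. ?p x = x}" if i: "i < n" for i
  proof
    fix x assume x: "x \<in> D i"
    have "?p x = (if i \<in> set [0..<n] then x else \<one>)"
      by (rule pointwise_prod_single) (use DG[OF i] x eid[OF i] e1 i in auto)
    then show "x \<in> {x \<in> carrier G. ?p x = x}"
      using i x DG[OF i] by auto
  qed
  ultimately have "carrier G \<subseteq> {x \<in> carrier G. ?p x = x}"
    by (rule everywhere)
  then have all: "?p x = x" if "x \<in> carrier G" for x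
    using that by blast
  have "direct_projections G n D e"
    unfolding direct_projections_def
    by (intro conjI allI impI ballI) (simp_all only: D ne eD eid e1 all not_False_eq_True)
  then show ?thesis by (rule that)
qed

text \<open>The conjugate of \<open>y\<close> by \<open>x\<close> stays in \<open>D k\<close> by normality, so that projecting to \<open>D k\<close> does not change it; but
  the projection kills \<open>x\<close>.\<close>
lemma (in group) direct_projections_commute:
  assumes proj: "direct_projections G n D e"
    and ik: "i < n" "k < n" "i \<noteq> k" and x: "x \<in> D i" and y: "y \<in> D k"
  shows "x \<otimes> y = y \<otimes> x"
proof -
  have Di: "subgroup (D i) G" and Dk: "subgroup (D k) G" and e: "normal_endo G (e k)"
    and eid: "e k y = y" and e1: "e k x = \<one>"
    using proj ik x y unfolding direct_projections_def by simp_all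
  note es = normal_endo_simps[OF e]
  have c: "x \<in> carrier G" "y \<in> carrier G"
    using x y Di Dk by (auto dest: subgroup.mem_carrier)
  have "x \<otimes> y \<otimes> inv x = e k (x \<otimes> y \<otimes> inv x)"
    using es(5)[OF c] eid by simp
  also have "\<dots> = y"
    using c eid e1 by (simp add: es(2,4))
  finally show ?thesis
    using c by (metis inv_solve_right' m_closed)
qed

lemma (in group) direct_family_iso_image:
  assumes fam: "direct_family G n D" and phi: "\<phi> \<in> iso G G"
  shows "direct_family G n (\<lambda>i. \<phi> ` D i)"
proof -
  interpret h: group_hom G G \<phi>
    using phi group_axioms by (simp add: group_hom_def group_hom_axioms_def iso_def)
  have inv: "inv_into (carrier G) \<phi> \<in> iso G G"
    using phi by (rule iso_set_sym)
  have bij: "bij_betw \<phi> (carrier G) (carrier G)"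
    using phi by (simp add: iso_def)
  have DG: "D i \<subseteq> carrier G" if "i < n" for i
    using direct_familyD(1)[OF fam that] by (rule subgroup.subset)
  have U: "(\<Union>i<n. D i) \<subseteq> carrier G"
    using DG by blast
  have inv_phi: "inv_into (carrier G) \<phi> (\<phi> x) = x" if "x \<in> carrier G" for x
    using bij that by (simp add: bij_betw_def)
  have "generate G (\<Union>i<n. \<phi> ` D i) = generate G (\<phi> ` (\<Union>i<n. D i))"
    by (simp add: image_UN)
  also have "\<dots> = \<phi> ` carrier G"
    using h.generate_img[OF U] direct_familyD(3)[OF fam] by simp
  finally have "generate G (\<Union>i<n. \<phi> ` D i) = carrier G"
    using bij by (simp add: bij_betw_def)
  moreover have "subgroup (\<phi> ` D i) G" if "i < n" for i
    using direct_familyD(1)[OF fam that] by (rule h.subgroup_img_is_subgroup)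
  moreover have "\<phi> x \<otimes> \<phi> y = \<phi> y \<otimes> \<phi> x"
    if "i < n" "k < n" "i \<noteq> k" "x \<in> D i" "y \<in> D k" for i k x y
  proof -
    have "x \<otimes> y = y \<otimes> x"
      using direct_familyD(2)[OF fam that] .
    moreover have "x \<in> carrier G" "y \<in> carrier G"
      using that DG by blast+
    ultimately show ?thesis
      by (metis h.hom_mult)
  qed
  moreover have "\<exists>r\<in>hom G G. (\<forall>x\<in>\<phi> ` D i. r x = x) \<and>
      (\<forall>k<n. k \<noteq> i \<longrightarrow> (\<forall>x\<in>\<phi> ` D k. r x = \<one>))" if i: "i < n" for i
  proof -
    obtain r where r: "r \<in> hom G G" "\<forall>x\<in>D i. r x = x"
      "\<forall>k<n. k \<noteq> i \<longrightarrow> (\<forall>x\<in>D k. r x = \<one>)"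
      using direct_familyD(4)[OF fam i] by blast
    have "\<phi> \<circ> r \<circ> inv_into (carrier G) \<phi> \<in> hom G G"
      by (rule Group.hom_compose[OF iso_imp_homomorphism[OF inv] Group.hom_compose[OF r(1) h.homh]])
    moreover have "(\<phi> \<circ> r \<circ> inv_into (carrier G) \<phi>) (\<phi> x) = \<phi> (r x)" if "k < n" "x \<in> D k" for k x
      using inv_phi[of x] subsetD[OF DG[OF that(1)] that(2)] by simp
    ultimately show ?thesis
      using r(2,3) i by (intro bexI[of _ "\<phi> \<circ> r \<circ> inv_into (carrier G) \<phi>"]) auto
  qed
  ultimately show ?thesis
    unfolding direct_family_def by (intro conjI allI impI) blast+
qed

lemma (in group) central_automorphism_comp:
  assumes "central_automorphism G \<phi>" "central_automorphism G \<psi>"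
  shows "central_automorphism G (\<psi> \<circ> \<phi>)"
proof -
  have iso: "\<phi> \<in> iso G G" "\<psi> \<in> iso G G"
    using assms by (auto simp: central_automorphism_def)
  have "inv g \<otimes> (\<psi> \<circ> \<phi>) g \<in> group_center G" if g: "g \<in> carrier G" for g
  proof -
    have c: "\<phi> g \<in> carrier G" "\<psi> (\<phi> g) \<in> carrier G"
      using iso g by (auto simp: iso_def hom_def)
    have z: "inv g \<otimes> \<phi> g \<in> group_center G" "inv (\<phi> g) \<otimes> \<psi> (\<phi> g) \<in> group_center G"
      using assms g c by (auto simp: central_automorphism_def)
    have "inv g \<otimes> \<psi> (\<phi> g) = (inv g \<otimes> \<phi> g) \<otimes> (inv (\<phi> g) \<otimes> \<psi> (\<phi> g))"
      using g c by (simp add: m_assoc) (simp flip: m_assoc)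
    moreover have "x \<otimes> y \<in> group_center G" if xy: "x \<in> group_center G" "y \<in> group_center G" for x y
    proof -
      have c: "x \<in> carrier G" "y \<in> carrier G"
        and z: "\<And>g. g \<in> carrier G \<Longrightarrow> g \<otimes> x = x \<otimes> g" "\<And>g. g \<in> carrier G \<Longrightarrow> g \<otimes> y = y \<otimes> g"
        using xy unfolding group_center_def by auto
      show ?thesis
        unfolding group_center_def
      proof (intro CollectI conjI ballI)
        fix g assume g: "g \<in> carrier G"
        show "x \<otimes> y \<otimes> g = g \<otimes> (x \<otimes> y)"
          using commute_mult[OF g c z(1)[OF g] z(2)[OF g]] by (rule sym)
      qed (use c in simp)
    qed
    ultimately show ?thesis
      using z by simp
  qed
  moreover have "\<psi> \<circ> \<phi> \<in> iso G G"
    using iso iso_set_trans by blast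
  ultimately show ?thesis
    by (simp add: central_automorphism_def)
qed

text \<open>On \<open>P\<close> the map \<open>\<pi>\<close> after the sum of the \<open>\<epsilon> j\<close> is a sum of normal endomorphisms \<open>\<pi> \<circ> \<epsilon> j\<close> of \<open>P\<close> with
  commuting images. Splitting off one summand at a time leads to a bijective one, as the empty sum is
  not bijective.\<close>
lemma (in group) exchange_bijective:
  assumes proj: "direct_projections G m E \<epsilon>"
    and pi: "normal_endo G \<pi>" "\<And>x. x \<in> carrier G \<Longrightarrow> \<pi> x \<in> P"
    and P: "subgroup P G" "P \<noteq> {\<one>}" and loc: "local_endos (G\<lparr>carrier := P\<rparr>)"
    and js: "distinct js" "set js \<subseteq> {..<m}"
    and bij: "bij_betw (\<lambda>x. \<pi> (pointwise_prod G \<epsilon> js x)) P P"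
  shows "\<exists>j<m. bij_betw (\<lambda>x. \<pi> (\<epsilon> j x)) P P"
  using js bij
proof (induction js)
  case Nil
  interpret P: subgroup P G by (rule P(1))
  have "(\<lambda>x. \<one>) ` P = P"
    using Nil(3) normal_endo_simps(3)[OF pi(1)] by (simp add: bij_betw_def)
  then show ?case
    using P(2) P.one_closed by auto
next
  case (Cons j js)
  interpret P: subgroup P G by (rule P(1))
  interpret GP: group "G\<lparr>carrier := P\<rparr>" by (rule P.subgroup_is_group) (rule is_group)
  have E: "subgroup (E i) G" "normal_endo G (\<epsilon> i)" "x \<in> carrier G \<Longrightarrow> \<epsilon> i x \<in> E i"
    "x \<in> E i \<Longrightarrow> \<epsilon> i x = x" "k < m \<Longrightarrow> k \<noteq> i \<Longrightarrow> x \<in> E k \<Longrightarrow> \<epsilon> i x = \<one>"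
    if "i < m" for i k x
    using proj that unfolding direct_projections_def by simp_all
  have EG: "E i \<subseteq> carrier G" if "i < m" for i
    using E(1)[OF that] by (rule subgroup.subset)
  have comm: "x \<otimes> y = y \<otimes> x" if "i < m" "k < m" "i \<noteq> k" "x \<in> E i" "y \<in> E k" for i k x y
    using direct_projections_commute[OF proj] that by blast
  have j: "j < m" "j \<notin> set js" and js: "distinct js" "set js \<subseteq> {..<m}"
    using Cons.prems by auto
  let ?p = "pointwise_prod G \<epsilon> js"
  have p: "normal_endo G ?p"
    by (rule normal_endo_pointwise_prod(1)[of m \<epsilon> E]) (use E(2,3) EG comm js in auto)
  have pc: "z \<otimes> ?p x = ?p x \<otimes> z" if "z \<in> E j" "x \<in> carrier G" for z x
    by (rule normal_endo_pointwise_prod(2)[of m \<epsilon> E js j]) (use E(2,3) EG comm js j that in auto)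
  have restrict: "normal_endo (G\<lparr>carrier := P\<rparr>) (\<lambda>x. \<pi> (f x))" if f: "normal_endo G f" for f
  proof -
    note fs = normal_endo_simps[OF normal_endo_comp[OF pi(1) f]]
    show ?thesis
      unfolding normal_endo_def
    proof (intro conjI ballI homI)
      fix x y assume "x \<in> carrier (G\<lparr>carrier := P\<rparr>)" "y \<in> carrier (G\<lparr>carrier := P\<rparr>)"
      then have xy: "x \<in> P" "y \<in> P" "x \<in> carrier G" "y \<in> carrier G" by auto
      show "\<pi> (f x) \<in> carrier (G\<lparr>carrier := P\<rparr>)"
        using pi(2) normal_endo_simps(1)[OF f] xy by simp
      show "\<pi> (f (x \<otimes>\<^bsub>G\<lparr>carrier := P\<rparr>\<^esub> y)) = \<pi> (f x) \<otimes>\<^bsub>G\<lparr>carrier := P\<rparr>\<^esub> \<pi> (f y)"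
        using fs(2) xy by simp
      have "inv\<^bsub>G\<lparr>carrier := P\<rparr>\<^esub> x = inv x"
        using m_inv_consistent[OF P(1) xy(1)] .
      then show "\<pi> (f (x \<otimes>\<^bsub>G\<lparr>carrier := P\<rparr>\<^esub> y \<otimes>\<^bsub>G\<lparr>carrier := P\<rparr>\<^esub> inv\<^bsub>G\<lparr>carrier := P\<rparr>\<^esub> x)) =
          x \<otimes>\<^bsub>G\<lparr>carrier := P\<rparr>\<^esub> \<pi> (f y) \<otimes>\<^bsub>G\<lparr>carrier := P\<rparr>\<^esub> inv\<^bsub>G\<lparr>carrier := P\<rparr>\<^esub> x"
        using fs(5)[OF xy(3,4)] by simp
    qed
  qed
  have pis: "\<pi> (x \<otimes> y) = \<pi> x \<otimes> \<pi> y" if "x \<in> carrier G" "y \<in> carrier G" for x y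
    using normal_endo_simps(2)[OF pi(1)] that .
  have ec: "\<epsilon> j x \<in> carrier G" "?p x \<in> carrier G" if "x \<in> carrier G" for x
    using normal_endo_simps(1)[OF E(2)[OF j(1)]] normal_endo_simps(1)[OF p] that by auto
  have "bij_betw (\<lambda>x. \<pi> (\<epsilon> j x)) (carrier (G\<lparr>carrier := P\<rparr>)) (carrier (G\<lparr>carrier := P\<rparr>)) \<or>
      bij_betw (\<lambda>x. \<pi> (?p x)) (carrier (G\<lparr>carrier := P\<rparr>)) (carrier (G\<lparr>carrier := P\<rparr>))"
  proof (rule GP.local_endos_bij[OF loc restrict[OF E(2)[OF j(1)]] restrict[OF p]])
    fix x y assume "x \<in> carrier (G\<lparr>carrier := P\<rparr>)" "y \<in> carrier (G\<lparr>carrier := P\<rparr>)"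
    then have xy: "x \<in> carrier G" "y \<in> carrier G" by auto
    have "\<epsilon> j x \<otimes> ?p y = ?p y \<otimes> \<epsilon> j x"
      by (rule pc[OF E(3)[OF j(1) xy(1)] xy(2)])
    then have "\<pi> (\<epsilon> j x) \<otimes> \<pi> (?p y) = \<pi> (?p y) \<otimes> \<pi> (\<epsilon> j x)"
      using pis ec xy by metis
    then show "\<pi> (\<epsilon> j x) \<otimes>\<^bsub>G\<lparr>carrier := P\<rparr>\<^esub> \<pi> (?p y) = \<pi> (?p y) \<otimes>\<^bsub>G\<lparr>carrier := P\<rparr>\<^esub> \<pi> (\<epsilon> j x)"
      by simp
  next
    have "bij_betw (\<lambda>x. \<pi> (\<epsilon> j x) \<otimes> \<pi> (?p x)) P P"
    proof (rule bij_betw_cong[THEN iffD1, OF _ Cons.prems(3)])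
      fix x assume "x \<in> P"
      then have "x \<in> carrier G" by simp
      then show "\<pi> (pointwise_prod G \<epsilon> (j # js) x) = \<pi> (\<epsilon> j x) \<otimes> \<pi> (?p x)"
        using pis ec by simp
    qed
    then show "bij_betw (\<lambda>x. \<pi> (\<epsilon> j x) \<otimes>\<^bsub>G\<lparr>carrier := P\<rparr>\<^esub> \<pi> (?p x))
        (carrier (G\<lparr>carrier := P\<rparr>)) (carrier (G\<lparr>carrier := P\<rparr>))"
      by simp
  qed
  then show ?case
    using j(1) Cons.IH[OF js] by auto
qed

text \<open>Here \<open>j\<close> is chosen such that \<open>\<pi> \<circ> \<epsilon> j\<close> is bijective on \<open>P = D k\<close>, where \<open>\<pi>\<close> is the projection onto \<open>P\<close>. Then
  \<open>E j\<close> is the direct product of \<open>\<epsilon> j P\<close> and the kernel of \<open>\<pi>\<close> in \<open>E j\<close>, so the latter is trivial and \<open>\<pi>\<close>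
  restricts to an isomorphism from \<open>E j\<close> to \<open>P\<close>. With \<open>\<tau>\<close> its inverse, the automorphism is
  \<open>x \<mapsto> \<tau> (\<pi> x) (\<pi> x)\<^sup>-\<^sup>1 x\<close>. The last conclusion says that a
  factor \<open>E j\<close> which already occurs among the \<open>D i\<close> is not found a second time.\<close>
lemma (in group) exchange:
  assumes D: "direct_family G n D" and E: "direct_family G m E"
    and ind: "\<forall>j<m. E j \<noteq> {\<one>} \<and> indecomposable (G\<lparr>carrier := E j\<rparr>)"
    and k: "k < n" and Dk: "D k \<noteq> {\<one>}" "local_endos (G\<lparr>carrier := D k\<rparr>)"
  shows "\<exists>j<m. \<exists>\<psi>. central_automorphism G \<psi> \<and> \<psi> ` D k = E j \<and>
    (\<forall>i<n. i \<noteq> k \<longrightarrow> (\<forall>x\<in>D i. \<psi> x = x) \<and> D i \<noteq> E j)"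
proof -
  obtain e where e: "direct_projections G n D e"
    using direct_family_imp_projections[OF D] .
  obtain \<epsilon> where \<epsilon>: "direct_projections G m E \<epsilon>"
    using direct_family_imp_projections[OF E] .
  define P where "P = D k"
  define \<pi> where "\<pi> = e k"
  have P: "subgroup P G" and pi: "normal_endo G \<pi>" and piP: "\<And>x. x \<in> carrier G \<Longrightarrow> \<pi> x \<in> P"
    and pi_id: "\<And>x. x \<in> P \<Longrightarrow> \<pi> x = x"
    and pi_one: "\<And>i x. i < n \<Longrightarrow> i \<noteq> k \<Longrightarrow> x \<in> D i \<Longrightarrow> \<pi> x = \<one>"
    using e k unfolding direct_projections_def P_def \<pi>_def by simp_all
  interpret P: subgroup P G by (rule P)
  have all: "pointwise_prod G \<epsilon> [0..<m] x = x" if "x \<in> carrier G" for x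
    using \<epsilon> that unfolding direct_projections_def by simp
  have "bij_betw (\<lambda>x. \<pi> (pointwise_prod G \<epsilon> [0..<m] x)) P P"
    by (rule bij_betw_cong[THEN iffD1, OF _ bij_betw_id]) (simp add: all pi_id)
  then have "\<exists>j<m. bij_betw (\<lambda>x. \<pi> (\<epsilon> j x)) P P"
    by (intro exchange_bijective[OF \<epsilon> pi piP P Dk[folded P_def]]) auto
  then obtain j where j: "j < m" and bij: "bij_betw (\<lambda>x. \<pi> (\<epsilon> j x)) P P"
    by blast
  have Ej: "subgroup (E j) G" and ej: "normal_endo G (\<epsilon> j)"
    and ejE: "\<And>x. x \<in> carrier G \<Longrightarrow> \<epsilon> j x \<in> E j"
    using \<epsilon> j unfolding direct_projections_def by simp_all
  interpret Ej: subgroup "E j" G by (rule Ej)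
  interpret GE: group "G\<lparr>carrier := E j\<rparr>" by (rule Ej.subgroup_is_group) (rule is_group)
  note pis = normal_endo_simps[OF pi] and ejs = normal_endo_simps[OF ej]
  have ker_comm: "q \<otimes> p = p \<otimes> q" if q: "q \<in> carrier G" "\<pi> q = \<one>" and p: "p \<in> P" for p q
  proof -
    have pc: "p \<in> carrier G" using p by simp
    have "q \<otimes> p \<otimes> inv q = \<pi> (q \<otimes> p \<otimes> inv q)"
      using pis(5)[OF q(1) pc] pi_id[OF p] by simp
    also have "\<dots> = \<pi> q \<otimes> \<pi> p \<otimes> inv (\<pi> q)"
      using q(1) pc by (simp only: pis(2,4) m_closed inv_closed)
    also have "\<dots> = p"
      using q(2) pc pi_id[OF p] by simp
    finally show ?thesis
      using q(1) pc by (metis inv_solve_right' m_closed)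
  qed
  have ker_comm_ej: "q \<otimes> \<epsilon> j p = \<epsilon> j p \<otimes> q"
    if q: "q \<in> carrier G" "\<pi> q = \<one>" and p: "p \<in> P" for p q
    by (rule normal_endo_commute[OF ej q(1) _ ker_comm[OF q p]]) (use p in simp)
  let ?A = "\<epsilon> j ` P" and ?B = "{x \<in> E j. \<pi> x = \<one>}"
  have "complementary (G\<lparr>carrier := E j\<rparr>) ?A ?B"
    unfolding complementary_def
  proof (intro conjI ballI)
    have "group_hom G G (\<epsilon> j)"
      using ej group_axioms by (simp add: normal_endo_def group_hom_def group_hom_axioms_def)
    then have "subgroup ?A G"
      using P by (rule group_hom.subgroup_img_is_subgroup)
    then show "subgroup ?A (G\<lparr>carrier := E j\<rparr>)"
      by (rule subgroup_incl[OF _ Ej]) (use ejE in auto)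
    have "subgroup ?B G"
      by (rule subgroup.intro) (auto simp: pis)
    then show "subgroup ?B (G\<lparr>carrier := E j\<rparr>)"
      by (rule subgroup_incl[OF _ Ej]) auto
  next
    fix a b assume "a \<in> ?A" "b \<in> ?B"
    then show "a \<otimes>\<^bsub>G\<lparr>carrier := E j\<rparr>\<^esub> b = b \<otimes>\<^bsub>G\<lparr>carrier := E j\<rparr>\<^esub> a"
      using ker_comm_ej[of b] by auto
  next
    have "x = \<one>" if "p \<in> P" "x = \<epsilon> j p" "\<pi> x = \<one>" for p x
    proof -
      have "\<pi> (\<epsilon> j p) = \<pi> (\<epsilon> j \<one>)"
        using that by (simp add: ejs(3) pis(3))
      then have "p = \<one>"
        using bij that(1) P.one_closed unfolding bij_betw_def inj_on_def by blast
      then show ?thesis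
        using that by (simp add: ejs(3))
    qed
    moreover have "\<one> \<in> ?A"
      using P.one_closed ejs(3) by (metis imageI)
    moreover have "\<one> \<in> ?B"
      using pis(3) Ej.one_closed by simp
    ultimately have "?A \<inter> ?B = {\<one>}"
      by blast
    then show "?A \<inter> ?B = {\<one>\<^bsub>G\<lparr>carrier := E j\<rparr>\<^esub>}"
      by simp
  next
    fix x assume "x \<in> carrier (G\<lparr>carrier := E j\<rparr>)"
    then have x: "x \<in> E j" "x \<in> carrier G" by auto
    then have "\<pi> x \<in> (\<lambda>x. \<pi> (\<epsilon> j x)) ` P"
      using piP bij by (simp add: bij_betw_def)
    then obtain p where p: "p \<in> P" "\<pi> x = \<pi> (\<epsilon> j p)" by blast
    have pc: "\<epsilon> j p \<in> E j" "\<epsilon> j p \<in> carrier G"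
      using p ejE Ej.mem_carrier by auto
    have "inv (\<epsilon> j p) \<otimes> x \<in> ?B"
      using pc x p by (simp add: pis(2,4) pis(1))
    moreover have "x = \<epsilon> j p \<otimes> (inv (\<epsilon> j p) \<otimes> x)"
      using pc x by (simp flip: m_assoc)
    ultimately show "\<exists>a\<in>?A. \<exists>b\<in>?B. x = a \<otimes>\<^bsub>G\<lparr>carrier := E j\<rparr>\<^esub> b"
      using p(1) by auto
  qed
  then have "?A = {\<one>} \<or> ?B = {\<one>}"
    using ind j GE.indecomposable_iff by auto
  moreover have "?A \<noteq> {\<one>}"
  proof
    assume "?A = {\<one>}"
    then have "\<epsilon> j x = \<one>" if "x \<in> P" for x
      using that by blast
    then have "P = (\<lambda>x. \<one>) ` P"
      using bij pis(3) by (simp add: bij_betw_def)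
    then show False
      using Dk(1) P.one_closed unfolding P_def by auto
  qed
  ultimately have B: "?B = {\<one>}" by blast
  have inj: "g = g'" if g: "g \<in> E j" "g' \<in> E j" "\<pi> g = \<pi> g'" for g g'
  proof -
    have c: "g \<in> carrier G" "g' \<in> carrier G"
      using g by auto
    then have "\<pi> (g \<otimes> inv g') = \<one>"
      using g pis(1) by (simp add: pis(2,4))
    then have "g \<otimes> inv g' = \<one>"
      using B g by blast
    then show ?thesis
      using c by (metis inv_closed inv_equality inv_inv)
  qed
  have "\<exists>g. g \<in> ?A \<and> \<pi> g = p" if "p \<in> P" for p
  proof -
    have "p \<in> (\<lambda>x. \<pi> (\<epsilon> j x)) ` P"
      using bij that by (simp add: bij_betw_def)
    then show ?thesis by blast
  qed
  then obtain \<tau> where \<tau>: "\<And>p. p \<in> P \<Longrightarrow> \<tau> p \<in> ?A \<and> \<pi> (\<tau> p) = p"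
    by metis
  have \<tau>E: "\<tau> p \<in> E j" if "p \<in> P" for p
    using \<tau>[OF that] ejE by auto
  \<comment> \<open>The factor \<open>d x\<close> by which \<open>\<psi>\<close> moves \<open>x\<close> lies in the kernel of \<open>\<pi>\<close>, hence commutes with \<open>P\<close>; it is a product
    of elements of \<open>\<epsilon> j P\<close> and of \<open>P\<close>, hence commutes with the kernel of \<open>\<pi>\<close>. So it is central.\<close>
  define d where "d x = \<tau> (\<pi> x) \<otimes> inv (\<pi> x)" for x
  have dc: "d x \<in> carrier G" and pid: "\<pi> (d x) = \<one>" if x: "x \<in> carrier G" for x
  proof -
    have "\<tau> (\<pi> x) \<in> carrier G" "\<pi> x \<in> carrier G" "\<pi> (\<tau> (\<pi> x)) = \<pi> x" "\<pi> (\<pi> x) = \<pi> x"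
      using \<tau>E[OF piP[OF x]] \<tau>[OF piP[OF x]] pis(1)[OF x] pi_id[OF piP[OF x]] by auto
    then show "d x \<in> carrier G" "\<pi> (d x) = \<one>"
      by (simp_all add: d_def pis(2,4))
  qed
  have dcomm: "d x \<otimes> y = y \<otimes> d x" if x: "x \<in> carrier G" and y: "y \<in> carrier G" for x y
  proof -
    define p where "p = \<pi> y"
    define q where "q = inv p \<otimes> y"
    have p: "p \<in> P" "p \<in> carrier G" and "\<pi> p = p"
      using piP[OF y] pi_id by (auto simp: p_def)
    then have q: "q \<in> carrier G" "\<pi> q = \<one>" and yq: "y = p \<otimes> q"
      using y by (simp_all add: q_def pis(2,4) p_def flip: m_assoc)
    obtain p' where p': "p' \<in> P" "\<tau> (\<pi> x) = \<epsilon> j p'"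
      using \<tau>[OF piP[OF x]] by blast
    have c: "\<tau> (\<pi> x) \<in> carrier G" "inv (\<pi> x) \<in> carrier G" and P': "inv (\<pi> x) \<in> P"
      using \<tau>E[OF piP[OF x]] pis(1)[OF x] piP[OF x] by auto
    have "q \<otimes> d x = d x \<otimes> q"
      unfolding d_def
      by (rule commute_mult[OF q(1) c])
        (use ker_comm_ej[OF q p'(1)] p'(2) ker_comm[OF q P'] in auto)
    moreover have "p \<otimes> d x = d x \<otimes> p"
      using ker_comm[OF dc[OF x] pid[OF x] p(1)] by simp
    ultimately show ?thesis
      unfolding yq using commute_mult[OF dc[OF x] p(2) q(1)] by simp
  qed
  have dmult: "d (x \<otimes> y) = d x \<otimes> d y" if x: "x \<in> carrier G" and y: "y \<in> carrier G" for x y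
  proof -
    have c: "\<pi> x \<in> carrier G" "\<pi> y \<in> carrier G" "\<tau> (\<pi> x) \<in> E j" "\<tau> (\<pi> y) \<in> E j"
      using \<tau>E piP x y by auto
    have "\<tau> (\<pi> x \<otimes> \<pi> y) = \<tau> (\<pi> x) \<otimes> \<tau> (\<pi> y)"
      by (rule inj) (use c \<tau>E \<tau> piP x y pis(2) in auto)
    then have "d (x \<otimes> y) = \<tau> (\<pi> x) \<otimes> d y \<otimes> inv (\<pi> x)"
      using x y c by (simp add: d_def pis(2) inv_mult_group m_assoc)
    also have "\<dots> = d x \<otimes> d y"
      using dcomm[OF y, of "inv (\<pi> x)"] c dc[OF y] by (simp add: d_def m_assoc)
    finally show ?thesis .
  qed
  define \<psi> where "\<psi> x = d x \<otimes> x" for x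
  have psi_pi: "\<pi> (\<psi> x) = \<pi> x" if "x \<in> carrier G" for x
    using that dc pid pis(1) by (simp add: \<psi>_def pis(2))
  have d_pi: "d x = d y" if "\<pi> x = \<pi> y" for x y
    using that by (simp add: d_def)
  have d_one: "d x = \<one>" if "x \<in> carrier G" "\<pi> x = \<one>" for x
  proof -
    have "d x \<otimes> d x = d x"
      using dmult[of \<one> \<one>] d_pi[of x \<one>] that pis(3) by simp
    then show ?thesis
      using dc[OF that(1)] by (metis r_cancel_one)
  qed
  have psi_ker: "\<psi> x = x" if "x \<in> carrier G" "\<pi> x = \<one>" for x
    using that d_one by (simp add: \<psi>_def)
  have "\<psi> \<in> hom G G"
  proof (rule homI)
    fix x y assume xy: "x \<in> carrier G" "y \<in> carrier G"
    have "d x \<otimes> d y \<otimes> (x \<otimes> y) = d x \<otimes> (d y \<otimes> x) \<otimes> y"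
      using xy dc by (simp add: m_assoc)
    then show "\<psi> (x \<otimes> y) = \<psi> x \<otimes> \<psi> y"
      using xy dc dmult dcomm[OF xy(2,1)] by (simp add: \<psi>_def m_assoc)
  qed (simp add: \<psi>_def dc)
  moreover have "inj_on \<psi> (carrier G)"
  proof (rule inj_onI)
    fix x y assume xy: "x \<in> carrier G" "y \<in> carrier G" "\<psi> x = \<psi> y"
    then have "d x = d y"
      using psi_pi by (metis d_pi)
    then show "x = y"
      using xy dc by (simp add: \<psi>_def)
  qed
  moreover have "y \<in> \<psi> ` carrier G" if y: "y \<in> carrier G" for y
  proof
    have "\<pi> (inv (d y) \<otimes> y) = \<pi> y"
      using y dc pid pis(1) by (simp add: pis(2,4))
    then have "d (inv (d y) \<otimes> y) = d y"
      by (rule d_pi)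
    then show "y = \<psi> (inv (d y) \<otimes> y)"
      using y dc by (simp add: \<psi>_def flip: m_assoc)
  qed (use y dc in simp)
  ultimately have iso: "\<psi> \<in> iso G G"
    by (auto simp: iso_def bij_betw_def \<psi>_def dc)
  moreover have "inv x \<otimes> \<psi> x \<in> group_center G" if x: "x \<in> carrier G" for x
  proof -
    have "inv x \<otimes> \<psi> x = d x"
      using x dc dcomm[OF x x] by (simp add: \<psi>_def flip: m_assoc)
    then show ?thesis
      using dc[OF x] dcomm[OF x] by (simp add: group_center_def)
  qed
  ultimately have "central_automorphism G \<psi>"
    by (simp add: central_automorphism_def)
  moreover have "\<psi> ` D k = E j"
  proof -
    have psi_tau: "\<psi> p = \<tau> p" if p: "p \<in> P" for p
      using p \<tau>E[OF p] pi_id[OF p] by (simp add: \<psi>_def d_def m_assoc)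
    have "g \<in> \<tau> ` P" if g: "g \<in> E j" for g
    proof
      show "\<pi> g \<in> P" using g piP by simp
      then show "g = \<tau> (\<pi> g)"
        using inj[OF g \<tau>E] \<tau> by simp
    qed
    then show ?thesis
      using \<tau>E psi_tau unfolding P_def[symmetric] by force
  qed
  moreover have "\<psi> x = x" if "i < n" "i \<noteq> k" "x \<in> D i" for i x
    using psi_ker[of x] pi_one[OF that] that subgroup.mem_carrier[OF direct_familyD(1)[OF D that(1)]]
    by simp
  moreover have "D i \<noteq> E j" if i: "i < n" "i \<noteq> k" for i
  proof
    assume "D i = E j"
    then have "E j = ?B"
      using pi_one[OF i] by auto
    then show False
      using B ind j by simp
  qed
  ultimately show ?thesis
    using j by blast
qed

text \<open>The factors \<open>D 0\<close>, \<open>D 1\<close>, \<dots> are exchanged one after the other, while the automorphism found so far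
  fixes the factors that are still to be exchanged. No \<open>E j\<close> can be left over at the end, because the
  factors already used generate the group and are killed by the projection to \<open>E j\<close>.\<close>
theorem (in group) krull_remak_schmidt:
  assumes D: "direct_family G n D" and E: "direct_family G m E"
    and loc: "\<forall>i<n. D i \<noteq> {\<one>} \<and> local_endos (G\<lparr>carrier := D i\<rparr>)"
    and ind: "\<forall>j<m. E j \<noteq> {\<one>} \<and> indecomposable (G\<lparr>carrier := E j\<rparr>)"
  shows "m = n \<and> (\<exists>\<sigma> \<phi>. \<sigma> permutes {..<m} \<and> central_automorphism G \<phi> \<and> (\<forall>i<n. \<phi> ` D i = E (\<sigma> i)))"
proof -
  have DG: "D i \<subseteq> carrier G" if "i < n" for i
    using direct_familyD(1)[OF D that] by (rule subgroup.subset)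
  have "\<exists>\<phi> \<iota>. central_automorphism G \<phi> \<and> (\<forall>i<k. \<iota> i < m \<and> \<phi> ` D i = E (\<iota> i)) \<and>
      inj_on \<iota> {..<k} \<and> (\<forall>i<n. k \<le> i \<longrightarrow> \<phi> ` D i = D i)" if "k \<le> n" for k
    using that
  proof (induction k)
    case 0
    have "central_automorphism G (\<lambda>x. x)"
      by (simp add: central_automorphism_def group_center_def iso_set_refl)
    then show ?case
      by (intro exI[of _ "\<lambda>x. x"] exI) auto
  next
    case (Suc k)
    then have k: "k < n" by simp
    obtain \<phi> \<iota> where \<phi>: "central_automorphism G \<phi>"
      and \<iota>: "\<forall>i<k. \<iota> i < m \<and> \<phi> ` D i = E (\<iota> i)" "inj_on \<iota> {..<k}"
      and fixed: "\<forall>i<n. k \<le> i \<longrightarrow> \<phi> ` D i = D i"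
      using Suc by auto
    have fam: "direct_family G n (\<lambda>i. \<phi> ` D i)"
      using direct_family_iso_image[OF D] \<phi> by (simp add: central_automorphism_def)
    have "\<phi> ` D k = D k"
      using fixed k by simp
    then have Dk: "\<phi> ` D k \<noteq> {\<one>}" "local_endos (G\<lparr>carrier := \<phi> ` D k\<rparr>)"
      using loc k by simp_all
    obtain j \<psi> where j: "j < m" and \<psi>: "central_automorphism G \<psi>" "\<psi> ` \<phi> ` D k = E j"
      and others: "\<forall>i<n. i \<noteq> k \<longrightarrow> (\<forall>x\<in>\<phi> ` D i. \<psi> x = x) \<and> \<phi> ` D i \<noteq> E j"
      using exchange[OF fam E ind k Dk] by (elim exE conjE)
    have \<psi>_id: "\<psi> x = x" if "i < n" "i \<noteq> k" "x \<in> \<phi> ` D i" for i x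
      using others that by blast
    have new: "\<phi> ` D i \<noteq> E j" if "i < n" "i \<noteq> k" for i
      using others that by blast
    have img: "(\<psi> \<circ> \<phi>) ` D i = \<phi> ` D i" if "i < n" "i \<noteq> k" for i
    proof -
      have "\<psi> (\<phi> x) = \<phi> x" if "x \<in> D i" for x
        using \<psi>_id[OF \<open>i < n\<close> \<open>i \<noteq> k\<close>] that by blast
      then show ?thesis
        by (auto intro!: image_cong)
    qed
    have "j \<notin> \<iota> ` {..<k}"
      using new \<iota>(1) k by auto
    then have "inj_on (\<iota>(k := j)) {..<Suc k}"
      using \<iota>(2) by (auto simp: lessThan_Suc inj_on_fun_updI)
    moreover have "\<forall>i<Suc k. (\<iota>(k := j)) i < m \<and> (\<psi> \<circ> \<phi>) ` D i = E ((\<iota>(k := j)) i)"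
      using \<iota>(1) \<psi>(2) j img k by (auto simp: less_Suc_eq image_comp)
    moreover have "\<forall>i<n. Suc k \<le> i \<longrightarrow> (\<psi> \<circ> \<phi>) ` D i = D i"
      using img fixed by auto
    ultimately show ?case
      using central_automorphism_comp[OF \<phi> \<psi>(1)] by blast
  qed
  then obtain \<phi> \<iota> where \<phi>: "central_automorphism G \<phi>"
    and \<iota>: "\<forall>i<n. \<iota> i < m \<and> \<phi> ` D i = E (\<iota> i)" "inj_on \<iota> {..<n}"
    by blast
  have fam: "direct_family G n (\<lambda>i. \<phi> ` D i)"
    using direct_family_iso_image[OF D] \<phi> by (simp add: central_automorphism_def)
  have "\<iota> ` {..<n} = {..<m}"
  proof (rule ccontr)
    assume "\<iota> ` {..<n} \<noteq> {..<m}"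
    then obtain j where j: "j < m" "j \<notin> \<iota> ` {..<n}"
      using \<iota>(1) by auto
    obtain r where r: "r \<in> hom G G" "\<forall>x\<in>E j. r x = x" "\<forall>k<m. k \<noteq> j \<longrightarrow> (\<forall>x\<in>E k. r x = \<one>)"
      using direct_familyD(4)[OF E j(1)] by blast
    have "subgroup {x \<in> carrier G. r x = \<one>} G"
      by (rule equaliser_subgroup[OF r(1) _ is_group]) (simp add: hom_def)
    moreover have "(\<Union>i<n. \<phi> ` D i) \<subseteq> {x \<in> carrier G. r x = \<one>}"
    proof
      fix x assume "x \<in> (\<Union>i<n. \<phi> ` D i)"
      then obtain i where i: "i < n" "x \<in> \<phi> ` D i" by blast
      then have "\<iota> i < m" "x \<in> E (\<iota> i)" "\<iota> i \<noteq> j" "x \<in> carrier G"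
        using \<iota>(1) j(2) direct_familyD(1)[OF fam i(1)] by (auto dest: subgroup.mem_carrier)
      then show "x \<in> {x \<in> carrier G. r x = \<one>}"
        using r(3) by blast
    qed
    ultimately have triv: "carrier G \<subseteq> {x \<in> carrier G. r x = \<one>}"
      using generate_subgroup_incl direct_familyD(3)[OF fam] by metis
    have Ej: "subgroup (E j) G"
      using direct_familyD(1)[OF E j(1)] .
    have "x = \<one>" if "x \<in> E j" for x
      using r(2) triv that subgroup.mem_carrier[OF Ej that] by force
    then have "E j = {\<one>}"
      using subgroup.one_closed[OF Ej] by blast
    then show False
      using ind j(1) by simp
  qed
  then have bij: "bij_betw \<iota> {..<n} {..<m}"
    using \<iota>(2) by (simp add: bij_betw_def)
  then have mn: "m = n"
    using bij_betw_same_card by fastforce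
  define \<sigma> where "\<sigma> i = (if i < m then \<iota> i else i)" for i
  have "\<sigma> permutes {..<m}"
  proof (rule bij_imp_permutes)
    show "bij_betw \<sigma> {..<m} {..<m}"
      using bij unfolding mn by (rule bij_betw_cong[THEN iffD1, rotated]) (simp add: \<sigma>_def mn)
  qed (simp add: \<sigma>_def)
  moreover have "\<forall>i<n. \<phi> ` D i = E (\<sigma> i)"
    using \<iota>(1) mn by (simp add: \<sigma>_def)
  ultimately show ?thesis
    using \<phi> mn by blast
qed

lemma (in group) foldr_single:
  assumes "distinct js" "x \<in> carrier G" "\<And>k. k \<in> set js \<Longrightarrow> h k = (if k = i then x else \<one>)"
  shows "foldr (\<lambda>k z. h k \<otimes> z) js \<one> = (if i \<in> set js then x else \<one>)"
  using assms
proof (induction js)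
  case (Cons j js)
  have "foldr (\<lambda>k z. h k \<otimes> z) js \<one> = (if i \<in> set js then x else \<one>)"
    by (rule Cons.IH) (use Cons.prems in auto)
  moreover have "h j = (if j = i then x else \<one>)"
    using Cons.prems(3)[of j] by simp
  ultimately show ?case
    using Cons.prems(1,2) by auto
qed simp

text \<open>The inverse of the given isomorphism provides the projections, and elements of different factors
  commute because they do so in the external product, as families \<open>s i x\<close> with one nontrivial entry.\<close>
lemma (in group) internal_direct_product_imp_direct_family:
  assumes idp: "internal_direct_product G n H"
  shows "direct_family G n H"
proof -
  let ?Pr = "product_group {..<n} (\<lambda>i. G\<lparr>carrier := H i\<rparr>)"
  let ?F = "\<lambda>h. foldr (\<lambda>i x. h i \<otimes> x) [0..<n] \<one>"
  have H: "subgroup (H i) G" if "i < n" for i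
    using idp that unfolding internal_direct_product_def by blast
  have iso: "?F \<in> iso ?Pr G"
    using idp unfolding internal_direct_product_def by blast
  have HG: "x \<in> carrier G" if "i < n" "x \<in> H i" for i x
    using H[OF that(1)] that(2) by (rule subgroup.mem_carrier)
  have grp: "group ?Pr"
    by (rule product_group) (use H subgroup_imp_group in auto)
  define s where "s i x = (\<lambda>k\<in>{..<n}. if k = i then x else \<one>)" for i x
  have sP: "s i x \<in> carrier ?Pr" if "i < n" "x \<in> H i" for i x
    using that H by (auto simp: s_def subgroup.one_closed)
  have Fs: "?F (s i x) = x" if "i < n" "x \<in> H i" for i x
  proof -
    have "?F (s i x) = (if i \<in> set [0..<n] then x else \<one>)"
      by (rule foldr_single) (use that HG in \<open>auto simp: s_def\<close>)
    then show ?thesis using that by simp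
  qed
  define \<Psi> where "\<Psi> = inv_into (carrier ?Pr) ?F"
  have Psi: "\<Psi> \<in> iso G ?Pr"
    unfolding \<Psi>_def by (rule group.iso_set_sym[OF grp iso])
  have Psi_s: "\<Psi> x = s i x" if "i < n" "x \<in> H i" for i x
  proof -
    have "inj_on ?F (carrier ?Pr)"
      using iso unfolding iso_def bij_betw_def by blast
    from inv_into_f_f[OF this sP[OF that]] show ?thesis
      unfolding \<Psi>_def Fs[OF that] .
  qed
  have comm: "x \<otimes> y = y \<otimes> x" if ik: "i < n" "k < n" "i \<noteq> k" and x: "x \<in> H i" and y: "y \<in> H k" for i k x y
  proof -
    have "s i x \<otimes>\<^bsub>?Pr\<^esub> s k y = s k y \<otimes>\<^bsub>?Pr\<^esub> s i x"
      using ik HG[OF ik(1) x] HG[OF ik(2) y] by (auto simp: s_def fun_eq_iff)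
    then have "?F (s i x) \<otimes> ?F (s k y) = ?F (s k y) \<otimes> ?F (s i x)"
      using hom_mult[OF iso_imp_homomorphism[OF iso]] sP[OF ik(1) x] sP[OF ik(2) y] by metis
    then show ?thesis
      using Fs[OF ik(1) x] Fs[OF ik(2) y] by simp
  qed
  have "x \<in> generate G (\<Union>i<n. H i)" if x: "x \<in> carrier G" for x
  proof -
    have "x \<in> ?F ` carrier ?Pr"
      using iso x unfolding iso_def bij_betw_def by blast
    then obtain h where h: "h \<in> carrier ?Pr" "x = ?F h" by blast
    have "foldr (\<lambda>i x. h i \<otimes> x) js \<one> \<in> generate G (\<Union>i<n. H i)" if "set js \<subseteq> {..<n}" for js
      using that
    proof (induction js)
      case Nil
      show ?case by (simp add: generate.one)
    next
      case (Cons j js)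
      then have "h j \<in> (\<Union>i<n. H i)"
        using h(1) by (auto simp: PiE_iff)
      then show ?case
        using Cons by (simp add: generate.eng generate.incl)
    qed
    from this[of "[0..<n]"] show ?thesis
      using h(2) by (simp add: atLeast0LessThan)
  qed
  moreover have "generate G (\<Union>i<n. H i) \<subseteq> carrier G"
    by (rule generate_incl) (use HG in auto)
  ultimately have gen: "generate G (\<Union>i<n. H i) = carrier G"
    by blast
  have "\<exists>r\<in>hom G G. (\<forall>x\<in>H i. r x = x) \<and> (\<forall>k<n. k \<noteq> i \<longrightarrow> (\<forall>x\<in>H k. r x = \<one>))" if i: "i < n" for i
  proof (intro bexI conjI ballI allI impI)
    show "(\<lambda>x. \<Psi> x i) \<in> hom G G"
    proof (rule homI)
      fix x y assume xy: "x \<in> carrier G" "y \<in> carrier G"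
      then have "\<Psi> x \<in> carrier ?Pr"
        using Psi unfolding iso_def hom_def by blast
      then show "\<Psi> x i \<in> carrier G"
        using i HG by (auto simp: PiE_iff)
      show "\<Psi> (x \<otimes> y) i = \<Psi> x i \<otimes> \<Psi> y i"
        using hom_mult[OF iso_imp_homomorphism[OF Psi] xy] i by simp
    qed
  qed (use Psi_s i in \<open>auto simp: s_def\<close>)
  then show ?thesis
    unfolding direct_family_def using H comm gen by (intro conjI allI impI ballI) simp_all
qed

section \<open>Presented groups\<close>

definition word_value :: "('a, 'b) monoid_scheme \<Rightarrow> ('s \<Rightarrow> 'a) \<Rightarrow> 's word \<Rightarrow> 'a" where
  "word_value K f u =
     foldr (\<lambda>(s, e) x. (if e then f s else inv\<^bsub>K\<^esub> f s) \<otimes>\<^bsub>K\<^esub> x) u \<one>\<^bsub>K\<^esub>"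

lemma words_simps [simp]:
  "[] \<in> words S"
  "x # u \<in> words S \<longleftrightarrow> fst x \<in> S \<and> u \<in> words S"
  "u @ v \<in> words S \<longleftrightarrow> u \<in> words S \<and> v \<in> words S"
  by (cases x; auto simp: words_def)+

locale presentation =
  fixes S :: "'s set" and R :: "'s word set"
  assumes relators: "R \<subseteq> words S"
begin

abbreviation "Gr \<equiv> presented_group S R"

abbreviation cls :: "'s word \<Rightarrow> 's word set" where
  "cls u \<equiv> word_eq S R `` {u}"

lemma equiv_word_eq: "equiv UNIV (word_eq S R)"
proof (rule equivI)
  show "sym (word_eq S R)"
    unfolding word_eq_def by (intro sym_rtrancl sym_Un_converse)
qed (auto simp: word_eq_def refl_on_def trans_rtrancl)

lemma cls_eq_iff: "cls u = cls v \<longleftrightarrow> (u, v) \<in> word_eq S R"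
  using eq_equiv_class_iff[OF equiv_word_eq] by auto

lemma step_context:
  assumes "(u, u') \<in> word_step S R" "x \<in> words S" "y \<in> words S"
  shows "(x @ u @ y, x @ u' @ y) \<in> word_step S R"
proof -
  obtain a b r where *: "u = a @ b" "u' = a @ r @ b" "a \<in> words S" "b \<in> words S"
    "r \<in> R \<union> {[(s, e), (s, \<not> e)] | s e. s \<in> S}"
    using assms(1) unfolding word_step_def by blast
  show ?thesis
    unfolding word_step_def mem_Collect_eq
    by (rule exI[of _ "x @ a"], rule exI[of _ "b @ y"], rule exI[of _ r]) (use * assms in auto)
qed

lemma step_words:
  assumes "(u, u') \<in> word_step S R"
  shows "u \<in> words S \<and> u' \<in> words S"
  using assms relators unfolding word_step_def by auto

lemma eq_context:
  assumes "(u, u') \<in> word_eq S R" "x \<in> words S" "y \<in> words S"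
  shows "(x @ u @ y, x @ u' @ y) \<in> word_eq S R"
  using assms(1) unfolding word_eq_def
proof (induction rule: rtrancl_induct)
  case (step v w)
  have "(x @ v @ y, x @ w @ y) \<in> word_step S R \<union> (word_step S R)\<inverse>"
    using step(2) step_context[OF _ assms(2,3)] by auto
  with step(3) show ?case by (rule rtrancl_into_rtrancl)
qed simp

lemma eq_words:
  assumes "(u, u') \<in> word_eq S R" "u \<in> words S"
  shows "u' \<in> words S"
  using assms(1) unfolding word_eq_def
  by (induction rule: rtrancl_induct) (use assms(2) step_words in auto)

lemma cls_relator:
  assumes "r \<in> R \<union> {[(s, e), (s, \<not> e)] | s e. s \<in> S}" "x \<in> words S" "y \<in> words S"
  shows "cls (x @ r @ y) = cls (x @ y)"
proof -
  have "(x @ y, x @ r @ y) \<in> word_step S R"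
    unfolding word_step_def mem_Collect_eq
    by (rule exI[of _ x], rule exI[of _ y], rule exI[of _ r]) (use assms in auto)
  then have "(x @ y, x @ r @ y) \<in> word_eq S R"
    unfolding word_eq_def by auto
  then show ?thesis
    using cls_eq_iff by blast
qed

lemma carrier_P: "carrier Gr = cls ` words S"
  unfolding presented_group_def quotient_def by auto

lemma one_P: "\<one>\<^bsub>Gr\<^esub> = cls []"
  unfolding presented_group_def by auto

lemma mult_P:
  assumes "u \<in> words S" "v \<in> words S"
  shows "cls u \<otimes>\<^bsub>Gr\<^esub> cls v = cls (u @ v)"
proof -
  have "cls (a @ b) = cls (u @ v)" if "a \<in> cls u" "b \<in> cls v" for a b
  proof -
    have "(u @ v, a @ v) \<in> word_eq S R"
      using eq_context[of u a "[]" v] that assms by auto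
    moreover have "(a @ v, a @ b) \<in> word_eq S R"
      using eq_context[of v b a "[]"] that assms eq_words by auto
    ultimately show ?thesis
      using cls_eq_iff by blast
  qed
  moreover have "u \<in> cls u" "v \<in> cls v"
    by (auto simp: word_eq_def)
  ultimately have "(\<Union>a\<in>cls u. \<Union>b\<in>cls v. cls (a @ b)) = cls (u @ v)"
    by blast
  then show ?thesis
    unfolding presented_group_def by simp
qed

lemma left_inverse_word:
  assumes "u \<in> words S"
  shows "\<exists>v\<in>words S. cls (v @ u) = cls []"
  using assms
proof (induction u)
  case Nil
  then show ?case by (intro bexI[of _ "[]"]) auto
next
  case (Cons x u)
  then obtain v where v: "v \<in> words S" "cls (v @ u) = cls []" by auto
  obtain s e where x: "x = (s, e)" by force
  have "cls (v @ [(s, \<not> e), (s, e)] @ u) = cls (v @ u)"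
    by (rule cls_relator) (use Cons v x in \<open>auto intro: exI[of _ "\<not> e"]\<close>)
  then show ?case
    using v Cons x by (intro bexI[of _ "v @ [(s, \<not> e)]"]) auto
qed

lemma group_P: "group Gr"
proof (rule groupI)
  fix x assume "x \<in> carrier Gr"
  then obtain u where u: "u \<in> words S" "x = cls u" by (auto simp: carrier_P)
  then obtain v where "v \<in> words S" "cls (v @ u) = cls []" using left_inverse_word by blast
  with u show "\<exists>y\<in>carrier Gr. y \<otimes>\<^bsub>Gr\<^esub> x = \<one>\<^bsub>Gr\<^esub>"
    by (intro bexI[of _ "cls v"]) (auto simp: carrier_P one_P mult_P)
qed (auto simp: carrier_P one_P mult_P)

lemma word_value_Nil [simp]: "word_value K f [] = \<one>\<^bsub>K\<^esub>"
  by (simp add: word_value_def)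

lemma word_value_Cons [simp]:
  "word_value K f ((s, e) # u) = (if e then f s else inv\<^bsub>K\<^esub> f s) \<otimes>\<^bsub>K\<^esub> word_value K f u"
  by (simp add: word_value_def)

lemma word_value_closed:
  assumes "group K" "f \<in> S \<rightarrow> carrier K" "u \<in> words S"
  shows "word_value K f u \<in> carrier K"
  using assms(3)
proof (induction u)
  case (Cons x u)
  interpret K: group K by fact
  obtain s e where x: "x = (s, e)" by force
  have "f s \<in> carrier K"
    using Cons.prems x assms(2) by auto
  then show ?case
    using Cons x by auto
qed (simp add: assms(1) group.is_monoid monoid.one_closed)

lemma word_value_append:
  assumes "group K" "f \<in> S \<rightarrow> carrier K" "u \<in> words S" "v \<in> words S"
  shows "word_value K f (u @ v) = word_value K f u \<otimes>\<^bsub>K\<^esub> word_value K f v"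
  using assms(3)
proof (induction u)
  case Nil
  interpret K: group K by fact
  show ?case using word_value_closed[OF assms(1,2,4)] by simp
next
  case (Cons x u)
  interpret K: group K by fact
  obtain s e where x: "x = (s, e)" by force
  define c where "c = (if e then f s else inv\<^bsub>K\<^esub> f s)"
  have "f s \<in> carrier K"
    using Cons.prems x assms(2) by auto
  then have c: "c \<in> carrier K"
    by (simp add: c_def)
  have "u \<in> words S" using Cons.prems by simp
  then show ?case
    using Cons.IH c word_value_closed[OF assms(1,2)] assms(4)
    by (simp add: x flip: c_def) (simp add: K.m_assoc)
qed

lemma word_value_step:
  assumes K: "group K" and f: "f \<in> S \<rightarrow> carrier K"
    and rel: "\<And>r. r \<in> R \<Longrightarrow> word_value K f r = \<one>\<^bsub>K\<^esub>"
    and step: "(u, u') \<in> word_step S R"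
  shows "word_value K f u = word_value K f u'"
proof -
  interpret K: group K by (rule K)
  obtain a b r where *: "u = a @ b" "u' = a @ r @ b" and ab: "a \<in> words S" "b \<in> words S"
    and r: "r \<in> R \<union> {[(s, e), (s, \<not> e)] | s e. s \<in> S}"
    using step unfolding word_step_def by blast
  have rS: "r \<in> words S"
    using r relators by auto
  have r1: "word_value K f r = \<one>\<^bsub>K\<^esub>"
    using r
  proof
    assume "r \<in> {[(s, e), (s, \<not> e)] | s e. s \<in> S}"
    then obtain s e where se: "r = [(s, e), (s, \<not> e)]" "s \<in> S" by blast
    then have "f s \<in> carrier K" using f by blast
    then show ?thesis using se by simp
  qed (rule rel)
  have "word_value K f u' = word_value K f a \<otimes>\<^bsub>K\<^esub> (word_value K f r \<otimes>\<^bsub>K\<^esub> word_value K f b)"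
    using rS ab by (simp add: * word_value_append[OF K f])
  also have "\<dots> = word_value K f u"
    using r1 ab word_value_closed[OF K f] by (simp add: * word_value_append[OF K f])
  finally show ?thesis ..
qed

lemma word_value_eq:
  assumes K: "group K" and f: "f \<in> S \<rightarrow> carrier K"
    and rel: "\<And>r. r \<in> R \<Longrightarrow> word_value K f r = \<one>\<^bsub>K\<^esub>"
    and uv: "(u, u') \<in> word_eq S R"
  shows "word_value K f u = word_value K f u'"
  using uv unfolding word_eq_def
proof (induction rule: rtrancl_induct)
  case (step v w)
  from step(2) have "(v, w) \<in> word_step S R \<or> (w, v) \<in> word_step S R" by simp
  then have "word_value K f v = word_value K f w"
    by (metis word_value_step[OF K f rel])
  with step show ?case by simp
qed simp

lemma universal_property:
  assumes K: "group K" and f: "f \<in> S \<rightarrow> carrier K"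
    and rel: "\<And>r. r \<in> R \<Longrightarrow> word_value K f r = \<one>\<^bsub>K\<^esub>"
  shows "\<exists>h \<in> hom Gr K. \<forall>s\<in>S. h (cls [(s, True)]) = f s"
proof -
  interpret K: group K by (rule K)
  define h where "h A = word_value K f (SOME u. u \<in> A)" for A
  have h: "h (cls u) = word_value K f u" for u
  proof -
    have "u \<in> cls u" by (simp add: word_eq_def)
    then have "(SOME x. x \<in> cls u) \<in> cls u" by (rule someI)
    then have "(u, SOME x. x \<in> cls u) \<in> word_eq S R" by simp
    from word_value_eq[OF K f rel this] show ?thesis unfolding h_def by simp
  qed
  have "h \<in> hom Gr K"
  proof (rule homI)
    fix x assume "x \<in> carrier Gr"
    then show "h x \<in> carrier K"
      using word_value_closed[OF K f] by (auto simp: carrier_P h)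
  next
    fix x y assume "x \<in> carrier Gr" "y \<in> carrier Gr"
    then show "h (x \<otimes>\<^bsub>Gr\<^esub> y) = h x \<otimes>\<^bsub>K\<^esub> h y"
      by (auto simp: carrier_P mult_P h word_value_append[OF K f])
  qed
  moreover have "h (cls [(s, True)]) = f s" if "s \<in> S" for s
  proof -
    have "f s \<in> carrier K" using f that by blast
    then show ?thesis by (simp add: h)
  qed
  ultimately show ?thesis by blast
qed

lemma cls_word_value:
  assumes "u \<in> words S"
  shows "cls u = word_value Gr (\<lambda>s. cls [(s, True)]) u"
  using assms
proof (induction u)
  case Nil
  show ?case by (simp add: one_P)
next
  case (Cons x u)
  interpret group Gr by (rule group_P)
  obtain s e where x: "x = (s, e)" by force
  then have s: "s \<in> S" "u \<in> words S" using Cons.prems by auto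
  have "cls ([] @ [(s, False), (s, True)] @ []) = cls ([] @ [])"
    by (rule cls_relator) (use s in auto)
  then have "cls [(s, False)] \<otimes>\<^bsub>Gr\<^esub> cls [(s, True)] = \<one>\<^bsub>Gr\<^esub>"
    using s by (simp add: mult_P one_P)
  then have "inv\<^bsub>Gr\<^esub> (cls [(s, True)]) = cls [(s, False)]"
    using s by (intro inv_equality) (auto simp: carrier_P)
  then have "word_value Gr (\<lambda>s. cls [(s, True)]) (x # u) = cls [x] \<otimes>\<^bsub>Gr\<^esub> cls u"
    using Cons.IH s by (cases e) (auto simp: x)
  then show ?case
    using s by (simp add: mult_P x)
qed

end

section \<open>Coxeter groups as presented groups\<close>

locale coxeter_system =
  fixes S :: "'s set" and M :: "'s \<Rightarrow> 's \<Rightarrow> enat"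
  assumes matrix: "coxeter_matrix S M"
begin

abbreviation "W \<equiv> coxeter_group S M"
abbreviation "gen \<equiv> coxeter_generator S M"

lemma relators_words: "coxeter_relators S M \<subseteq> words S"
proof -
  have "concat (replicate k [(s, True), (t, True)]) \<in> words S" if "s \<in> S" "t \<in> S" for s t k
    using that by (induction k) auto
  then show ?thesis
    by (auto simp: coxeter_relators_def)
qed

sublocale presentation S "coxeter_relators S M"
  by unfold_locales (rule relators_words)

lemma group_W: "group W"
  using group_P by (simp add: coxeter_group_def)

sublocale W: group W
  by (rule group_W)

lemma gen_cls: "gen s = cls [(s, True)]"
  by (simp add: coxeter_generator_def)

lemma gen_closed [simp]: "s \<in> S \<Longrightarrow> gen s \<in> carrier W"
  by (auto simp: coxeter_group_def carrier_P gen_cls)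

lemma word_value_power:
  assumes "group K" "f s \<in> carrier K" "f t \<in> carrier K"
  shows "word_value K f (concat (replicate k [(s, True), (t, True)])) = (f s \<otimes>\<^bsub>K\<^esub> f t) [^]\<^bsub>K\<^esub> k"
proof -
  interpret K: group K by fact
  have "(f s \<otimes>\<^bsub>K\<^esub> f t) [^]\<^bsub>K\<^esub> Suc k = f s \<otimes>\<^bsub>K\<^esub> (f t \<otimes>\<^bsub>K\<^esub> (f s \<otimes>\<^bsub>K\<^esub> f t) [^]\<^bsub>K\<^esub> k)" for k
    unfolding K.nat_pow_Suc2[OF K.m_closed[OF assms(2,3)]]
    using assms by (simp add: K.m_assoc)
  then show ?thesis
    by (induction k) auto
qed

text \<open>The form of the universal property in which all homomorphisms out of Coxeter groups are constructed.\<close>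
lemma coxeter_universal_property:
  assumes K: "group K" and f: "\<And>s. s \<in> S \<Longrightarrow> f s \<in> carrier K"
    and sq: "\<And>s. s \<in> S \<Longrightarrow> f s \<otimes>\<^bsub>K\<^esub> f s = \<one>\<^bsub>K\<^esub>"
    and braid: "\<And>s t k. s \<in> S \<Longrightarrow> t \<in> S \<Longrightarrow> s \<noteq> t \<Longrightarrow> M s t = enat k \<Longrightarrow>
      (f s \<otimes>\<^bsub>K\<^esub> f t) [^]\<^bsub>K\<^esub> k = \<one>\<^bsub>K\<^esub>"
  shows "\<exists>h\<in>hom W K. \<forall>s\<in>S. h (gen s) = f s"
proof -
  interpret K: group K by (rule K)
  have "word_value K f r = \<one>\<^bsub>K\<^esub>" if "r \<in> coxeter_relators S M" for r
  proof -
    have "(\<exists>s. r = [(s, True), (s, True)] \<and> s \<in> S) \<or>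
        (\<exists>s t k. r = concat (replicate k [(s, True), (t, True)]) \<and> s \<in> S \<and> t \<in> S \<and> s \<noteq> t \<and> M s t = enat k)"
      using that unfolding coxeter_relators_def Un_iff mem_Collect_eq .
    then show ?thesis
    proof (elim disjE exE conjE)
      fix s assume "r = [(s, True), (s, True)]" "s \<in> S"
      then show ?thesis using f sq by simp
    next
      fix s t k
      assume r: "r = concat (replicate k [(s, True), (t, True)])" and s: "s \<in> S" and t: "t \<in> S"
        and st: "s \<noteq> t" "M s t = enat k"
      show ?thesis
        unfolding r word_value_power[of K f s t k, OF K f[OF s] f[OF t]] by (rule braid[OF s t st])
    qed
  qed
  then show ?thesis
    using universal_property[OF K, of f] f by (simp add: coxeter_group_def gen_cls Pi_iff)
qed

lemma gen_sq [simp]: "s \<in> S \<Longrightarrow> gen s \<otimes>\<^bsub>W\<^esub> gen s = \<one>\<^bsub>W\<^esub>"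
proof -
  assume s: "s \<in> S"
  then have "cls ([] @ [(s, True), (s, True)] @ []) = cls ([] @ [])"
    by (intro cls_relator) (auto simp: coxeter_relators_def)
  then show ?thesis
    using s by (simp add: coxeter_group_def gen_cls mult_P one_P)
qed

lemma inv_gen [simp]: "s \<in> S \<Longrightarrow> inv\<^bsub>W\<^esub> gen s = gen s"
  by (rule W.inv_equality) auto

lemma gen_braid:
  assumes s: "s \<in> S" and t: "t \<in> S" and "s \<noteq> t" and k: "M s t = enat k"
  shows "(gen s \<otimes>\<^bsub>W\<^esub> gen t) [^]\<^bsub>W\<^esub> k = \<one>\<^bsub>W\<^esub>"
proof -
  let ?r = "concat (replicate k [(s, True), (t, True)])"
  have r: "?r \<in> coxeter_relators S M"
    using assms by (auto simp: coxeter_relators_def)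
  then have "cls ([] @ ?r @ []) = cls ([] @ [])"
    by (intro cls_relator) auto
  then have "cls ?r = \<one>\<^bsub>W\<^esub>"
    by (simp add: coxeter_group_def one_P)
  moreover have "cls ?r = word_value W gen ?r"
    using cls_word_value[of ?r] r relators_words by (auto simp: coxeter_group_def gen_cls[abs_def])
  ultimately show ?thesis
    using word_value_power[OF group_W, of gen s t k] s t by simp
qed

definition prod_gen :: "'s list \<Rightarrow> 's word set" where
  "prod_gen xs = foldr (\<lambda>s w. gen s \<otimes>\<^bsub>W\<^esub> w) xs \<one>\<^bsub>W\<^esub>"

lemma prod_gen_simps [simp]:
  "prod_gen [] = \<one>\<^bsub>W\<^esub>" "prod_gen (s # xs) = gen s \<otimes>\<^bsub>W\<^esub> prod_gen xs"
  by (simp_all add: prod_gen_def)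

lemma prod_gen_closed [simp]: "set xs \<subseteq> S \<Longrightarrow> prod_gen xs \<in> carrier W"
  by (induction xs) auto

lemma prod_gen_append:
  "set xs \<subseteq> S \<Longrightarrow> set ys \<subseteq> S \<Longrightarrow> prod_gen (xs @ ys) = prod_gen xs \<otimes>\<^bsub>W\<^esub> prod_gen ys"
  by (induction xs) (auto simp: W.m_assoc)

lemma prod_gen_surj:
  assumes "w \<in> carrier W"
  obtains xs where "set xs \<subseteq> S" "w = prod_gen xs"
proof -
  obtain u where u: "u \<in> words S" "w = cls u"
    using assms by (auto simp: coxeter_group_def carrier_P)
  have "word_value W gen u = prod_gen (map fst u) \<and> set (map fst u) \<subseteq> S"
    using u(1)
  proof (induction u)
    case (Cons x u)
    then show ?case by (cases x) auto
  qed simp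
  moreover have "w = word_value W gen u"
    using cls_word_value[OF u(1)] u(2) by (simp add: coxeter_group_def gen_cls[abs_def])
  ultimately show ?thesis
    using that by blast
qed

lemma prod_gen_generate:
  assumes "set xs \<subseteq> X" "X \<subseteq> S"
  shows "prod_gen xs \<in> generate W (gen ` X)"
  using assms(1) by (induction xs) (auto intro: generate.one generate.eng generate.incl)

lemma generate_gen: "generate W (gen ` S) = carrier W"
proof
  show "generate W (gen ` S) \<subseteq> carrier W"
    by (rule W.generate_incl) auto
  show "carrier W \<subseteq> generate W (gen ` S)"
  proof
    fix w assume "w \<in> carrier W"
    then obtain xs where "set xs \<subseteq> S" "w = prod_gen xs" by (rule prod_gen_surj)
    then show "w \<in> generate W (gen ` S)" using prod_gen_generate by blast
  qed
qed

lemma gen_induct [consumes 1, case_names one gen]: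
  assumes "w \<in> carrier W" "Q \<one>\<^bsub>W\<^esub>"
    and "\<And>s w. s \<in> S \<Longrightarrow> w \<in> carrier W \<Longrightarrow> Q w \<Longrightarrow> Q (gen s \<otimes>\<^bsub>W\<^esub> w)"
  shows "Q w"
proof -
  obtain xs where xs: "set xs \<subseteq> S" "w = prod_gen xs"
    using assms(1) by (rule prod_gen_surj)
  have "Q (prod_gen xs)"
    using xs(1) by (induction xs) (auto intro: assms)
  then show ?thesis by (simp add: xs(2))
qed

lemma M_sym: "s \<in> S \<Longrightarrow> t \<in> S \<Longrightarrow> M s t = M t s"
  using matrix unfolding coxeter_matrix_def by metis

lemma M_ge_2: "s \<in> S \<Longrightarrow> t \<in> S \<Longrightarrow> s \<noteq> t \<Longrightarrow> M s t \<ge> 2"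
  using matrix unfolding coxeter_matrix_def by metis

lemma finite_S: "finite S"
  using matrix unfolding coxeter_matrix_def by blast

end

lemma (in group) hom_eq_on_generate:
  assumes "f \<in> hom G K" "g \<in> hom G K" "group K" "A \<subseteq> carrier G" "\<And>x. x \<in> A \<Longrightarrow> f x = g x"
    and "x \<in> generate G A"
  shows "f x = g x"
proof -
  have "generate G A \<subseteq> {x \<in> carrier G. f x = g x}"
    by (rule generate_subgroup_incl[OF _ equaliser_subgroup[OF assms(1-3)]]) (use assms in auto)
  then show ?thesis using assms(6) by blast
qed

section \<open>The geometric representation and its affine deformations\<close>

definition perm_group :: "('v \<Rightarrow> 'v) monoid" where
  "perm_group = \<lparr>carrier = {f. bij f}, monoid.mult = (\<circ>), one = id\<rparr>"

lemma group_perm_group: "group perm_group"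
proof (rule groupI)
  fix f :: "'v \<Rightarrow> 'v" assume "f \<in> carrier perm_group"
  then show "\<exists>g\<in>carrier perm_group. g \<otimes>\<^bsub>perm_group\<^esub> f = \<one>\<^bsub>perm_group\<^esub>"
    by (intro bexI[of _ "inv_into UNIV f"]) (auto simp: perm_group_def bij_imp_bij_inv bij_is_inj)
qed (auto simp: perm_group_def bij_comp o_assoc)

lemma perm_group_pow: "f [^]\<^bsub>perm_group\<^esub> (n::nat) = f ^^ n"
proof (induction n)
  case (Suc n)
  then show ?case by (simp add: perm_group_def funpow_Suc_right del: funpow.simps)
qed (simp add: perm_group_def)

context coxeter_system
begin

text \<open>The canonical bilinear form on pairs of simple roots.\<close>
definition cform :: "'s \<Rightarrow> 's \<Rightarrow> real" where
  "cform s t = (if s = t then 1 else case M s t of enat k \<Rightarrow> - cos (pi / k) | \<infinity> \<Rightarrow> - 1)"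

lemma cform_refl [simp]: "cform s s = 1"
  by (simp add: cform_def)

lemma cform_sym: "s \<in> S \<Longrightarrow> t \<in> S \<Longrightarrow> cform s t = cform t s"
  using M_sym by (simp add: cform_def)

lemma cform_edge:
  assumes "(s, t) \<in> coxeter_edges S M"
  shows "cform s t < 0"
proof -
  have *: "s \<noteq> t" "M s t \<ge> 3"
    using assms by (auto simp: coxeter_edges_def)
  show ?thesis
  proof (cases "M s t")
    case (enat k)
    then have "k \<ge> 3"
      using * by (simp add: numeral_eq_enat)
    then have "2 < real k" by simp
    then have "pi / real k < pi / 2"
      by (intro divide_strict_left_mono) auto
    moreover have "0 \<le> pi / real k" by simp
    ultimately have "cos (pi / real k) > 0"
      by (intro cos_gt_zero_pi) (auto intro: less_le_trans[of _ 0])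
    then show ?thesis
      using * enat by (simp add: cform_def)
  qed (use * in \<open>simp add: cform_def\<close>)
qed

lemma cform_nonedge:
  assumes "s \<in> S" "t \<in> S" "s \<noteq> t" "(s, t) \<notin> coxeter_edges S M"
  shows "M s t = 2" "cform s t = 0"
proof -
  have "\<not> M s t \<ge> 3"
    using assms by (auto simp: coxeter_edges_def)
  then show "M s t = 2"
    using M_ge_2[OF assms(1-3)] by (cases "M s t") (auto simp: numeral_eq_enat)
  then show "cform s t = 0"
    using assms by (simp add: cform_def numeral_eq_enat)
qed

text \<open>For \<open>g = 0\<close> this is the form paired with the simple root of \<open>s\<close>, and \<open>reflection\<close> is the usual reflection
  of the geometric representation. The form may be degenerate, and then products of reflections do not
  determine the roots involved. The parameter \<open>g\<close> repairs this: each \<open>g\<close> deforms the representation to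
  an action by affine reflections with the same linear part, and the images of the origin for varying
  \<open>g\<close> contain the missing information. Equivalently, the sum of the space and its dual carries a
  nondegenerate invariant form, and \<open>g\<close> is the dual coordinate.\<close>
definition coord :: "('s \<Rightarrow> real) \<Rightarrow> 's \<Rightarrow> ('s \<Rightarrow> real) \<Rightarrow> real" where
  "coord g s v = (\<Sum>t\<in>S. cform s t * v t) + g s"

definition reflection :: "('s \<Rightarrow> real) \<Rightarrow> 's \<Rightarrow> ('s \<Rightarrow> real) \<Rightarrow> ('s \<Rightarrow> real)" where
  "reflection g s v = v(s := v s - 2 * coord g s v)"

abbreviation zero :: "'s \<Rightarrow> real" where
  "zero \<equiv> \<lambda>_. 0"

lemma coord_upd:
  assumes "s \<in> S"
  shows "coord g t (v(s := x)) = coord g t v + cform t s * (x - v s)"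
proof -
  have "(\<Sum>i\<in>S. cform t i * (v(s := x)) i) = cform t s * x + (\<Sum>i\<in>S - {s}. cform t i * v i)"
    using finite_S assms by (subst sum.remove[of _ s]) auto
  moreover have "(\<Sum>i\<in>S. cform t i * v i) = cform t s * v s + (\<Sum>i\<in>S - {s}. cform t i * v i)"
    using finite_S assms by (subst sum.remove[of _ s]) auto
  ultimately show ?thesis
    by (simp add: coord_def algebra_simps)
qed

lemma coord_reflection:
  "s \<in> S \<Longrightarrow> coord g t (reflection g s v) = coord g t v - 2 * cform t s * coord g s v"
  by (simp add: reflection_def coord_upd)

lemma coord_add: "coord g s (\<lambda>i. v i + c * u i) = coord g s v + c * coord zero s u"
  by (simp add: coord_def algebra_simps sum.distrib sum_distrib_left)

lemma reflection_add:
  "reflection g s (\<lambda>i. v i + c * u i) = (\<lambda>i. reflection g s v i + c * reflection zero s u i)"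
  by (auto simp: reflection_def coord_add fun_eq_iff algebra_simps)

lemma reflection_involution: "s \<in> S \<Longrightarrow> reflection g s (reflection g s v) = v"
  by (auto simp: reflection_def coord_upd fun_eq_iff)

definition plane :: "'s \<Rightarrow> 's \<Rightarrow> real \<Rightarrow> real \<Rightarrow> 's \<Rightarrow> real" where
  "plane s t x y = (\<lambda>i. if i = s then x else if i = t then y else 0)"

lemma coord_plane:
  assumes "s \<in> S" "t \<in> S" "s \<noteq> t"
  shows "coord zero i (plane s t x y) = cform i s * x + cform i t * y"
proof -
  have p: "plane s t x y = (zero(t := y))(s := x)"
    using assms by (auto simp: plane_def)
  show ?thesis
    unfolding p using assms by (simp add: coord_upd) (simp add: coord_def)
qed

lemma reflection_plane:
  assumes "s \<in> S" "t \<in> S" "s \<noteq> t"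
  shows "reflection zero s (plane s t x y) = plane s t (- 2 * cform s t * y - x) y"
    and "reflection zero t (plane s t x y) = plane s t x (- 2 * cform s t * x - y)"
  using assms cform_sym[of s t]
  by (auto simp: reflection_def coord_plane) (auto simp: plane_def fun_eq_iff)

text \<open>The form is positive definite on the plane of the two simple roots because \<open>m\<close> is finite. So a vector
  is a common fixed point of both affine reflections plus a vector of this plane, on which the product of
  the linear reflections is a rotation by \<open>2 \<pi> / m\<close>. The function \<open>f\<close> lists the coordinates of the rotated
  vector.\<close>
lemma reflection_braid:
  assumes st: "s \<in> S" "t \<in> S" "s \<noteq> t" and m: "M s t = enat m"
  shows "((reflection g s \<circ> reflection g t) ^^ m) v = v"
proof -
  define \<theta> where "\<theta> = pi / m"
  have "m \<ge> 2"
    using M_ge_2[OF st] m by (simp add: numeral_eq_enat)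
  then have theta: "0 < \<theta>" "\<theta> < pi" and period: "real m * \<theta> = pi"
    by (auto simp: \<theta>_def field_simps intro: less_le_trans[of _ "pi * 2"])
  have c: "cform s t = - cos \<theta>" "cform t s = - cos \<theta>"
    using st m cform_sym[of s t] by (auto simp: cform_def \<theta>_def)
  have sin: "sin \<theta> > 0"
    using theta by (simp add: sin_gt_zero)
  then have det: "1 - cos \<theta> * cos \<theta> > 0"
    using sin_squared_eq[of \<theta>] mult_pos_pos[OF sin sin] by (simp add: power2_eq_square)
  define x where "x = (coord g s v + cos \<theta> * coord g t v) / (1 - cos \<theta> * cos \<theta>)"
  define y where "y = (coord g t v + cos \<theta> * coord g s v) / (1 - cos \<theta> * cos \<theta>)"
  have xy: "x - cos \<theta> * y = coord g s v" "y - cos \<theta> * x = coord g t v"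
  proof -
    have "(a + c * b) / (1 - c * c) - c * ((b + c * a) / (1 - c * c)) = a"
      if "1 - c * c > 0" for a b c :: real
    proof -
      have "(a + c * b) / (1 - c * c) - c * ((b + c * a) / (1 - c * c))
          = ((a + c * b) - c * (b + c * a)) / (1 - c * c)"
        by (simp add: diff_divide_distrib)
      also have "(a + c * b) - c * (b + c * a) = a * (1 - c * c)"
        by (simp add: algebra_simps)
      finally show ?thesis using that by simp
    qed
    then show "x - cos \<theta> * y = coord g s v" "y - cos \<theta> * x = coord g t v"
      using det unfolding x_def y_def by blast+
  qed
  define q where "q = (\<lambda>i. v i + (- 1) * plane s t x y i)"
  have q0: "coord g s q = 0" "coord g t q = 0"
    unfolding q_def coord_add using xy st by (simp_all add: coord_plane c)
  then have fixed: "reflection g s q = q" "reflection g t q = q"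
    by (simp_all add: reflection_def)
  have v: "v = (\<lambda>i. q i + 1 * plane s t x y i)"
    by (simp add: q_def)
  define f where "f j = y * cos (real j * \<theta>) + (x - y * cos \<theta>) / sin \<theta> * sin (real j * \<theta>)" for j :: nat
  have f_rec: "2 * cos \<theta> * f (Suc j) - f j = f (Suc (Suc j))" for j
  proof -
    have "real (Suc (Suc j)) * \<theta> = real (Suc j) * \<theta> + \<theta>" "real j * \<theta> = real (Suc j) * \<theta> - \<theta>"
      by (simp_all add: algebra_simps)
    then show ?thesis
      unfolding f_def by (simp only: cos_add sin_add cos_diff sin_diff) (simp add: algebra_simps)
  qed
  have f0: "f 0 = y" "f 1 = x"
    using sin by (simp_all add: f_def)
  have fm: "f (2 * m) = y" "f (Suc (2 * m)) = x"
  proof -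
    have "real (2 * m) * \<theta> = 2 * pi" "real (Suc (2 * m)) * \<theta> = \<theta> + 2 * pi"
      using period by (simp_all add: algebra_simps)
    then show "f (2 * m) = y" "f (Suc (2 * m)) = x"
      using sin unfolding f_def by (simp_all only: cos_periodic sin_periodic) simp_all
  qed
  have "((reflection g s \<circ> reflection g t) ^^ n) v = (\<lambda>i. q i + 1 * plane s t (f (Suc (2 * n))) (f (2 * n)) i)" for n
  proof (induction n)
    case 0
    show ?case using v f0 by simp
  next
    case (Suc n)
    have "((reflection g s \<circ> reflection g t) ^^ Suc n) v =
        reflection g s (reflection g t (\<lambda>i. q i + 1 * plane s t (f (Suc (2 * n))) (f (2 * n)) i))"
      by (simp only: funpow.simps comp_apply Suc)
    also have "\<dots> = (\<lambda>i. q i + 1 * reflection zero s (reflection zero t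
        (plane s t (f (Suc (2 * n))) (f (2 * n)))) i)"
      by (simp only: reflection_add fixed)
    also have "reflection zero s (reflection zero t (plane s t (f (Suc (2 * n))) (f (2 * n)))) =
        plane s t (f (Suc (2 * Suc n))) (f (2 * Suc n))"
      using st f_rec[of "2 * n"] f_rec[of "Suc (2 * n)"] by (simp add: reflection_plane c)
    finally show ?case .
  qed
  from this[of m] show ?thesis
    using v fm by simp
qed

lemma ex_action:
  "\<exists>h\<in>hom W perm_group. \<forall>s\<in>S. h (gen s) = reflection g s"
proof (rule coxeter_universal_property[OF group_perm_group])
  fix s assume s: "s \<in> S"
  then have "bij (reflection g s)"
    by (intro o_bij[of "reflection g s"]) (auto simp: reflection_involution fun_eq_iff)
  then show "reflection g s \<in> carrier perm_group"
    by (simp add: perm_group_def)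
  show "reflection g s \<otimes>\<^bsub>perm_group\<^esub> reflection g s = \<one>\<^bsub>perm_group\<^esub>"
    using s by (auto simp: perm_group_def reflection_involution fun_eq_iff)
next
  fix s t k assume *: "s \<in> S" "t \<in> S" "s \<noteq> t" "M s t = enat k"
  have "(reflection g s \<circ> reflection g t) ^^ k = id"
    using reflection_braid[OF *] by auto
  then show "(reflection g s \<otimes>\<^bsub>perm_group\<^esub> reflection g t) [^]\<^bsub>perm_group\<^esub> k = \<one>\<^bsub>perm_group\<^esub>"
    unfolding perm_group_pow by (simp add: perm_group_def)
qed

definition act :: "('s \<Rightarrow> real) \<Rightarrow> 's word set \<Rightarrow> ('s \<Rightarrow> real) \<Rightarrow> ('s \<Rightarrow> real)" where
  "act g = (SOME h. h \<in> hom W perm_group \<and> (\<forall>s\<in>S. h (gen s) = reflection g s))"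

abbreviation "lin \<equiv> act zero"

lemma act_spec: "act g \<in> hom W perm_group \<and> (\<forall>s\<in>S. act g (gen s) = reflection g s)"
proof -
  have "\<exists>h. h \<in> hom W perm_group \<and> (\<forall>s\<in>S. h (gen s) = reflection g s)"
    using ex_action by blast
  from someI_ex[OF this] show ?thesis
    unfolding act_def .
qed

lemma act_gen [simp]: "s \<in> S \<Longrightarrow> act g (gen s) = reflection g s"
  using act_spec by blast

lemma act_mult: "x \<in> carrier W \<Longrightarrow> y \<in> carrier W \<Longrightarrow> act g (x \<otimes>\<^bsub>W\<^esub> y) v = act g x (act g y v)"
  using act_spec[of g] by (auto simp: hom_def perm_group_def)

lemma act_one [simp]: "act g \<one>\<^bsub>W\<^esub> v = v"
proof -
  have "act g \<one>\<^bsub>W\<^esub> = \<one>\<^bsub>perm_group\<^esub>"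
    using hom_one[OF conjunct1[OF act_spec] group_W group_perm_group] .
  then show ?thesis by (simp add: perm_group_def)
qed

lemma act_inv: "w \<in> carrier W \<Longrightarrow> act g w (act g (inv\<^bsub>W\<^esub> w) v) = v"
  by (simp flip: act_mult)

lemma act_inv': "w \<in> carrier W \<Longrightarrow> act g (inv\<^bsub>W\<^esub> w) (act g w v) = v"
  by (simp flip: act_mult)

lemma act_add:
  "w \<in> carrier W \<Longrightarrow> act g w (\<lambda>i. v i + c * u i) = (\<lambda>i. act g w v i + c * lin w u i)"
  by (induction w rule: gen_induct) (simp_all add: act_mult reflection_add)

text \<open>For \<open>g = 0\<close> this is the form itself. In general \<open>u\<close> is a vector of the linear representation and \<open>v\<close> a point
  of the deformed one.\<close>
definition pairing :: "('s \<Rightarrow> real) \<Rightarrow> ('s \<Rightarrow> real) \<Rightarrow> ('s \<Rightarrow> real) \<Rightarrow> real" where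
  "pairing g u v = (\<Sum>i\<in>S. u i * coord g i v)"

lemma pairing_add: "pairing g u (\<lambda>i. v i + c * x i) = pairing g u v + c * pairing zero u x"
  by (simp add: pairing_def coord_add algebra_simps sum.distrib sum_distrib_left)

definition sroot :: "'s \<Rightarrow> 's \<Rightarrow> real" where
  "sroot s = (\<lambda>i. if i = s then 1 else 0)"

lemma pairing_sroot: "s \<in> S \<Longrightarrow> pairing g (sroot s) v = coord g s v"
  unfolding pairing_def sroot_def using finite_S
  by (simp add: if_distrib[of "\<lambda>x. x * _"] cong: if_cong)

lemma reflection_sroot: "reflection g s v = (\<lambda>i. v i + (- 2 * coord g s v) * sroot s i)"
  by (auto simp: reflection_def sroot_def fun_eq_iff)

lemma pairing_invariant:
  assumes "w \<in> carrier W"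
  shows "pairing g (lin w u) (act g w v) = pairing g u v"
proof -
  have step: "pairing g (reflection zero s u) (reflection g s v) = pairing g u v" if s: "s \<in> S" for s u v
  proof -
    let ?c = "coord zero s u" and ?d = "coord g s v"
    have 1: "(\<Sum>i\<in>S. sroot s i * coord g i x) = coord g s x" for x
      using pairing_sroot[OF s] by (simp add: pairing_def)
    have 2: "(\<Sum>i\<in>S. u i * cform i s) = ?c"
      using cform_sym s by (simp add: coord_def mult.commute)
    have "pairing g (reflection zero s u) (reflection g s v)
        = (\<Sum>i\<in>S. (u i + (- 2 * ?c) * sroot s i) * coord g i (reflection g s v))"
      by (simp add: pairing_def reflection_sroot[of zero])
    also have "\<dots> = (\<Sum>i\<in>S. u i * coord g i (reflection g s v)) - 2 * ?c * coord g s (reflection g s v)"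
      unfolding 1[symmetric] sum_distrib_left sum_subtractf[symmetric]
      by (rule sum.cong) (simp_all add: algebra_simps)
    also have "(\<Sum>i\<in>S. u i * coord g i (reflection g s v)) = pairing g u v - 2 * ?d * (\<Sum>i\<in>S. u i * cform i s)"
      using s by (simp add: coord_reflection pairing_def algebra_simps sum.distrib sum_distrib_left sum_subtractf)
    finally show ?thesis
      using s unfolding 2 by (simp add: coord_reflection)
  qed
  show ?thesis
    using assms by (induction w rule: gen_induct) (simp_all add: act_mult step)
qed

text \<open>The invariance of the pairing turns the formula for \<open>s\<close>, transported by \<open>w\<close>, into the formula of the affine
  reflection in the root of the conjugate.\<close>
lemma act_conjugate:
  assumes s: "s \<in> S" and w: "w \<in> carrier W"
  shows "act g (w \<otimes>\<^bsub>W\<^esub> gen s \<otimes>\<^bsub>W\<^esub> inv\<^bsub>W\<^esub> w) v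
    = (\<lambda>i. v i + (- 2 * pairing g (lin w (sroot s)) v) * lin w (sroot s) i)"
proof -
  let ?v = "act g (inv\<^bsub>W\<^esub> w) v"
  have "act g (w \<otimes>\<^bsub>W\<^esub> gen s \<otimes>\<^bsub>W\<^esub> inv\<^bsub>W\<^esub> w) v = act g w (reflection g s ?v)"
    using s w by (simp add: act_mult)
  also have "\<dots> = (\<lambda>i. v i + (- 2 * coord g s ?v) * lin w (sroot s) i)"
    unfolding reflection_sroot act_add[OF w] act_inv[OF w] ..
  also have "coord g s ?v = pairing g (lin w (sroot s)) v"
    using pairing_invariant[OF w, of g "sroot s" ?v] s w by (simp add: pairing_sroot act_inv)
  finally show ?thesis .
qed

end

section \<open>Length and positivity of roots\<close>

text \<open>The alternating word of length \<open>k\<close> in \<open>s\<close> and \<open>t\<close> whose last letter is \<open>t\<close>. Letters are prepended, because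
  actions are evaluated from the right.\<close>
primrec alternating :: "'s \<Rightarrow> 's \<Rightarrow> nat \<Rightarrow> 's list" where
  "alternating s t 0 = []"
| "alternating s t (Suc k) = (if even k then t else s) # alternating s t k"

lemma length_alternating [simp]: "length (alternating s t k) = k"
  by (induction k) auto

lemma set_alternating: "set (alternating s t k) \<subseteq> {s, t}"
  by (induction k) auto

lemma alternating_snoc: "alternating s t (Suc k) = alternating t s k @ [t]"
  by (induction k) auto

lemma alternating_split:
  "m \<le> k \<Longrightarrow> \<exists>xs. alternating s t k = xs @ alternating s t m \<and> length xs = k - m \<and> set xs \<subseteq> {s, t}"
proof (induction k)
  case (Suc k)
  show ?case
  proof (cases "m = Suc k")
    case False
    then obtain xs where "alternating s t k = xs @ alternating s t m" "length xs = k - m" "set xs \<subseteq> {s, t}"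
      using Suc by auto
    then show ?thesis
      using Suc False by (intro exI[of _ "(if even k then t else s) # xs"]) auto
  qed auto
qed simp

context coxeter_system
begin

definition len :: "'s word set \<Rightarrow> nat" where
  "len w = (LEAST n. \<exists>xs. set xs \<subseteq> S \<and> length xs = n \<and> prod_gen xs = w)"

lemma len_prod_gen: "set xs \<subseteq> S \<Longrightarrow> len (prod_gen xs) \<le> length xs"
  unfolding len_def by (rule Least_le) blast

lemma reduced_word:
  assumes "w \<in> carrier W"
  obtains xs where "set xs \<subseteq> S" "length xs = len w" "prod_gen xs = w"
proof -
  obtain xs where "set xs \<subseteq> S" "w = prod_gen xs"
    using assms by (rule prod_gen_surj)
  then have "\<exists>n xs. set xs \<subseteq> S \<and> length xs = n \<and> prod_gen xs = w" by blast
  from LeastI_ex[OF this] show ?thesis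
    using that unfolding len_def by blast
qed

lemma len_mult_prod_gen:
  assumes "w \<in> carrier W" "set ys \<subseteq> S"
  shows "len (w \<otimes>\<^bsub>W\<^esub> prod_gen ys) \<le> len w + length ys"
proof -
  obtain xs where xs: "set xs \<subseteq> S" "length xs = len w" "prod_gen xs = w"
    using assms(1) by (rule reduced_word)
  then have "w \<otimes>\<^bsub>W\<^esub> prod_gen ys = prod_gen (xs @ ys)"
    using assms(2) by (simp add: prod_gen_append)
  then show ?thesis
    using len_prod_gen[of "xs @ ys"] xs assms(2) by simp
qed

lemma len_mult_gen: "w \<in> carrier W \<Longrightarrow> s \<in> S \<Longrightarrow> len (w \<otimes>\<^bsub>W\<^esub> gen s) \<le> len w + 1"
  using len_mult_prod_gen[of w "[s]"] by simp

lemma mult_gen_gen: "w \<in> carrier W \<Longrightarrow> s \<in> S \<Longrightarrow> w \<otimes>\<^bsub>W\<^esub> gen s \<otimes>\<^bsub>W\<^esub> gen s = w"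
  by (simp add: W.m_assoc)

lemma len_zero: "w \<in> carrier W \<Longrightarrow> len w = 0 \<Longrightarrow> w = \<one>\<^bsub>W\<^esub>"
  by (rule reduced_word[of w]) auto

lemma last_letter:
  assumes w: "w \<in> carrier W" and "len w \<noteq> 0"
  obtains s v where "s \<in> S" "v \<in> carrier W" "w = v \<otimes>\<^bsub>W\<^esub> gen s" "len w = Suc (len v)"
proof -
  obtain xs where xs: "set xs \<subseteq> S" "length xs = len w" "prod_gen xs = w"
    using w by (rule reduced_word)
  then obtain ys s where ys: "xs = ys @ [s]"
    using assms(2) by (metis length_0_conv rev_exhaust)
  then have *: "s \<in> S" "set ys \<subseteq> S" "w = prod_gen ys \<otimes>\<^bsub>W\<^esub> gen s"
    using xs by (auto simp: prod_gen_append)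
  moreover have "len (prod_gen ys) \<le> length ys"
    using len_prod_gen * by simp
  moreover have "len w \<le> len (prod_gen ys) + 1"
    using len_mult_gen[of "prod_gen ys" s] * by simp
  ultimately show ?thesis
    using that[of s "prod_gen ys"] xs(2) ys by simp
qed

text \<open>The two words of length \<open>k\<close> differ by the factor \<open>(s t)\<^sup>k\<close>.\<close>
lemma alternating_braid:
  assumes s: "s \<in> S" and t: "t \<in> S" and st: "s \<noteq> t" and m: "M s t = enat m"
  shows "prod_gen (alternating s t m) = prod_gen (alternating t s m)"
proof -
  let ?u = "gen s" and ?v = "gen t"
  let ?A = "\<lambda>k. prod_gen (alternating s t k)" and ?B = "\<lambda>k. prod_gen (alternating t s k)"
  have set: "set (alternating s t k) \<subseteq> S" "set (alternating t s k) \<subseteq> S" for k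
    using set_alternating[of s t k] set_alternating[of t s k] s t by auto
  have snoc: "?A (Suc k) = ?B k \<otimes>\<^bsub>W\<^esub> ?v" "?B (Suc k) = ?A k \<otimes>\<^bsub>W\<^esub> ?u" for k
    unfolding alternating_snoc using set s t by (simp_all add: prod_gen_append)
  have "inv\<^bsub>W\<^esub> (?B k) \<otimes>\<^bsub>W\<^esub> ?A k = (?u \<otimes>\<^bsub>W\<^esub> ?v) [^]\<^bsub>W\<^esub> k" for k
  proof (induction k)
    case (Suc k)
    have c: "?A k \<in> carrier W" "?B k \<in> carrier W" "?u \<in> carrier W" "?v \<in> carrier W"
      using set s t by auto
    have "inv\<^bsub>W\<^esub> (?B (Suc k)) \<otimes>\<^bsub>W\<^esub> ?A (Suc k) = ?u \<otimes>\<^bsub>W\<^esub> (inv\<^bsub>W\<^esub> (?A k) \<otimes>\<^bsub>W\<^esub> ?B k) \<otimes>\<^bsub>W\<^esub> ?v"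
      unfolding snoc using c s by (simp add: W.inv_mult_group W.m_assoc)
    also have "inv\<^bsub>W\<^esub> (?A k) \<otimes>\<^bsub>W\<^esub> ?B k = inv\<^bsub>W\<^esub> (inv\<^bsub>W\<^esub> (?B k) \<otimes>\<^bsub>W\<^esub> ?A k)"
      using c by (simp add: W.inv_mult_group)
    also have "\<dots> = inv\<^bsub>W\<^esub> ((?u \<otimes>\<^bsub>W\<^esub> ?v) [^]\<^bsub>W\<^esub> k)"
      using Suc by simp
    also have "\<dots> = (?v \<otimes>\<^bsub>W\<^esub> ?u) [^]\<^bsub>W\<^esub> k"
      using c s t by (simp add: W.inv_mult_group flip: W.nat_pow_inv)
    also have "?u \<otimes>\<^bsub>W\<^esub> (?v \<otimes>\<^bsub>W\<^esub> ?u) [^]\<^bsub>W\<^esub> k = (?u \<otimes>\<^bsub>W\<^esub> ?v) [^]\<^bsub>W\<^esub> k \<otimes>\<^bsub>W\<^esub> ?u"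
    proof (induction k)
      case (Suc k)
      have "?u \<otimes>\<^bsub>W\<^esub> (?v \<otimes>\<^bsub>W\<^esub> ?u) [^]\<^bsub>W\<^esub> Suc k = (?u \<otimes>\<^bsub>W\<^esub> (?v \<otimes>\<^bsub>W\<^esub> ?u) [^]\<^bsub>W\<^esub> k) \<otimes>\<^bsub>W\<^esub> (?v \<otimes>\<^bsub>W\<^esub> ?u)"
        using c by (simp add: W.m_assoc)
      also have "\<dots> = (?u \<otimes>\<^bsub>W\<^esub> ?v) [^]\<^bsub>W\<^esub> Suc k \<otimes>\<^bsub>W\<^esub> ?u"
        unfolding Suc using c by (simp add: W.m_assoc)
      finally show ?case .
    qed (use c in simp)
    finally show ?case
      using c by (simp add: W.m_assoc)
  qed simp
  from this[of m] have "inv\<^bsub>W\<^esub> (?B m) \<otimes>\<^bsub>W\<^esub> ?A m = \<one>\<^bsub>W\<^esub>"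
    using gen_braid[OF s t st m] by simp
  moreover have "?A m \<in> carrier W" "?B m \<in> carrier W"
    using set by auto
  ultimately show ?thesis
    by (metis W.inv_closed W.inv_equality W.inv_inv)
qed

text \<open>The Chebyshev numbers \<open>sin (k \<theta>) / sin \<theta>\<close> with \<open>\<theta> = \<pi> / m\<close>, and their limit \<open>k\<close> for infinite \<open>m\<close>. They are
  the coordinates of the roots of the dihedral group generated by \<open>s\<close> and \<open>t\<close>.\<close>
definition dihedral_coeff :: "'s \<Rightarrow> 's \<Rightarrow> nat \<Rightarrow> real" where
  "dihedral_coeff s t k =
     (case M s t of enat m \<Rightarrow> sin (real k * (pi / m)) / sin (pi / m) | \<infinity> \<Rightarrow> real k)"

lemma dihedral_coeff:
  assumes st: "s \<in> S" "t \<in> S" "s \<noteq> t"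
  shows "dihedral_coeff s t 0 = 0" "dihedral_coeff s t 1 = 1"
    and "dihedral_coeff s t (Suc (Suc k)) = - 2 * cform s t * dihedral_coeff s t (Suc k) - dihedral_coeff s t k"
    and "enat k \<le> M s t \<Longrightarrow> dihedral_coeff s t k \<ge> 0"
proof -
  have "dihedral_coeff s t 0 = 0 \<and> dihedral_coeff s t 1 = 1 \<and>
    dihedral_coeff s t (Suc (Suc k)) = - 2 * cform s t * dihedral_coeff s t (Suc k) - dihedral_coeff s t k \<and>
    (enat k \<le> M s t \<longrightarrow> dihedral_coeff s t k \<ge> 0)"
  proof (cases "M s t")
    case (enat m)
    define \<theta> where "\<theta> = pi / m"
    have "m \<ge> 2"
      using M_ge_2[OF st] enat by (simp add: numeral_eq_enat)
    then have theta: "0 < \<theta>" "\<theta> < pi" and period: "real m * \<theta> = pi"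
      by (auto simp: \<theta>_def field_simps intro: less_le_trans[of _ "pi * 2"])
    have sin: "sin \<theta> > 0"
      using theta by (simp add: sin_gt_zero)
    have d: "dihedral_coeff s t j = sin (real j * \<theta>) / sin \<theta>" for j
      by (simp add: dihedral_coeff_def enat \<theta>_def)
    have c: "cform s t = - cos \<theta>"
      using st enat by (simp add: cform_def \<theta>_def)
    have "real (Suc (Suc k)) * \<theta> = real (Suc k) * \<theta> + \<theta>" "real k * \<theta> = real (Suc k) * \<theta> - \<theta>"
      by (simp_all add: algebra_simps)
    then have "sin (real (Suc (Suc k)) * \<theta>) = 2 * cos \<theta> * sin (real (Suc k) * \<theta>) - sin (real k * \<theta>)"
      by (simp only: sin_add sin_diff) simp
    then have "dihedral_coeff s t (Suc (Suc k)) = - 2 * cform s t * dihedral_coeff s t (Suc k) - dihedral_coeff s t k"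
      unfolding d c by (simp add: diff_divide_distrib)
    moreover have "dihedral_coeff s t k \<ge> 0" if "k \<le> m"
    proof -
      have "real k * \<theta> \<le> pi"
        unfolding period[symmetric] using that theta by (intro mult_right_mono) auto
      then show ?thesis
        unfolding d using sin theta by (intro divide_nonneg_pos sin_ge_zero) auto
    qed
    ultimately show ?thesis
      using sin enat by (simp add: d)
  next
    case infinity
    then show ?thesis
      using st by (simp add: dihedral_coeff_def cform_def)
  qed
  then show "dihedral_coeff s t 0 = 0" "dihedral_coeff s t 1 = 1"
    "dihedral_coeff s t (Suc (Suc k)) = - 2 * cform s t * dihedral_coeff s t (Suc k) - dihedral_coeff s t k"
    "enat k \<le> M s t \<Longrightarrow> dihedral_coeff s t k \<ge> 0"
    by blast+
qed

lemma lin_alternating: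
  assumes st: "s \<in> S" "t \<in> S" "s \<noteq> t"
  defines "a \<equiv> dihedral_coeff s t"
  shows "lin (prod_gen (alternating s t k)) (sroot s) =
    plane s t (if even k then a (Suc k) else a k) (if even k then a k else a (Suc k))"
proof (induction k)
  case 0
  then show ?case
    using dihedral_coeff(1,2)[OF st] by (auto simp: a_def sroot_def plane_def fun_eq_iff)
next
  case (Suc k)
  let ?p = "if even k then t else s"
  have "set (alternating s t k) \<subseteq> S"
    using set_alternating[of s t k] st by auto
  then have "lin (prod_gen (alternating s t (Suc k))) (sroot s) =
      reflection zero ?p (plane s t (if even k then a (Suc k) else a k) (if even k then a k else a (Suc k)))"
    using Suc st by (simp add: act_mult)
  then show ?case
    using reflection_plane[OF st] dihedral_coeff(3)[OF st, of k] by (simp add: a_def)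
qed

lemma lin_zero: "w \<in> carrier W \<Longrightarrow> lin w zero = zero"
  by (induction w rule: gen_induct) (auto simp: act_mult reflection_def coord_def fun_eq_iff)

lemma lin_scale: "w \<in> carrier W \<Longrightarrow> lin w (\<lambda>i. c * u i) = (\<lambda>i. c * lin w u i)"
  using act_add[of w zero zero c u] lin_zero by simp

lemma lin_plane:
  assumes "w \<in> carrier W" "s \<noteq> t"
  shows "lin w (plane s t x y) = (\<lambda>i. x * lin w (sroot s) i + y * lin w (sroot t) i)"
proof -
  have "plane s t x y = (\<lambda>i. x * sroot s i + y * sroot t i)"
    using assms(2) by (auto simp: plane_def sroot_def fun_eq_iff)
  then show ?thesis
    using act_add[OF assms(1)] lin_scale[OF assms(1)] by simp
qed

text \<open>Induction on the length of \<open>w\<close>. Let \<open>t\<close> be the last letter of a reduced word of \<open>w\<close>, and write \<open>w = v u\<close>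
  with an alternating suffix \<open>u\<close> in \<open>s\<close> and \<open>t\<close> of the greatest possible length \<open>k\<close> such that lengths add.
  Neither \<open>s\<close> nor \<open>t\<close> shortens \<open>v\<close>: one of them would give a longer suffix, the other a shorter word for \<open>w\<close>.
  So \<open>v\<close> maps both simple roots to nonnegative vectors. Moreover \<open>k < m\<close>, since otherwise the braid
  relation would give a reduced word of \<open>w\<close> that ends in \<open>s\<close>. Hence \<open>u\<close> maps the root of \<open>s\<close> to a combination of
  the two simple roots with nonnegative coefficients.\<close>
theorem root_positive:
  assumes "w \<in> carrier W" "s \<in> S" "len w \<le> len (w \<otimes>\<^bsub>W\<^esub> gen s)"
  shows "lin w (sroot s) i \<ge> 0"
  using assms
proof (induction "len w" arbitrary: w s rule: less_induct)
  case less
  note w = less.prems(1) and s = less.prems(2)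
  show ?case
  proof (cases "len w = 0")
    case True
    then show ?thesis
      using len_zero[OF w] by (simp add: sroot_def)
  next
    case False
    then obtain t v where t: "t \<in> S" and v: "v \<in> carrier W" "w = v \<otimes>\<^bsub>W\<^esub> gen t" "len w = Suc (len v)"
      using last_letter[OF w] by metis
    have st: "s \<noteq> t"
      using v less.prems(3) t mult_gen_gen by auto
    have alt: "set (alternating s t k) \<subseteq> S" for k
      using set_alternating[of s t k] s t by auto
    define K where "K = {k. \<exists>v\<in>carrier W. w = v \<otimes>\<^bsub>W\<^esub> prod_gen (alternating s t k) \<and> len v + k = len w}"
    have K: "K \<subseteq> {..len w}"
      by (auto simp: K_def)
    then have fin: "finite K"
      using finite_subset by blast
    have K1: "1 \<in> K"
      unfolding K_def using v t by auto
    define k where "k = Max K"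
    have kK: "k \<in> K"
      unfolding k_def using Max_in[OF fin] K1 by blast
    have k1: "k \<ge> 1"
      unfolding k_def by (rule Max_ge[OF fin K1])
    have kmax: "Suc k \<notin> K"
      using Max_ge[OF fin, of "Suc k"] unfolding k_def by auto
    obtain v where v: "v \<in> carrier W" "w = v \<otimes>\<^bsub>W\<^esub> prod_gen (alternating s t k)" "len v + k = len w"
      using kK unfolding K_def by blast
    obtain k' where k': "k = Suc k'"
      using k1 by (cases k) auto
    let ?p = "if even k' then t else s" and ?p' = "if even k then t else s"
    have p: "?p \<in> S" "?p' \<in> S" and pp: "{s, t} = {?p, ?p'}"
      using s t k' by auto
    have "len v \<le> len (v \<otimes>\<^bsub>W\<^esub> gen ?p')"
    proof (rule ccontr)
      assume "\<not> len v \<le> len (v \<otimes>\<^bsub>W\<^esub> gen ?p')"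
      then have lt: "len (v \<otimes>\<^bsub>W\<^esub> gen ?p') < len v" by simp
      let ?v = "v \<otimes>\<^bsub>W\<^esub> gen ?p'"
      have vc: "?v \<in> carrier W" using v p by simp
      have "?v \<otimes>\<^bsub>W\<^esub> prod_gen (alternating s t (Suc k)) = (?v \<otimes>\<^bsub>W\<^esub> gen ?p') \<otimes>\<^bsub>W\<^esub> prod_gen (alternating s t k)"
        using vc p(2) alt[of k] unfolding alternating.simps(2) prod_gen_simps(2) by (simp add: W.m_assoc del: alternating.simps)
      also have "\<dots> = w"
        using v(2) mult_gen_gen[OF v(1) p(2)] by simp
      finally have weq: "w = ?v \<otimes>\<^bsub>W\<^esub> prod_gen (alternating s t (Suc k))" ..
      have "len w \<le> len ?v + Suc k"
        using len_mult_prod_gen[OF vc alt[of "Suc k"]] unfolding weq[symmetric] by (simp only: length_alternating)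
      then have "len ?v + Suc k = len w"
        using lt v(3) by simp
      then show False
        using kmax vc weq unfolding K_def by blast
    qed
    moreover have "len v \<le> len (v \<otimes>\<^bsub>W\<^esub> gen ?p)"
    proof (rule ccontr)
      assume lt: "\<not> len v \<le> len (v \<otimes>\<^bsub>W\<^esub> gen ?p)"
      have "w = (v \<otimes>\<^bsub>W\<^esub> gen ?p) \<otimes>\<^bsub>W\<^esub> prod_gen (alternating s t k')"
        unfolding v(2) k' alternating.simps(2) prod_gen_simps(2)
        using v(1) p(1) alt[of k'] by (simp add: W.m_assoc del: alternating.simps)
      then have "len w \<le> len (v \<otimes>\<^bsub>W\<^esub> gen ?p) + k'"
        using len_mult_prod_gen[of "v \<otimes>\<^bsub>W\<^esub> gen ?p" "alternating s t k'"] v(1) p(1) alt[of k'] by simp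
      then show False
        using lt v(3) k' by simp
    qed
    ultimately have up: "len v \<le> len (v \<otimes>\<^bsub>W\<^esub> gen s)" "len v \<le> len (v \<otimes>\<^bsub>W\<^esub> gen t)"
      using pp by (auto split: if_splits)
    have lv: "len v < len w"
      using v(3) k1 by simp
    have pos: "lin v (sroot s) i \<ge> 0" "lin v (sroot t) i \<ge> 0"
      using less.hyps[OF lv v(1) s up(1)] less.hyps[OF lv v(1) t up(2)] .
    have km: "enat (Suc k) \<le> M s t"
    proof (rule ccontr)
      assume not: "\<not> enat (Suc k) \<le> M s t"
      then obtain m where m: "M s t = enat m" "m \<le> k"
        by (cases "M s t") auto
      have "m \<ge> 2"
        using M_ge_2[OF s t st] m by (simp add: numeral_eq_enat)
      then obtain m' where m': "m = Suc m'"
        by (cases m) auto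
      obtain xs where xs: "alternating s t k = xs @ alternating s t m" "length xs = k - m" "set xs \<subseteq> {s, t}"
        using alternating_split[OF m(2), of s t] by (elim exE conjE)
      have xsS: "set xs \<subseteq> S"
        using xs(3) s t by auto
      have "prod_gen (alternating s t k) = prod_gen xs \<otimes>\<^bsub>W\<^esub> prod_gen (alternating t s m)"
        unfolding xs(1) using xsS alt[of m] alternating_braid[OF s t st m(1)] by (simp add: prod_gen_append)
      also have "\<dots> = prod_gen xs \<otimes>\<^bsub>W\<^esub> (prod_gen (alternating s t m') \<otimes>\<^bsub>W\<^esub> gen s)"
        unfolding m' alternating_snoc using alt[of m'] s by (simp add: prod_gen_append)
      also have "\<dots> = prod_gen (xs @ alternating s t m') \<otimes>\<^bsub>W\<^esub> gen s"
        using xsS alt[of m'] s by (simp add: prod_gen_append W.m_assoc)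
      finally have "w \<otimes>\<^bsub>W\<^esub> gen s = (v \<otimes>\<^bsub>W\<^esub> prod_gen (xs @ alternating s t m')) \<otimes>\<^bsub>W\<^esub> gen s \<otimes>\<^bsub>W\<^esub> gen s"
        using v(1,2) s xsS alt[of m'] by (simp add: W.m_assoc)
      also have "\<dots> = v \<otimes>\<^bsub>W\<^esub> prod_gen (xs @ alternating s t m')"
        by (rule mult_gen_gen) (use v(1) s xsS alt[of m'] in auto)
      finally have "len (w \<otimes>\<^bsub>W\<^esub> gen s) \<le> len v + (k - m + m')"
        using len_mult_prod_gen[OF v(1), of "xs @ alternating s t m'"] xsS alt[of m'] xs(2) by simp
      then show False
        using less.prems(3) v(3) m m' by simp
    qed
    then have km': "enat k \<le> M s t"
      using order_trans[of "enat k" "enat (Suc k)"] by simp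
    have "lin w (sroot s) = lin v (lin (prod_gen (alternating s t k)) (sroot s))"
      using v(1,2) alt[of k] by (simp add: act_mult)
    then show ?thesis
      unfolding lin_alternating[OF s t st] lin_plane[OF v(1) st]
      using pos dihedral_coeff(4)[OF s t st km] dihedral_coeff(4)[OF s t st km'] by auto
  qed
qed

lemma lin_gen_sroot: "s \<in> S \<Longrightarrow> lin (gen s) (sroot s) = (\<lambda>i. - 1 * sroot s i)"
  using pairing_sroot[of s zero "sroot s"] finite_S
  by (auto simp: reflection_def coord_def sroot_def fun_eq_iff if_distrib cong: if_cong)

lemma root_negative:
  assumes w: "w \<in> carrier W" and s: "s \<in> S" and "len (w \<otimes>\<^bsub>W\<^esub> gen s) < len w"
  shows "lin w (sroot s) i \<le> 0"
proof -
  let ?w = "w \<otimes>\<^bsub>W\<^esub> gen s"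
  have "lin ?w (sroot s) i \<ge> 0"
    by (rule root_positive) (use assms mult_gen_gen in auto)
  moreover have "lin ?w (sroot s) = (\<lambda>i. - 1 * lin w (sroot s) i)"
    using act_mult[of w "gen s" zero "sroot s"] w s lin_gen_sroot[OF s] lin_scale[OF w, of "- 1" "sroot s"]
    by simp
  ultimately show ?thesis by simp
qed

text \<open>A last letter of a reduced word of \<open>w\<close> would have its simple root mapped to a nonpositive vector.\<close>
lemma positive_scalar_trivial:
  assumes w: "w \<in> carrier W" and c: "c > 0"
    and scal: "\<And>s. s \<in> S \<Longrightarrow> lin w (sroot s) = (\<lambda>i. c * sroot s i)"
  shows "w = \<one>\<^bsub>W\<^esub>"
proof (rule ccontr)
  assume "w \<noteq> \<one>\<^bsub>W\<^esub>"
  then obtain s v where s: "s \<in> S" "v \<in> carrier W" "w = v \<otimes>\<^bsub>W\<^esub> gen s" "len w = Suc (len v)"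
    using last_letter[OF w] len_zero[OF w] by metis
  then have "len (w \<otimes>\<^bsub>W\<^esub> gen s) < len w"
    using mult_gen_gen by simp
  from root_negative[OF w s(1) this, of s] show False
    using scal[OF s(1)] c by (simp add: sroot_def)
qed

text \<open>If \<open>s\<close> lengthens \<open>v\<close>, then \<open>v\<close> maps the root of \<open>s\<close> to a positive vector and \<open>w v\<close> maps it to a negative one, so
  that \<open>s\<close> shortens \<open>w v\<close>. Along a reduced word of \<open>y\<close> the length of \<open>w y\<close> thus decreases in each step,
  which bounds the length of \<open>y\<close> by that of \<open>w\<close>.\<close>
lemma negative_scalar_finite:
  assumes w: "w \<in> carrier W" and c: "c < 0"
    and scal: "\<And>y s. y \<in> carrier W \<Longrightarrow> s \<in> S \<Longrightarrow> lin w (lin y (sroot s)) = (\<lambda>i. c * lin y (sroot s) i)"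
  shows "finite (carrier W)"
proof -
  have bound: "len (w \<otimes>\<^bsub>W\<^esub> y) + len y \<le> len w" if "y \<in> carrier W" for y
    using that
  proof (induction "len y" arbitrary: y)
    case 0
    then show ?case using len_zero[of y] w by simp
  next
    case (Suc n)
    then obtain s v where s: "s \<in> S" and v: "v \<in> carrier W" "y = v \<otimes>\<^bsub>W\<^esub> gen s" "len y = Suc (len v)"
      using last_letter[of y] by (metis Suc_not_Zero)
    have IH: "len (w \<otimes>\<^bsub>W\<^esub> v) + len v \<le> len w"
      using Suc.hyps(1)[of v] Suc.hyps(2) v by simp
    have pos: "lin v (sroot s) i \<ge> 0" for i
      by (rule root_positive) (use v s in auto)
    have wv: "w \<otimes>\<^bsub>W\<^esub> v \<in> carrier W"
      using w v by simp
    have "len (w \<otimes>\<^bsub>W\<^esub> v \<otimes>\<^bsub>W\<^esub> gen s) < len (w \<otimes>\<^bsub>W\<^esub> v)"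
    proof (rule ccontr)
      assume "\<not> ?thesis"
      then have "lin (w \<otimes>\<^bsub>W\<^esub> v) (sroot s) i \<ge> 0" for i
        by (intro root_positive) (use wv s in auto)
      then have cp: "c * lin v (sroot s) i \<ge> 0" for i
        using scal[OF v(1) s] w v by (simp add: act_mult)
      have "lin v (sroot s) i = 0" for i
        using cp[of i] pos[of i] c by (simp add: zero_le_mult_iff)
      then have "lin v (sroot s) = zero" by auto
      then have "sroot s = lin (inv\<^bsub>W\<^esub> v) zero"
        using act_inv'[OF v(1), of zero "sroot s"] by simp
      then have "sroot s = zero"
        using lin_zero v by simp
      from fun_cong[OF this, of s] show False
        by (simp add: sroot_def)
    qed
    then show ?case
      using IH v s w by (simp add: W.m_assoc)
  qed
  have "carrier W \<subseteq> prod_gen ` {xs. set xs \<subseteq> S \<and> length xs \<le> len w}"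
  proof
    fix y assume y: "y \<in> carrier W"
    obtain xs where "set xs \<subseteq> S" "length xs = len y" "prod_gen xs = y"
      using y by (rule reduced_word)
    then show "y \<in> prod_gen ` {xs. set xs \<subseteq> S \<and> length xs \<le> len w}"
      using bound[OF y] by force
  qed
  moreover have "finite {xs. set xs \<subseteq> S \<and> length xs \<le> len w}"
    by (rule finite_lists_length_le[OF finite_S])
  ultimately show ?thesis
    using finite_subset by blast
qed

end

section \<open>Infinite groups generated by two involutions\<close>

context group
begin

lemma complementary_sym: "complementary G A B \<Longrightarrow> complementary G B A"
  unfolding complementary_def by (metis Int_commute)

lemma complementary_decompose:
  "complementary G A B \<Longrightarrow> x \<in> carrier G \<Longrightarrow> \<exists>a\<in>A. \<exists>b\<in>B. x = a \<otimes> b"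
  unfolding complementary_def by simp

lemma complementary_normal:
  assumes AB: "complementary G A B" and g: "g \<in> carrier G" and x: "x \<in> A"
  shows "g \<otimes> x \<otimes> inv g \<in> A"
proof -
  have A: "subgroup A G" and B: "subgroup B G" and comm: "\<And>a b. a \<in> A \<Longrightarrow> b \<in> B \<Longrightarrow> a \<otimes> b = b \<otimes> a"
    using AB unfolding complementary_def by auto
  interpret A: subgroup A G by (rule A)
  interpret B: subgroup B G by (rule B)
  obtain a b where ab: "a \<in> A" "b \<in> B" "g = a \<otimes> b"
    using AB g unfolding complementary_def by blast
  have "b \<otimes> x \<otimes> inv b = x \<otimes> b \<otimes> inv b"
    using comm[OF x ab(2)] by simp
  also have "\<dots> = x"
    using x ab(2) by (simp add: m_assoc)
  finally have "g \<otimes> x \<otimes> inv g = a \<otimes> x \<otimes> inv a"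
    using conj_mult[of a b x] ab x by simp
  then show ?thesis
    using ab x by simp
qed

text \<open>The powers of \<open>r = s t\<close> form an infinite cyclic subgroup \<open>N\<close> of index at most two. Nontrivial subgroups of
  \<open>N\<close> meet nontrivially, so one of two complementary factors meets \<open>N\<close> trivially. Such a factor has at
  most two elements, because the product of two elements outside \<open>N\<close> lies in \<open>N\<close>; being normal, it is
  central.\<close>
lemma dihedral_indecomposable:
  assumes s: "s \<in> carrier G" "s \<otimes> s = \<one>" and t: "t \<in> carrier G" "t \<otimes> t = \<one>"
    and gen: "generate G {s, t} = carrier G" and inf: "infinite (carrier G)"
    and centre: "group_center G \<subseteq> {\<one>}"
  shows "indecomposable G"
proof -
  define r where "r = s \<otimes> t"
  have r: "r \<in> carrier G"
    using s t by (simp add: r_def)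
  have inv_s: "inv s = s" and inv_t: "inv t = t"
    using s t by (simp_all add: inv_equality)
  have srs: "s \<otimes> r \<otimes> s = inv r"
    using s t by (simp add: r_def inv_mult_group inv_s inv_t flip: m_assoc)
  have "(\<lambda>x. s \<otimes> x \<otimes> s) \<in> hom G G"
  proof (rule homI)
    fix x y assume xy: "x \<in> carrier G" "y \<in> carrier G"
    have "s \<otimes> x \<otimes> s \<otimes> (s \<otimes> y \<otimes> s) = s \<otimes> x \<otimes> (s \<otimes> s) \<otimes> y \<otimes> s"
      using s(1) xy by (simp only: m_assoc m_closed)
    then show "s \<otimes> (x \<otimes> y) \<otimes> s = s \<otimes> x \<otimes> s \<otimes> (s \<otimes> y \<otimes> s)"
      using s xy by (simp add: m_assoc)
  qed (use s in simp)
  then have conj_pow: "s \<otimes> (r [^] k) \<otimes> s = r [^] (- k)" for k :: int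
    using hom_int_pow[OF _ r is_group is_group, of "\<lambda>x. s \<otimes> x \<otimes> s" k] r srs
    by (simp add: int_pow_neg int_pow_inv)
  then have s_pow: "s \<otimes> (r [^] k) = r [^] (- k) \<otimes> s" for k :: int
    using s r by (metis int_pow_closed inv_s inv_solve_right m_closed)
  have t_eq: "t = r [^] (- 1 :: int) \<otimes> s"
    using s t by (simp add: int_pow_neg r_def inv_mult_group inv_s inv_t m_assoc)
  define N where "N = range (\<lambda>k::int. r [^] k)"
  \<comment> \<open>\<open>T\<close> is closed under left multiplication by \<open>s\<close> and \<open>t\<close>, hence is the whole group.\<close>
  define T where "T = N \<union> (\<lambda>x. x \<otimes> s) ` N"
  have rs: "s \<otimes> x \<in> T" if x: "x \<in> T" for x
  proof -
    obtain k :: int where "x = r [^] k \<or> x = r [^] k \<otimes> s"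
      using x by (auto simp: T_def N_def)
    then have "s \<otimes> x = r [^] (- k) \<otimes> s \<or> s \<otimes> x = r [^] (- k)"
      using s_pow[of k] conj_pow[of k] s r by (auto simp flip: m_assoc)
    then show ?thesis
      by (auto simp: T_def N_def)
  qed
  have rr: "r [^] j \<otimes> x \<in> T" if x: "x \<in> T" for x and j :: int
  proof -
    obtain k :: int where "x = r [^] k \<or> x = r [^] k \<otimes> s"
      using x by (auto simp: T_def N_def)
    then have "r [^] j \<otimes> x = r [^] (j + k) \<or> r [^] j \<otimes> x = r [^] (j + k) \<otimes> s"
      using s r by (auto simp: int_pow_mult m_assoc)
    then show ?thesis
      by (auto simp: T_def N_def)
  qed
  have TG: "T \<subseteq> carrier G"
    using r s by (auto simp: T_def N_def)
  have rt: "t \<otimes> x \<in> T" if x: "x \<in> T" for x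
  proof -
    have "t \<otimes> x = r [^] (- 1 :: int) \<otimes> (s \<otimes> x)"
      using x TG r s unfolding t_eq by (auto simp: m_assoc simp del: int_pow_neg)
    then show ?thesis
      using rr rs x by metis
  qed
  have one: "\<one> \<in> T"
    unfolding T_def N_def by (rule UnI1) (metis int_pow_0 rangeI)
  have "x \<otimes> y \<in> T" if "x \<in> generate G {s, t}" "y \<in> T" for x y
    using that
  proof (induction x arbitrary: y rule: generate.induct)
    case one
    then show ?case using TG by auto
  next
    case (incl h)
    then show ?case using rs rt by blast
  next
    case (inv h)
    then show ?case using rs rt inv_s inv_t by force
  next
    case (eng h1 h2)
    then have "h1 \<in> carrier G" "h2 \<in> carrier G" "y \<in> carrier G"
      using TG gen by auto
    then show ?case using eng by (simp add: m_assoc)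
  qed
  from this[OF _ one] have all: "x \<in> T" if "x \<in> carrier G" for x
    using that gen by force
  have no_period: "k = 0" if k: "r [^] k = \<one>" for k :: int
  proof (rule ccontr)
    assume "k \<noteq> 0"
    have "N \<subseteq> (\<lambda>j. r [^] j) ` {0..<\<bar>k\<bar>}"
    proof
      fix x assume "x \<in> N"
      then obtain j :: int where x: "x = r [^] j" by (auto simp: N_def)
      have "r [^] j = r [^] (k * (j div k) + j mod k)" by simp
      also have "\<dots> = (r [^] k) [^] (j div k) \<otimes> r [^] (j mod k)"
        using r by (simp only: int_pow_mult int_pow_pow)
      finally have 1: "x = r [^] (j mod k)"
        using r by (simp add: x k)
      have "r [^] (j mod k) = r [^] (j mod k mod \<bar>k\<bar>)"
      proof -
        have "r [^] (j mod k) = r [^] (\<bar>k\<bar> * (j mod k div \<bar>k\<bar>) + j mod k mod \<bar>k\<bar>)" by simp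
        also have "\<dots> = (r [^] \<bar>k\<bar>) [^] (j mod k div \<bar>k\<bar>) \<otimes> r [^] (j mod k mod \<bar>k\<bar>)"
          using r by (simp only: int_pow_mult int_pow_pow)
        also have "r [^] \<bar>k\<bar> = \<one>"
          using k r by (cases "k \<ge> 0") (simp_all add: int_pow_neg)
        finally show ?thesis
          using r by simp
      qed
      then show "x \<in> (\<lambda>j. r [^] j) ` {0..<\<bar>k\<bar>}"
        using 1 \<open>k \<noteq> 0\<close> by auto
    qed
    then have "finite N"
      using finite_subset by blast
    then have "finite T"
      by (simp add: T_def)
    then show False
      using inf all finite_subset[of "carrier G" T] by blast
  qed
  have main: "A = {\<one>}" if AB: "complementary G A B" and AN: "A \<inter> N \<subseteq> {\<one>}" for A B
  proof -
    have A: "subgroup A G"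
      using AB unfolding complementary_def by blast
    interpret A: subgroup A G by (rule A)
    have prod: "a \<otimes> a' = \<one>" if a: "a \<in> A" "a \<noteq> \<one>" "a' \<in> A" "a' \<noteq> \<one>" for a a'
    proof -
      obtain k l :: int where kl: "a = r [^] k \<otimes> s" "a' = r [^] l \<otimes> s"
        using all[of a] all[of a'] a AN A.mem_carrier unfolding T_def N_def by blast
      have "a \<otimes> a' = r [^] k \<otimes> (s \<otimes> r [^] l \<otimes> s)"
        using s r by (simp add: kl m_assoc)
      also have "\<dots> = r [^] (k + (- l))"
        unfolding conj_pow using r by (simp only: int_pow_mult)
      finally have "a \<otimes> a' \<in> N"
        by (auto simp: N_def)
      then show ?thesis
        using AN A.m_closed[OF a(1,3)] by blast
    qed
    have "a = \<one>" if a: "a \<in> A" for a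
    proof (rule ccontr)
      assume a1: "a \<noteq> \<one>"
      have "a \<otimes> g = g \<otimes> a" if g: "g \<in> carrier G" for g
      proof -
        let ?c = "g \<otimes> a \<otimes> inv g"
        have c: "?c \<in> A"
          by (rule complementary_normal[OF AB g a])
        have cg: "?c \<otimes> g = g \<otimes> a"
          using g a by (simp add: m_assoc)
        have "?c \<noteq> \<one>"
        proof
          assume "?c = \<one>"
          then have "g \<otimes> a = g \<otimes> \<one>"
            using cg g by simp
          then show False
            using a1 g a by simp
        qed
        then have "a \<otimes> ?c = a \<otimes> a"
          using prod[OF a a1 c] prod[OF a a1 a a1] by simp
        then have "?c = a"
          using A.mem_carrier[OF a] A.mem_carrier[OF c] by simp
        then show ?thesis
          using cg by simp
      qed
      then have "a \<in> group_center G"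
        using a by (simp add: group_center_def)
      then show False
        using centre a1 by blast
    qed
    then show ?thesis
      using A.one_closed by blast
  qed
  show ?thesis
    unfolding indecomposable_iff
  proof (intro allI impI)
    fix A B assume AB: "complementary G A B"
    have A: "subgroup A G" and B: "subgroup B G" and int: "A \<inter> B = {\<one>}"
      using AB unfolding complementary_def by auto
    have "A \<inter> N \<subseteq> {\<one>} \<or> B \<inter> N \<subseteq> {\<one>}"
    proof (rule ccontr)
      assume "\<not> ?thesis"
      then obtain k l :: int where kl: "r [^] k \<in> A" "r [^] k \<noteq> \<one>" "r [^] l \<in> B" "r [^] l \<noteq> \<one>"
        by (auto simp: N_def)
      then have "k \<noteq> 0" "l \<noteq> 0" by auto
      have "(r [^] k) [^] l \<in> A" "(r [^] l) [^] k \<in> B"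
        using kl A B by (simp_all add: subgroup_int_pow_closed)
      then have "r [^] (k * l) \<in> A \<inter> B"
        using r by (simp add: int_pow_pow mult.commute)
      then show False
        using int no_period[of "k * l"] \<open>k \<noteq> 0\<close> \<open>l \<noteq> 0\<close> by auto
    qed
    then show "A = {\<one>} \<or> B = {\<one>}"
      using main[OF AB] main[OF complementary_sym[OF AB]] by blast
  qed
qed

end

section \<open>Infinite irreducible Coxeter groups\<close>

context coxeter_system
begin

lemma lin_outside: "w \<in> carrier W \<Longrightarrow> i \<notin> S \<Longrightarrow> lin w v i = v i"
  by (induction w rule: gen_induct) (auto simp: act_mult reflection_def)

lemma coord_zero_sroot: "s \<in> S \<Longrightarrow> coord zero t (sroot s) = cform t s"
  using finite_S by (simp add: coord_def sroot_def if_distrib cong: if_cong)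

text \<open>The reflection of an adjacent simple root differs from that root by a nonzero multiple of the new one,
  so a scalar action spreads along edges.\<close>
lemma scalar_extends:
  assumes a: "a \<in> carrier W" and st: "(s, t) \<in> (coxeter_edges S M)\<^sup>*"
    and scal: "\<And>y. y \<in> carrier W \<Longrightarrow> lin a (lin y (sroot s)) = (\<lambda>i. c * lin y (sroot s) i)"
    and y: "y \<in> carrier W"
  shows "lin a (lin y (sroot t)) = (\<lambda>i. c * lin y (sroot t) i)"
  using st y
proof (induction arbitrary: y rule: rtrancl_induct)
  case base
  then show ?case by (rule scal)
next
  case (step t u)
  have tu: "t \<in> S" "u \<in> S"
    using step.hyps(2) by (auto simp: coxeter_edges_def)
  define d where "d = - 2 * cform u t"
  have "d \<noteq> 0"
    using cform_edge[OF step.hyps(2)] cform_sym[OF tu] by (simp add: d_def)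
  let ?p = "lin y (sroot t)" and ?q = "lin y (sroot u)"
  have y: "y \<in> carrier W" "y \<otimes>\<^bsub>W\<^esub> gen u \<in> carrier W"
    using step.prems tu by auto
  have eq: "lin (y \<otimes>\<^bsub>W\<^esub> gen u) (sroot t) = (\<lambda>i. ?p i + d * ?q i)"
    using y(1) tu
    by (simp only: act_mult gen_closed act_gen reflection_sroot coord_zero_sroot act_add d_def)
  have "(\<lambda>i. c * (?p i + d * ?q i)) = lin a (\<lambda>i. ?p i + d * ?q i)"
    using step.IH[OF y(2)] unfolding eq by simp
  also have "\<dots> = (\<lambda>i. c * ?p i + d * lin a ?q i)"
    unfolding act_add[OF a] step.IH[OF y(1)] ..
  finally have "c * (?p i + d * ?q i) = c * ?p i + d * lin a ?q i" for i
    by (rule fun_cong)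
  then have "d * (c * ?q i) = d * lin a ?q i" for i
    by (simp add: algebra_simps)
  then show ?case
    using \<open>d \<noteq> 0\<close> by (auto simp: fun_eq_iff)
qed

text \<open>With the indicator function of \<open>j\<close> as parameter, the pairing with the origin reads off the \<open>j\<close>th
  coordinate. Through \<open>act_conjugate\<close>, the image of the origin under the reflection in a root \<open>\<delta>\<close> then has the
  coordinates \<open>- 2 * \<delta> j * \<delta> i\<close>.\<close>
lemma pairing_sroot_zero: "j \<in> S \<Longrightarrow> pairing (sroot j) u zero = u j"
  using finite_S by (simp add: pairing_def coord_def sroot_def if_distrib cong: if_cong)

end

locale irreducible_infinite_coxeter_system = coxeter_system +
  assumes connected: "\<And>s t. s \<in> S \<Longrightarrow> t \<in> S \<Longrightarrow> (s, t) \<in> (coxeter_edges S M)\<^sup>*"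
    and infinite_W: "infinite (carrier W)"
begin

lemma scalar_trivial:
  assumes a: "a \<in> carrier W" and s: "s \<in> S"
    and scal: "\<And>y. y \<in> carrier W \<Longrightarrow> lin a (lin y (sroot s)) = (\<lambda>i. c * lin y (sroot s) i)"
  shows "a = \<one>\<^bsub>W\<^esub>"
proof -
  have all: "lin a (lin y (sroot t)) = (\<lambda>i. c * lin y (sroot t) i)" if "y \<in> carrier W" "t \<in> S" for y t
    using scalar_extends[OF a connected[OF s that(2)] scal that(1)] .
  consider "c > 0" | "c = 0" | "c < 0" by linarith
  then show ?thesis
  proof cases
    case 1
    show ?thesis
      by (rule positive_scalar_trivial[OF a 1]) (use all[of "\<one>\<^bsub>W\<^esub>"] in simp)
  next
    case 2
    then have "lin a (sroot s) = zero"
      using all[of "\<one>\<^bsub>W\<^esub>" s] s by simp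
    then have "sroot s = lin (inv\<^bsub>W\<^esub> a) zero"
      using act_inv'[OF a, of zero "sroot s"] by simp
    then have "sroot s = zero"
      using lin_zero a by simp
    from fun_cong[OF this, of s] show ?thesis
      by (simp add: sroot_def)
  next
    case 3
    then show ?thesis
      using negative_scalar_finite[OF a 3 all] infinite_W by blast
  qed
qed

lemma root_line:
  assumes w: "w \<in> carrier W" and "s \<in> S" and off: "\<And>i. i \<in> S \<Longrightarrow> i \<noteq> s \<Longrightarrow> lin w (sroot s) i = 0"
  shows "lin w (sroot s) = (\<lambda>i. lin w (sroot s) s * sroot s i)"
proof
  fix i
  show "lin w (sroot s) i = lin w (sroot s) s * sroot s i"
    using off[of i] lin_outside[OF w, of i "sroot s"] assms(2) by (cases "i \<in> S") (auto simp: sroot_def)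
qed

text \<open>Conjugation by a central \<open>z\<close> fixes \<open>s\<close>, so \<open>z\<close> preserves the line of its root. As \<open>z\<close> commutes with the group,
  it acts by the same scalar on the whole orbit of that root.\<close>
lemma centre_trivial: "group_center W \<subseteq> {\<one>\<^bsub>W\<^esub>}"
proof
  fix z assume "z \<in> group_center W"
  then have z: "z \<in> carrier W" and comm: "\<And>g. g \<in> carrier W \<Longrightarrow> z \<otimes>\<^bsub>W\<^esub> g = g \<otimes>\<^bsub>W\<^esub> z"
    by (auto simp: group_center_def)
  have "S \<noteq> {}"
  proof
    assume "S = {}"
    then have "carrier W = {\<one>\<^bsub>W\<^esub>}"
      using generate_gen W.generate_empty by simp
    then show False using infinite_W by simp
  qed
  then obtain s where s: "s \<in> S" by blast
  have conj: "z \<otimes>\<^bsub>W\<^esub> gen s \<otimes>\<^bsub>W\<^esub> inv\<^bsub>W\<^esub> z = gen s"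
    using comm[of "gen s"] z s by (simp add: W.m_assoc)
  have "lin z (sroot s) i = 0" if i: "i \<in> S" "i \<noteq> s" for i
  proof -
    have "act (sroot i) (gen s) zero i = - 2 * lin z (sroot s) i * lin z (sroot s) i"
      using act_conjugate[OF s z, of "sroot i" zero] i unfolding conj by (simp add: pairing_sroot_zero)
    then show ?thesis
      using s i by (simp add: reflection_def)
  qed
  from root_line[OF z s this] have line: "lin z (sroot s) = (\<lambda>i. lin z (sroot s) s * sroot s i)" .
  have "z = \<one>\<^bsub>W\<^esub>"
  proof (rule scalar_trivial[OF z s])
    fix y assume y: "y \<in> carrier W"
    have "lin z (lin y (sroot s)) = lin y (lin z (sroot s))"
      using y z comm[OF y] by (simp flip: act_mult)
    also have "\<dots> = (\<lambda>i. lin z (sroot s) s * lin y (sroot s) i)"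
      by (subst line) (rule lin_scale[OF y])
    finally show "lin z (lin y (sroot s)) = (\<lambda>i. lin z (sroot s) s * lin y (sroot s) i)" .
  qed
  then show "z \<in> {\<one>\<^bsub>W\<^esub>}" by simp
qed

text \<open>Both sides of \<open>(a b) s (a b)\<^sup>-\<^sup>1 = (a s a\<^sup>-\<^sup>1) s (b s b\<^sup>-\<^sup>1)\<close> are applied to the origin of the affine action with
  parameter the indicator function of \<open>i\<close>, and the \<open>j\<close>th coordinates are compared. The coordinate \<open>s\<close> is
  left out, which amounts to working modulo the root of \<open>s\<close>. The left-hand side is a matrix of rank
  one.\<close>
lemma three_reflections:
  assumes AB: "complementary W A B" and s: "s \<in> S" and a: "a \<in> A" and b: "b \<in> B"
  defines "\<beta> \<equiv> lin a (sroot s)" and "\<gamma> \<equiv> lin b (sroot s)" and "\<delta> \<equiv> lin (a \<otimes>\<^bsub>W\<^esub> b) (sroot s)"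
  shows "\<exists>r. \<forall>i\<in>S - {s}. \<forall>j\<in>S - {s}. \<delta> i * \<delta> j = \<gamma> i * \<gamma> j + \<beta> i * \<beta> j + r * \<gamma> i * \<beta> j"
proof -
  have A: "subgroup A W" and B: "subgroup B W"
    and comm: "\<And>a b. a \<in> A \<Longrightarrow> b \<in> B \<Longrightarrow> a \<otimes>\<^bsub>W\<^esub> b = b \<otimes>\<^bsub>W\<^esub> a"
    using AB unfolding complementary_def by auto
  interpret A: subgroup A W by (rule A)
  interpret B: subgroup B W by (rule B)
  have ac: "a \<in> carrier W" and bc: "b \<in> carrier W" and sc: "gen s \<in> carrier W"
    using a b s by auto
  let ?R = "\<lambda>w. w \<otimes>\<^bsub>W\<^esub> gen s \<otimes>\<^bsub>W\<^esub> inv\<^bsub>W\<^esub> w"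
  have "gen s \<otimes>\<^bsub>W\<^esub> inv\<^bsub>W\<^esub> a \<otimes>\<^bsub>W\<^esub> inv\<^bsub>W\<^esub> (gen s) \<in> A"
    by (rule W.complementary_normal[OF AB sc]) (use a in simp)
  then have sas: "gen s \<otimes>\<^bsub>W\<^esub> inv\<^bsub>W\<^esub> a \<otimes>\<^bsub>W\<^esub> gen s \<in> A"
    using s by simp
  have "?R a \<otimes>\<^bsub>W\<^esub> (gen s \<otimes>\<^bsub>W\<^esub> ?R b)
      = a \<otimes>\<^bsub>W\<^esub> ((gen s \<otimes>\<^bsub>W\<^esub> inv\<^bsub>W\<^esub> a \<otimes>\<^bsub>W\<^esub> gen s) \<otimes>\<^bsub>W\<^esub> b) \<otimes>\<^bsub>W\<^esub> gen s \<otimes>\<^bsub>W\<^esub> inv\<^bsub>W\<^esub> b"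
    using ac bc sc by (simp add: W.m_assoc)
  also have "\<dots> = a \<otimes>\<^bsub>W\<^esub> (b \<otimes>\<^bsub>W\<^esub> (gen s \<otimes>\<^bsub>W\<^esub> inv\<^bsub>W\<^esub> a \<otimes>\<^bsub>W\<^esub> gen s)) \<otimes>\<^bsub>W\<^esub> gen s \<otimes>\<^bsub>W\<^esub> inv\<^bsub>W\<^esub> b"
    using comm[OF sas b] by simp
  also have "\<dots> = a \<otimes>\<^bsub>W\<^esub> b \<otimes>\<^bsub>W\<^esub> gen s \<otimes>\<^bsub>W\<^esub> (inv\<^bsub>W\<^esub> a \<otimes>\<^bsub>W\<^esub> (gen s \<otimes>\<^bsub>W\<^esub> gen s) \<otimes>\<^bsub>W\<^esub> inv\<^bsub>W\<^esub> b)"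
    using ac bc sc by (simp only: W.m_assoc W.m_closed W.inv_closed)
  also have "\<dots> = ?R (a \<otimes>\<^bsub>W\<^esub> b)"
    using ac bc sc s comm[of "inv\<^bsub>W\<^esub> a" "inv\<^bsub>W\<^esub> b"] a b by (simp add: W.inv_mult_group)
  finally have prod: "?R (a \<otimes>\<^bsub>W\<^esub> b) = ?R a \<otimes>\<^bsub>W\<^esub> (gen s \<otimes>\<^bsub>W\<^esub> ?R b)" ..
  define p where "p = coord zero s \<gamma>"
  define k where "k = pairing zero \<beta> \<gamma>"
  define l where "l = pairing zero \<beta> (sroot s)"
  have "\<delta> i * \<delta> j = \<gamma> i * \<gamma> j + \<beta> i * \<beta> j + (4 * p * l - 2 * k) * \<gamma> i * \<beta> j"
    if ij: "i \<in> S - {s}" "j \<in> S - {s}" for i j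
  proof -
    let ?g = "sroot i"
    have i: "i \<in> S" "i \<noteq> s" and j: "j \<noteq> s" using ij by auto
    define v1 where "v1 = (\<lambda>n. zero n + (- 2 * \<gamma> i) * \<gamma> n)"
    define v2 where "v2 = (\<lambda>n. v1 n + (4 * \<gamma> i * p) * sroot s n)"
    have 1: "act ?g (?R b) zero = v1"
      unfolding v1_def act_conjugate[OF s bc] pairing_sroot_zero[OF i(1)] \<gamma>_def ..
    have "coord ?g s zero = 0"
      using i by (simp add: coord_def sroot_def)
    then have "coord ?g s v1 = - 2 * \<gamma> i * p"
      unfolding v1_def coord_add by (simp add: p_def)
    then have 2: "act ?g (gen s) v1 = v2"
      using s by (simp add: reflection_sroot v2_def mult.assoc)
    have "pairing ?g \<beta> v2 = \<beta> i - 2 * \<gamma> i * k + 4 * \<gamma> i * p * l"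
      unfolding v2_def v1_def pairing_add pairing_sroot_zero[OF i(1)] by (simp add: k_def l_def)
    then have 3: "act ?g (?R a) v2 = (\<lambda>n. v2 n + (- 2 * (\<beta> i - 2 * \<gamma> i * k + 4 * \<gamma> i * p * l)) * \<beta> n)"
      unfolding act_conjugate[OF s ac] \<beta>_def by simp
    have "act ?g (?R (a \<otimes>\<^bsub>W\<^esub> b)) zero = act ?g (?R a) (act ?g (gen s) (act ?g (?R b) zero))"
      unfolding prod using ac bc sc by (simp add: act_mult)
    then have "(\<lambda>n. zero n + (- 2 * \<delta> i) * \<delta> n) =
        (\<lambda>n. v2 n + (- 2 * (\<beta> i - 2 * \<gamma> i * k + 4 * \<gamma> i * p * l)) * \<beta> n)"
      unfolding 1 2 3 act_conjugate[OF s W.m_closed[OF ac bc]] pairing_sroot_zero[OF i(1)] \<delta>_def .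
    from fun_cong[OF this, of j] show ?thesis
      using j by (simp add: v2_def v1_def sroot_def algebra_simps)
  qed
  then show ?thesis by blast
qed

text \<open>All vectors are considered modulo the root of \<open>s\<close>, that is, off the coordinate \<open>s\<close>. The matrix of rank one in
  \<open>three_reflections\<close> has vanishing minors, and its minor at \<open>i\<close> and \<open>j\<close> is the square of the minor of the
  vectors \<open>b \<alpha>\<close> and \<open>a \<alpha>\<close>. So each \<open>a \<alpha>\<close> is parallel to each \<open>b \<alpha>\<close>; as neither factor preserves the line of
  \<open>\<alpha>\<close>, all of them are multiples of one vector \<open>\<eta>\<close>, and then so is each \<open>(a b) \<alpha>\<close>.\<close>
lemma parallel_orbit:
  assumes AB: "complementary W A B" and s: "s \<in> S"
    and a0: "a0 \<in> A" "i0 \<in> S - {s}" "lin a0 (sroot s) i0 \<noteq> 0"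
    and b0: "b0 \<in> B" "j0 \<in> S - {s}" "lin b0 (sroot s) j0 \<noteq> 0"
    and w: "w \<in> carrier W" "w' \<in> carrier W" and ij: "i \<in> S - {s}" "j \<in> S - {s}"
  shows "lin w (sroot s) i * lin w' (sroot s) j = lin w (sroot s) j * lin w' (sroot s) i"
proof -
  let ?v = "\<lambda>w. lin w (sroot s)"
  have AB_parallel: "?v b i * ?v a j = ?v b j * ?v a i"
    if a: "a \<in> A" and b: "b \<in> B" and ij: "i \<in> S - {s}" "j \<in> S - {s}" for a b i j
  proof -
    obtain r where r: "\<forall>i\<in>S - {s}. \<forall>j\<in>S - {s}. ?v (a \<otimes>\<^bsub>W\<^esub> b) i * ?v (a \<otimes>\<^bsub>W\<^esub> b) j =
        ?v b i * ?v b j + ?v a i * ?v a j + r * ?v b i * ?v a j"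
      using three_reflections[OF AB s a b] by (elim exE)
    let ?D = "\<lambda>i j. ?v b i * ?v b j + ?v a i * ?v a j + r * ?v b i * ?v a j"
    let ?d = "?v (a \<otimes>\<^bsub>W\<^esub> b)"
    have d: "?d i * ?d i = ?D i i" "?d j * ?d j = ?D j j" "?d i * ?d j = ?D i j" "?d j * ?d i = ?D j i"
      using r ij by blast+
    have "?D i i * ?D j j = ?D i j * ?D j i"
      unfolding d[symmetric] by (simp add: algebra_simps)
    then have "(?v b i * ?v a j - ?v b j * ?v a i)\<^sup>2 = 0"
      by (simp add: power2_eq_square algebra_simps)
    then show ?thesis by simp
  qed
  define \<eta> where "\<eta> = ?v a0"
  have eta: "\<eta> i0 \<noteq> 0"
    using a0 by (simp add: \<eta>_def)
  have B_eta: "?v b i = ?v b i0 / \<eta> i0 * \<eta> i" if "b \<in> B" "i \<in> S - {s}" for b i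
    using AB_parallel[OF a0(1) that a0(2)] eta by (simp add: \<eta>_def field_simps)
  have b0_i0: "?v b0 i0 \<noteq> 0"
    using B_eta[OF b0(1,2)] b0(3) by auto
  have A_eta: "?v a i = ?v a i0 / \<eta> i0 * \<eta> i" if a: "a \<in> A" "i \<in> S - {s}" for a i
  proof -
    have "?v b0 i0 * (?v a i * \<eta> i0) = (?v b0 i * ?v a i0) * \<eta> i0"
      using AB_parallel[OF a(1) b0(1) a(2) a0(2)] by simp
    also have "\<dots> = (?v b0 i * \<eta> i0) * ?v a i0"
      by simp
    also have "\<dots> = ?v b0 i0 * (?v a i0 * \<eta> i)"
      using AB_parallel[OF a0(1) b0(1) a(2) a0(2)] by (simp add: \<eta>_def)
    finally have "?v a i * \<eta> i0 = ?v a i0 * \<eta> i"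
      using b0_i0 by simp
    then show ?thesis
      using eta by (simp add: field_simps)
  qed
  have line: "\<exists>c. \<forall>i\<in>S - {s}. ?v w i = c * \<eta> i" if w: "w \<in> carrier W" for w
  proof -
    obtain a b where ab: "a \<in> A" "b \<in> B" "w = a \<otimes>\<^bsub>W\<^esub> b"
      using W.complementary_decompose[OF AB w] by blast
    obtain r where r: "\<forall>i\<in>S - {s}. \<forall>j\<in>S - {s}. ?v w i * ?v w j =
        ?v b i * ?v b j + ?v a i * ?v a j + r * ?v b i * ?v a j"
      using three_reflections[OF AB s ab(1,2)] unfolding ab(3)[symmetric] by (elim exE)
    define x where "x = ?v a i0 / \<eta> i0"
    define y where "y = ?v b i0 / \<eta> i0"
    have prod: "?v w i * ?v w j = (y * y + x * x + r * y * x) * (\<eta> i * \<eta> j)"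
      if ij: "i \<in> S - {s}" "j \<in> S - {s}" for i j
    proof -
      have "?v a i = x * \<eta> i" "?v a j = x * \<eta> j" "?v b i = y * \<eta> i" "?v b j = y * \<eta> j"
        unfolding x_def y_def by (rule A_eta[OF ab(1)] B_eta[OF ab(2)] ij)+
      moreover have "?v w i * ?v w j = ?v b i * ?v b j + ?v a i * ?v a j + r * ?v b i * ?v a j"
        using r ij by blast
      ultimately show ?thesis
        by (simp add: algebra_simps)
    qed
    have "?v w i = ?v w i0 / \<eta> i0 * \<eta> i" if i: "i \<in> S - {s}" for i
    proof -
      have "(?v w i * \<eta> i0 - ?v w i0 * \<eta> i)\<^sup>2 =
          (?v w i * ?v w i) * (\<eta> i0 * \<eta> i0) - 2 * (?v w i * ?v w i0) * (\<eta> i0 * \<eta> i) + (?v w i0 * ?v w i0) * (\<eta> i * \<eta> i)"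
        by (simp add: power2_eq_square algebra_simps)
      also have "\<dots> = 0"
        unfolding prod[OF i i] prod[OF i a0(2)] prod[OF a0(2) a0(2)] by (simp add: algebra_simps)
      finally have "?v w i * \<eta> i0 = ?v w i0 * \<eta> i" by simp
      then show ?thesis
        using eta by (simp add: field_simps)
    qed
    then show ?thesis by blast
  qed
  obtain c c' where "\<forall>i\<in>S - {s}. ?v w i = c * \<eta> i" "\<forall>i\<in>S - {s}. ?v w' i = c' * \<eta> i"
    using line[OF w(1)] line[OF w(2)] by blast
  then show ?thesis
    using ij by simp
qed

text \<open>Each \<open>a \<in> A\<close> scales the root of \<open>s\<close>. It commutes with \<open>B\<close>, and the orbit of the root under \<open>B\<close> spans the same lines
  as its orbit under \<open>W\<close>, so \<open>a\<close> acts by the same scalar on the whole orbit.\<close>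
lemma fixed_line_trivial:
  assumes AB: "complementary W A B" and s: "s \<in> S"
    and off: "\<And>a i. a \<in> A \<Longrightarrow> i \<in> S - {s} \<Longrightarrow> lin a (sroot s) i = 0"
  shows "A = {\<one>\<^bsub>W\<^esub>}"
proof -
  have A: "subgroup A W" and B: "subgroup B W"
    and comm: "\<And>a b. a \<in> A \<Longrightarrow> b \<in> B \<Longrightarrow> a \<otimes>\<^bsub>W\<^esub> b = b \<otimes>\<^bsub>W\<^esub> a"
    using AB unfolding complementary_def by auto
  interpret A: subgroup A W by (rule A)
  interpret B: subgroup B W by (rule B)
  have line: "lin a (sroot s) = (\<lambda>i. lin a (sroot s) s * sroot s i)" if "a \<in> A" for a
    by (rule root_line) (use that s off in auto)
  have "a = \<one>\<^bsub>W\<^esub>" if a: "a \<in> A" for a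
  proof (rule scalar_trivial[OF _ s])
    show ac: "a \<in> carrier W" using a by simp
    fix y assume "y \<in> carrier W"
    from W.complementary_decompose[OF AB this]
    obtain a' b where ab: "a' \<in> A" "b \<in> B" "y = a' \<otimes>\<^bsub>W\<^esub> b"
      by (elim bexE)
    define c c' where "c = lin a (sroot s) s" and "c' = lin a' (sroot s) s"
    have bc: "b \<in> carrier W" "a' \<in> carrier W"
      using ab by auto
    have "lin y (sroot s) = lin b (lin a' (sroot s))"
      using bc comm[OF ab(1,2)] by (simp add: ab(3) flip: act_mult)
    also have "\<dots> = (\<lambda>i. c' * lin b (sroot s) i)"
      unfolding c'_def by (subst line[OF ab(1)]) (rule lin_scale[OF bc(1)])
    finally have y: "lin y (sroot s) = (\<lambda>i. c' * lin b (sroot s) i)" .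
    have "lin a (lin b (sroot s)) = lin b (lin a (sroot s))"
      using ac bc comm[OF a ab(2)] by (simp flip: act_mult)
    also have "\<dots> = (\<lambda>i. c * lin b (sroot s) i)"
      unfolding c_def by (subst line[OF a]) (rule lin_scale[OF bc(1)])
    finally have "lin a (lin y (sroot s)) = (\<lambda>i. c' * (c * lin b (sroot s) i))"
      unfolding y lin_scale[OF ac] by simp
    then show "lin a (lin y (sroot s)) = (\<lambda>i. c * lin y (sroot s) i)"
      by (simp add: y algebra_simps)
  qed
  then show ?thesis
    using A.one_closed by blast
qed

text \<open>With two generators the group is infinite dihedral. With three generators or more, \<open>s\<close> has a neighbour \<open>t\<close>, and a third generator \<open>u\<close> is adjacent to \<open>s\<close> or \<open>t\<close>. Off the
  coordinate \<open>s\<close>, the image of the root of \<open>s\<close> under \<open>t\<close> has only the coordinate \<open>t\<close>, while its image under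
  \<open>u\<close> or \<open>u t\<close> involves \<open>u\<close>; so the orbit is not parallel, and one factor preserves the line of the root.\<close>
theorem W_indecomposable: "indecomposable W"
proof (cases "\<exists>s t. S \<subseteq> {s, t}")
  case True
  then obtain s0 t0 where st0: "S \<subseteq> {s0, t0}" by blast
  have "S \<noteq> {}"
  proof
    assume "S = {}"
    then have "carrier W = {\<one>\<^bsub>W\<^esub>}"
      using generate_gen W.generate_empty by simp
    then show False using infinite_W by simp
  qed
  with st0 obtain s t where st: "s \<in> S" "t \<in> S" and S: "S = {s, t}" by blast
  have "gen ` S = {gen s, gen t}"
    by (subst S) simp
  then have "generate W {gen s, gen t} = carrier W"
    using generate_gen by simp
  from W.dihedral_indecomposable[OF gen_closed gen_sq gen_closed gen_sq this infinite_W centre_trivial]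
  show ?thesis
    using st by simp
next
  case False
  then have "S \<noteq> {}" by blast
  then obtain s where s: "s \<in> S" by blast
  obtain t where st: "(s, t) \<in> coxeter_edges S M"
  proof -
    obtain x where "x \<in> S" "x \<noteq> s" using False by blast
    then show ?thesis
      using connected[OF s] that by (metis converse_rtranclE)
  qed
  then have t: "t \<in> S" "t \<noteq> s"
    by (auto simp: coxeter_edges_def)
  have "\<exists>x u. x \<in> {s, t} \<and> u \<notin> {s, t} \<and> (x, u) \<in> coxeter_edges S M"
  proof (rule ccontr)
    assume not: "\<not> ?thesis"
    have "x \<in> {s, t}" if "(s, x) \<in> (coxeter_edges S M)\<^sup>*" for x
      using that by (induction rule: rtrancl_induct) (use not in blast)+
    then show False
      using False connected[OF s] by blast
  qed
  then obtain x u where xu: "x \<in> {s, t}" "u \<notin> {s, t}" "(x, u) \<in> coxeter_edges S M" by blast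
  then have u: "u \<in> S" "u \<noteq> s" "u \<noteq> t"
    by (auto simp: coxeter_edges_def)
  have ts: "cform t s < 0"
    using cform_edge[OF st] cform_sym s t by simp
  have vt: "lin (gen t) (sroot s) = (\<lambda>i. sroot s i + (- 2 * cform t s) * sroot t i)"
    using s t by (simp only: act_gen reflection_sroot coord_zero_sroot)
  have "\<exists>w\<in>carrier W. lin w (sroot s) u \<noteq> 0"
  proof (cases "(s, u) \<in> coxeter_edges S M")
    case True
    then have "cform u s \<noteq> 0"
      using cform_edge[OF True] cform_sym s u by simp
    moreover have "lin (gen u) (sroot s) = (\<lambda>i. sroot s i + (- 2 * cform u s) * sroot u i)"
      using s u by (simp only: act_gen reflection_sroot coord_zero_sroot)
    ultimately have "lin (gen u) (sroot s) u \<noteq> 0"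
      using u by (simp add: sroot_def)
    then show ?thesis
      using u gen_closed by blast
  next
    case False
    then have us: "cform u s = 0"
      using cform_nonedge(2)[of s u] cform_sym s u by simp
    have "(t, u) \<in> coxeter_edges S M"
      using xu False by blast
    then have ut: "cform u t \<noteq> 0"
      using cform_edge cform_sym[of t u] t u by force
    have "lin (gen u \<otimes>\<^bsub>W\<^esub> gen t) (sroot s) u = lin (gen u) (\<lambda>i. sroot s i + (- 2 * cform t s) * sroot t i) u"
      using u t vt by (simp add: act_mult del: act_gen)
    also have "\<dots> = 4 * cform t s * cform u t"
      unfolding act_add[OF gen_closed[OF u(1)]]
      unfolding act_gen[OF u(1)] reflection_sroot coord_zero_sroot[OF s] coord_zero_sroot[OF t(1)] us
      using u by (simp add: sroot_def)
    finally have "lin (gen u \<otimes>\<^bsub>W\<^esub> gen t) (sroot s) u \<noteq> 0"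
      using ts ut by simp
    then show ?thesis
      using u t gen_closed by (metis W.m_closed)
  qed
  then obtain w where w: "w \<in> carrier W" "lin w (sroot s) u \<noteq> 0" by blast
  show ?thesis
    unfolding W.indecomposable_iff
  proof (intro allI impI)
    fix A B assume AB: "complementary W A B"
    show "A = {\<one>\<^bsub>W\<^esub>} \<or> B = {\<one>\<^bsub>W\<^esub>}"
    proof (rule ccontr)
      assume not: "\<not> ?thesis"
      obtain a0 i0 where a0: "a0 \<in> A" "i0 \<in> S - {s}" "lin a0 (sroot s) i0 \<noteq> 0"
        using fixed_line_trivial[OF AB s] not by blast
      obtain b0 j0 where b0: "b0 \<in> B" "j0 \<in> S - {s}" "lin b0 (sroot s) j0 \<noteq> 0"
        using fixed_line_trivial[OF W.complementary_sym[OF AB] s] not by blast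
      have "lin (gen t) (sroot s) t * lin w (sroot s) u = lin (gen t) (sroot s) u * lin w (sroot s) t"
        by (rule parallel_orbit[OF AB s a0 b0]) (use t u w in auto)
      then show False
        unfolding vt using t u w ts by (simp add: sroot_def)
    qed
  qed
qed

end

section \<open>Commuting subgroups and transport along isomorphisms\<close>

context group
begin

lemma generate_commute:
  assumes A: "A \<subseteq> carrier G" and B: "B \<subseteq> carrier G"
    and comm: "\<And>a b. a \<in> A \<Longrightarrow> b \<in> B \<Longrightarrow> a \<otimes> b = b \<otimes> a"
    and x: "x \<in> generate G A" and y: "y \<in> generate G B"
  shows "x \<otimes> y = y \<otimes> x"
proof -
  have sub: "subgroup {x \<in> carrier G. \<forall>b\<in>C. b \<otimes> x = x \<otimes> b} G" if C: "C \<subseteq> carrier G" for C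
  proof (rule subgroup.intro)
    fix u v assume uv: "u \<in> {x \<in> carrier G. \<forall>b\<in>C. b \<otimes> x = x \<otimes> b}" "v \<in> {x \<in> carrier G. \<forall>b\<in>C. b \<otimes> x = x \<otimes> b}"
    then have "b \<otimes> (u \<otimes> v) = u \<otimes> v \<otimes> b" if "b \<in> C" for b
      using that C by (intro commute_mult) auto
    then show "u \<otimes> v \<in> {x \<in> carrier G. \<forall>b\<in>C. b \<otimes> x = x \<otimes> b}"
      using uv by blast
  next
    fix u assume u: "u \<in> {x \<in> carrier G. \<forall>b\<in>C. b \<otimes> x = x \<otimes> b}"
    have "b \<otimes> inv u = inv u \<otimes> b" if b: "b \<in> C" for b
    proof -
      have c: "u \<in> carrier G" "b \<in> carrier G" "b \<otimes> u = u \<otimes> b"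
        using u b C by auto
      have "inv u \<otimes> b = inv u \<otimes> (b \<otimes> u) \<otimes> inv u"
        using c(1,2) by (simp add: m_assoc)
      also have "\<dots> = inv u \<otimes> (u \<otimes> b) \<otimes> inv u"
        using c(3) by simp
      also have "\<dots> = b \<otimes> inv u"
        using c(1,2) by (simp flip: m_assoc)
      finally show ?thesis ..
    qed
    then show "inv u \<in> {x \<in> carrier G. \<forall>b\<in>C. b \<otimes> x = x \<otimes> b}"
      using u by blast
  qed (use C in auto)
  have "generate G A \<subseteq> {x \<in> carrier G. \<forall>b\<in>B. b \<otimes> x = x \<otimes> b}"
  proof (rule generate_subgroup_incl[OF _ sub[OF B]])
    have "b \<otimes> a = a \<otimes> b" if "a \<in> A" "b \<in> B" for a b
      using comm[OF that] by (rule sym)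
    then show "A \<subseteq> {x \<in> carrier G. \<forall>b\<in>B. b \<otimes> x = x \<otimes> b}"
      using A by blast
  qed
  then have xB: "x \<otimes> b = b \<otimes> x" if "b \<in> B" for b
    using x that by auto
  have xG: "x \<in> carrier G"
    using generate_in_carrier[OF A x] .
  have "generate G B \<subseteq> {y \<in> carrier G. \<forall>b\<in>{x}. b \<otimes> y = y \<otimes> b}"
    by (rule generate_subgroup_incl[OF _ sub]) (use B xB xG in auto)
  then show ?thesis
    using y by auto
qed

lemma finite_generate_Un:
  assumes A: "A \<subseteq> carrier G" "finite (generate G A)" and B: "B \<subseteq> carrier G" "finite (generate G B)"
    and comm: "\<And>a b. a \<in> A \<Longrightarrow> b \<in> B \<Longrightarrow> a \<otimes> b = b \<otimes> a"
  shows "finite (generate G (A \<union> B))"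
proof -
  let ?A = "generate G A" and ?B = "generate G B"
  let ?P = "(\<lambda>(a, b). a \<otimes> b) ` (?A \<times> ?B)"
  interpret A: subgroup ?A G by (rule generate_is_subgroup[OF A(1)])
  interpret B: subgroup ?B G by (rule generate_is_subgroup[OF B(1)])
  have comm': "b \<otimes> a = a \<otimes> b" if "a \<in> ?A" "b \<in> ?B" for a b
    using generate_commute[OF A(1) B(1) comm that] by simp
  have "subgroup ?P G"
  proof (rule subgroup.intro)
    show "?P \<subseteq> carrier G" by auto
    show "\<one> \<in> ?P"
      by (rule image_eqI[of _ _ "(\<one>, \<one>)"]) auto
  next
    fix u v assume "u \<in> ?P" "v \<in> ?P"
    then obtain a b a' b' where *: "u = a \<otimes> b" "v = a' \<otimes> b'" "a \<in> ?A" "b \<in> ?B" "a' \<in> ?A" "b' \<in> ?B"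
      by auto
    have "u \<otimes> v = a \<otimes> (b \<otimes> a') \<otimes> b'"
      using * by (simp add: m_assoc)
    also have "\<dots> = (a \<otimes> a') \<otimes> (b \<otimes> b')"
      unfolding comm'[OF *(5,4)] using * by (simp add: m_assoc)
    finally show "u \<otimes> v \<in> ?P"
      using * by (intro image_eqI[of _ _ "(a \<otimes> a', b \<otimes> b')"]) auto
  next
    fix u assume "u \<in> ?P"
    then obtain a b where *: "u = a \<otimes> b" "a \<in> ?A" "b \<in> ?B" by auto
    have "inv u = inv a \<otimes> inv b"
      using * comm'[of "inv a" "inv b"] by (simp add: inv_mult_group)
    then show "inv u \<in> ?P"
      using * by (intro image_eqI[of _ _ "(inv a, inv b)"]) auto
  qed
  moreover have "A \<union> B \<subseteq> ?P"
  proof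
    fix x assume "x \<in> A \<union> B"
    then consider "x \<in> ?A" | "x \<in> ?B"
      by (auto intro: generate.incl)
    then show "x \<in> ?P"
    proof cases
      case 1
      then show ?thesis by (intro image_eqI[of _ _ "(x, \<one>)"]) auto
    next
      case 2
      then show ?thesis by (intro image_eqI[of _ _ "(\<one>, x)"]) auto
    qed
  qed
  ultimately have "generate G (A \<union> B) \<subseteq> ?P"
    using generate_subgroup_incl by blast
  then show ?thesis
    using A(2) B(2) finite_subset by blast
qed

lemma complementary_iso_image:
  assumes AB: "complementary G A B" and h: "h \<in> iso G K" and K: "group K"
  shows "complementary K (h ` A) (h ` B)"
proof -
  interpret h: group_hom G K h
    using h K group_axioms by (simp add: group_hom_def group_hom_axioms_def iso_def)
  have A: "subgroup A G" and B: "subgroup B G" and int: "A \<inter> B = {\<one>}"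
    and comm: "\<And>a b. a \<in> A \<Longrightarrow> b \<in> B \<Longrightarrow> a \<otimes> b = b \<otimes> a"
    using AB unfolding complementary_def by auto
  have sub: "A \<subseteq> carrier G" "B \<subseteq> carrier G"
    using A B by (simp_all add: subgroup.subset)
  have inj: "inj_on h (carrier G)" and surj: "h ` carrier G = carrier K"
    using h by (simp_all add: iso_def bij_betw_def)
  show ?thesis
    unfolding complementary_def
  proof (intro conjI ballI)
    show "subgroup (h ` A) K" "subgroup (h ` B) K"
      using A B by (simp_all add: h.subgroup_img_is_subgroup)
    have "h ` A \<inter> h ` B = h ` (A \<inter> B)"
      using inj_on_image_Int[OF inj sub] by simp
    then show "h ` A \<inter> h ` B = {\<one>\<^bsub>K\<^esub>}"
      using int by simp
  next
    fix x y assume "x \<in> h ` A" "y \<in> h ` B"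
    then obtain a b where ab: "a \<in> A" "b \<in> B" "x = h a" "y = h b" by blast
    have "a \<in> carrier G" "b \<in> carrier G" using ab sub by auto
    then show "x \<otimes>\<^bsub>K\<^esub> y = y \<otimes>\<^bsub>K\<^esub> x"
      using comm[OF ab(1,2)] ab(3,4) by (metis h.hom_mult)
  next
    fix x assume "x \<in> carrier K"
    then obtain g where g: "g \<in> carrier G" "x = h g" using surj by blast
    obtain a b where ab: "a \<in> A" "b \<in> B" "g = a \<otimes> b"
      using complementary_decompose[OF AB g(1)] by (elim bexE)
    have "a \<in> carrier G" "b \<in> carrier G"
      using ab sub by auto
    then have "x = h a \<otimes>\<^bsub>K\<^esub> h b"
      by (simp add: g(2) ab(3))
    then show "\<exists>a\<in>h ` A. \<exists>b\<in>h ` B. x = a \<otimes>\<^bsub>K\<^esub> b"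
      using ab by blast
  qed
qed

lemma indecomposable_iso:
  assumes ind: "indecomposable G" and h: "h \<in> iso G K" and K: "group K"
  shows "indecomposable K"
  unfolding group.indecomposable_iff[OF K]
proof (intro allI impI)
  fix A B assume AB: "complementary K A B"
  let ?k = "inv_into (carrier G) h"
  have k: "?k \<in> iso K G"
    using h by (rule iso_set_sym)
  then have "complementary G (?k ` A) (?k ` B)"
    using group.complementary_iso_image[OF K AB _ is_group] by blast
  then have "?k ` A = {\<one>} \<or> ?k ` B = {\<one>}"
    using ind indecomposable_iff by blast
  moreover have "C = {\<one>\<^bsub>K\<^esub>}" if C: "subgroup C K" "?k ` C = {\<one>}" for C
  proof -
    have "x = \<one>\<^bsub>K\<^esub>" if x: "x \<in> C" for x
    proof -
      have "?k x = ?k \<one>\<^bsub>K\<^esub>"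
        using C(2) x subgroup.one_closed[OF C(1)] by (metis imageI singletonD)
      moreover have "inj_on ?k (carrier K)"
        using k by (simp add: iso_def bij_betw_def)
      ultimately show ?thesis
        using subgroup.mem_carrier[OF C(1)] x subgroup.one_closed[OF C(1)] by (auto dest: inj_onD)
    qed
    then show ?thesis
      using subgroup.one_closed[OF C(1)] by blast
  qed
  ultimately show "A = {\<one>\<^bsub>K\<^esub>} \<or> B = {\<one>\<^bsub>K\<^esub>}"
    using AB unfolding complementary_def by blast
qed

lemma centre_trivial_iso:
  assumes triv: "group_center G \<subseteq> {\<one>}" and h: "h \<in> iso G K" and K: "group K"
  shows "group_center K \<subseteq> {\<one>\<^bsub>K\<^esub>}"
proof
  interpret h: group_hom G K h
    using h K group_axioms by (simp add: group_hom_def group_hom_axioms_def iso_def)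
  have inj: "inj_on h (carrier G)" and surj: "h ` carrier G = carrier K"
    using h by (simp_all add: iso_def bij_betw_def)
  fix z assume z: "z \<in> group_center K"
  then obtain g where g: "g \<in> carrier G" "z = h g"
    using surj by (auto simp: group_center_def)
  have "g \<otimes> x = x \<otimes> g" if x: "x \<in> carrier G" for x
  proof (rule inj_onD[OF inj])
    have "h g \<otimes>\<^bsub>K\<^esub> h x = h x \<otimes>\<^bsub>K\<^esub> h g"
      using z g x by (simp add: group_center_def)
    then show "h (g \<otimes> x) = h (x \<otimes> g)"
      using g x by simp
  qed (use g x in auto)
  then have "g \<in> group_center G"
    using g by (simp add: group_center_def)
  then show "z \<in> {\<one>\<^bsub>K\<^esub>}"
    using triv g by auto
qed

end

section \<open>Decomposition into irreducible components\<close>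

context coxeter_system
begin

lemma coxeter_matrix_subset: "Y \<subseteq> S \<Longrightarrow> coxeter_matrix Y M"
  using matrix finite_subset unfolding coxeter_matrix_def by blast

lemma edges_sym: "(s, t) \<in> coxeter_edges S M \<Longrightarrow> (t, s) \<in> coxeter_edges S M"
  using M_sym by (auto simp: coxeter_edges_def)

text \<open>Unions of vertex sets of connected components.\<close>
definition edge_closed :: "'s set \<Rightarrow> bool" where
  "edge_closed Y \<longleftrightarrow> Y \<subseteq> S \<and> (\<forall>s\<in>Y. \<forall>t\<in>S - Y. (s, t) \<notin> coxeter_edges S M)"

lemma edge_closed_M:
  assumes "edge_closed Y" "s \<in> Y" "t \<in> S - Y"
  shows "M s t = 2" "M t s = 2"
proof -
  have "s \<in> S" "t \<in> S" "s \<noteq> t" "(s, t) \<notin> coxeter_edges S M"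
    using assms by (auto simp: edge_closed_def)
  then show "M s t = 2" "M t s = 2"
    using cform_nonedge(1) M_sym by metis+
qed

lemma gen_commute:
  assumes "edge_closed Y" "s \<in> Y" "t \<in> S - Y"
  shows "gen s \<otimes>\<^bsub>W\<^esub> gen t = gen t \<otimes>\<^bsub>W\<^esub> gen s"
proof -
  have st: "s \<in> S" "t \<in> S" "s \<noteq> t"
    using assms by (auto simp: edge_closed_def)
  have c: "gen s \<in> carrier W" "gen t \<in> carrier W"
    using st by auto
  have "(gen s \<otimes>\<^bsub>W\<^esub> gen t) [^]\<^bsub>W\<^esub> (2::nat) = \<one>\<^bsub>W\<^esub>"
    by (rule gen_braid[OF st]) (use edge_closed_M[OF assms] in \<open>simp add: numeral_eq_enat\<close>)
  then have "(gen s \<otimes>\<^bsub>W\<^esub> gen t) \<otimes>\<^bsub>W\<^esub> (gen s \<otimes>\<^bsub>W\<^esub> gen t) = \<one>\<^bsub>W\<^esub>"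
    using c by (simp add: numeral_2_eq_2)
  then have "inv\<^bsub>W\<^esub> (gen s \<otimes>\<^bsub>W\<^esub> gen t) = gen s \<otimes>\<^bsub>W\<^esub> gen t"
    using c by (intro W.inv_equality) auto
  then show ?thesis
    using c st by (simp add: W.inv_mult_group)
qed

text \<open>A family that satisfies the relations of the subgraph on \<open>Y\<close> extends to all of \<open>W\<close> by \<open>1\<close> outside \<open>Y\<close>, since
  a relation between a generator in \<open>Y\<close> and one outside has exponent 2.\<close>
lemma ex_retraction_to:
  assumes Y: "edge_closed Y" and K: "group K" and k: "\<And>s. s \<in> Y \<Longrightarrow> k s \<in> carrier K"
    and sq: "\<And>s. s \<in> Y \<Longrightarrow> k s \<otimes>\<^bsub>K\<^esub> k s = \<one>\<^bsub>K\<^esub>"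
    and braid: "\<And>s t n. s \<in> Y \<Longrightarrow> t \<in> Y \<Longrightarrow> s \<noteq> t \<Longrightarrow> M s t = enat n \<Longrightarrow>
      (k s \<otimes>\<^bsub>K\<^esub> k t) [^]\<^bsub>K\<^esub> n = \<one>\<^bsub>K\<^esub>"
  shows "\<exists>r\<in>hom W K. (\<forall>s\<in>Y. r (gen s) = k s) \<and> (\<forall>s\<in>S - Y. r (gen s) = \<one>\<^bsub>K\<^esub>)"
proof -
  interpret K: group K by (rule K)
  define f where "f s = (if s \<in> Y then k s else \<one>\<^bsub>K\<^esub>)" for s
  have "\<exists>h\<in>hom W K. \<forall>s\<in>S. h (gen s) = f s"
  proof (rule coxeter_universal_property[OF K])
    fix s assume "s \<in> S"
    show "f s \<in> carrier K" "f s \<otimes>\<^bsub>K\<^esub> f s = \<one>\<^bsub>K\<^esub>"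
      using k sq by (auto simp: f_def)
  next
    fix s t n assume st: "s \<in> S" "t \<in> S" "s \<noteq> t" "M s t = enat n"
    have two: "(k u) [^]\<^bsub>K\<^esub> n = \<one>\<^bsub>K\<^esub>" if "M s t = 2" "u \<in> Y" for u
      using that st(4) sq k by (simp add: numeral_eq_enat numeral_2_eq_2)
    show "(f s \<otimes>\<^bsub>K\<^esub> f t) [^]\<^bsub>K\<^esub> n = \<one>\<^bsub>K\<^esub>"
      using st k braid[of s t n] two edge_closed_M[OF Y, of s t] edge_closed_M[OF Y, of t s]
      by (auto simp: f_def)
  qed
  then obtain h where h: "h \<in> hom W K" "\<forall>s\<in>S. h (gen s) = f s" by blast
  have "h (gen s) = k s" if "s \<in> Y" for s
    using h(2) that Y by (auto simp: f_def edge_closed_def)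
  moreover have "h (gen s) = \<one>\<^bsub>K\<^esub>" if "s \<in> S - Y" for s
    using h(2) that by (simp add: f_def)
  ultimately show ?thesis
    using h(1) by blast
qed

lemma parabolic_sub: "Y \<subseteq> S \<Longrightarrow> subgroup (standard_parabolic S M Y) W"
  unfolding standard_parabolic_def by (rule W.generate_is_subgroup) auto

lemma ex_retraction:
  assumes Y: "edge_closed Y"
  shows "\<exists>r\<in>hom W W. (\<forall>x\<in>standard_parabolic S M Y. r x = x) \<and>
    (\<forall>Z x. Z \<subseteq> S - Y \<and> x \<in> standard_parabolic S M Z \<longrightarrow> r x = \<one>\<^bsub>W\<^esub>)
    \<and> (\<forall>x\<in>carrier W. r x \<in> standard_parabolic S M Y)"
proof -
  have YS: "Y \<subseteq> S" using Y by (simp add: edge_closed_def)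
  obtain r where r: "r \<in> hom W W" "\<forall>s\<in>Y. r (gen s) = gen s" "\<forall>s\<in>S - Y. r (gen s) = \<one>\<^bsub>W\<^esub>"
    using ex_retraction_to[OF Y group_W, of gen] gen_braid YS by (auto simp: subset_iff)
  have ident: "r x = x" if "x \<in> standard_parabolic S M Y" for x
    by (rule W.hom_eq_on_generate[OF r(1) _ group_W, of "\<lambda>x. x" "gen ` Y"])
      (use r(2) that YS in \<open>auto simp: standard_parabolic_def hom_def\<close>)
  have triv: "r x = \<one>\<^bsub>W\<^esub>" if "Z \<subseteq> S - Y" "x \<in> standard_parabolic S M Z" for Z x
    by (rule W.hom_eq_on_generate[OF r(1) _ group_W, of "\<lambda>x. \<one>\<^bsub>W\<^esub>" "gen ` Z"])
      (use r(3) that in \<open>auto simp: standard_parabolic_def hom_def\<close>)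
  have img: "r x \<in> standard_parabolic S M Y" if "x \<in> carrier W" for x
  proof -
    interpret r: group_hom W W r
      using r(1) group_W by (simp add: group_hom_def group_hom_axioms_def)
    interpret Y: subgroup "standard_parabolic S M Y" W by (rule parabolic_sub[OF YS])
    show ?thesis
      using that
    proof (induction x rule: gen_induct)
      case (gen s w)
      have "r (gen s) \<in> standard_parabolic S M Y"
        using r(2,3) gen(1) unfolding standard_parabolic_def
        by (cases "s \<in> Y") (auto intro: generate.incl generate.one)
      then show ?case using gen by simp
    qed simp
  qed
  show ?thesis
  proof (intro bexI[OF _ r(1)] conjI ballI allI impI)
    fix Z x assume "Z \<subseteq> S - Y \<and> x \<in> standard_parabolic S M Z"
    then show "r x = \<one>\<^bsub>W\<^esub>" by (elim conjE) (rule triv)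
  qed (simp_all only: ident img)
qed

lemma parabolic_commute:
  assumes Y: "edge_closed Y" and Z: "Z \<subseteq> S - Y"
    and x: "x \<in> standard_parabolic S M Y" and y: "y \<in> standard_parabolic S M Z"
  shows "x \<otimes>\<^bsub>W\<^esub> y = y \<otimes>\<^bsub>W\<^esub> x"
proof (rule W.generate_commute)
  show "gen ` Y \<subseteq> carrier W" "gen ` Z \<subseteq> carrier W"
    using Y Z by (auto simp: edge_closed_def)
  fix a b assume "a \<in> gen ` Y" "b \<in> gen ` Z"
  then show "a \<otimes>\<^bsub>W\<^esub> b = b \<otimes>\<^bsub>W\<^esub> a"
    using gen_commute[OF Y] Z by blast
qed (use x y in \<open>simp_all add: standard_parabolic_def\<close>)

text \<open>The inclusion of generators defines a homomorphism from the abstract group to \<open>W\<close>; it is injective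
  because the retraction to the abstract group is a left inverse.\<close>
lemma parabolic_iso:
  assumes Y: "edge_closed Y"
  shows "\<exists>h. h \<in> iso (coxeter_group Y M) (W\<lparr>carrier := standard_parabolic S M Y\<rparr>)"
proof -
  have YS: "Y \<subseteq> S" using Y by (simp add: edge_closed_def)
  interpret Y: coxeter_system Y M
    by unfold_locales (rule coxeter_matrix_subset[OF YS])
  obtain r where r: "r \<in> hom W Y.W" "\<forall>s\<in>Y. r (gen s) = Y.gen s"
    using ex_retraction_to[OF Y Y.group_W, of Y.gen] Y.gen_braid by auto
  obtain h where h: "h \<in> hom Y.W W" "\<forall>s\<in>Y. h (Y.gen s) = gen s"
    using Y.coxeter_universal_property[OF group_W, of gen] gen_braid YS by (auto simp: subset_iff)
  have rh: "r (h x) = x" if "x \<in> carrier Y.W" for x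
  proof -
    have "r (h x) = (r \<circ> h) x" by simp
    also have "\<dots> = x"
      by (rule Y.W.hom_eq_on_generate[OF Group.hom_compose[OF h(1) r(1)] _ Y.group_W, of "\<lambda>x. x" "Y.gen ` Y"])
        (use r(2) h(2) that Y.generate_gen in \<open>auto simp: hom_def\<close>)
    finally show ?thesis .
  qed
  have "group_hom Y.W W h"
    by (intro group_hom.intro group_hom_axioms.intro Y.group_W group_W h(1))
  moreover have "Y.gen ` Y \<subseteq> carrier Y.W"
    by auto
  ultimately have "generate W (h ` (Y.gen ` Y)) = h ` generate Y.W (Y.gen ` Y)"
    by (rule group_hom.generate_img)
  then have "h ` carrier Y.W = generate W (h ` (Y.gen ` Y))"
    unfolding Y.generate_gen ..
  also have "h ` (Y.gen ` Y) = gen ` Y"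
    using h(2) by (simp add: image_image)
  finally have img: "h ` carrier Y.W = standard_parabolic S M Y"
    by (simp add: standard_parabolic_def)
  have hom: "h \<in> hom Y.W (W\<lparr>carrier := standard_parabolic S M Y\<rparr>)"
  proof (rule homI)
    fix x assume "x \<in> carrier Y.W"
    then have "h x \<in> h ` carrier Y.W" by (rule imageI)
    then show "h x \<in> carrier (W\<lparr>carrier := standard_parabolic S M Y\<rparr>)"
      unfolding img by simp
  next
    fix x y assume "x \<in> carrier Y.W" "y \<in> carrier Y.W"
    from hom_mult[OF h(1) this]
    show "h (x \<otimes>\<^bsub>Y.W\<^esub> y) = h x \<otimes>\<^bsub>W\<lparr>carrier := standard_parabolic S M Y\<rparr>\<^esub> h y"
      by simp
  qed
  have "inj_on h (carrier Y.W)"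
    by (rule inj_on_inverseI[of _ r]) (rule rh)
  moreover have "h ` carrier Y.W = carrier (W\<lparr>carrier := standard_parabolic S M Y\<rparr>)"
    unfolding img by simp
  ultimately have "bij_betw h (carrier Y.W) (carrier (W\<lparr>carrier := standard_parabolic S M Y\<rparr>))"
    by (rule bij_betw_imageI)
  with hom have "h \<in> iso Y.W (W\<lparr>carrier := standard_parabolic S M Y\<rparr>)"
    by (rule isoI)
  then show ?thesis
    by (rule exI[of _ h])
qed

lemma equiv_edges: "equiv UNIV ((coxeter_edges S M)\<^sup>*)"
proof (rule equivI)
  show "sym ((coxeter_edges S M)\<^sup>*)"
    by (intro sym_rtrancl symI) (rule edges_sym)
qed (auto simp: refl_on_def trans_rtrancl)

lemma component_subset:
  assumes "Y \<in> coxeter_components S M"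
  shows "Y \<subseteq> S"
proof -
  obtain s where s: "s \<in> S" "Y = (coxeter_edges S M)\<^sup>* `` {s}"
    using assms unfolding coxeter_components_def quotient_def by blast
  have "t \<in> S" if "(s, t) \<in> (coxeter_edges S M)\<^sup>*" for t
    using that by (induction rule: rtrancl_induct) (use s(1) in \<open>auto simp: coxeter_edges_def\<close>)
  then show ?thesis
    using s by blast
qed

lemma component_edge_closed:
  assumes "Y \<in> coxeter_components S M"
  shows "edge_closed Y"
  unfolding edge_closed_def
proof (intro conjI ballI component_subset[OF assms] notI)
  fix s t assume st: "s \<in> Y" "t \<in> S - Y" "(s, t) \<in> coxeter_edges S M"
  obtain u where "Y = (coxeter_edges S M)\<^sup>* `` {u}"
    using assms unfolding coxeter_components_def quotient_def by blast
  then show False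
    using st by (auto dest: rtrancl_into_rtrancl)
qed

lemma component_connected:
  assumes Y: "Y \<in> coxeter_components S M" and s: "s \<in> Y" and t: "t \<in> Y"
  shows "(s, t) \<in> (coxeter_edges Y M)\<^sup>*"
proof -
  obtain u where u: "Y = (coxeter_edges S M)\<^sup>* `` {u}"
    using Y unfolding coxeter_components_def quotient_def by blast
  have "(s, u) \<in> (coxeter_edges S M)\<^sup>*"
    using equiv_edges s u by (auto simp: equiv_def dest: symD)
  then have "(s, t) \<in> (coxeter_edges S M)\<^sup>*"
    using t u by auto
  then have "(s, t) \<in> (coxeter_edges Y M)\<^sup>* \<and> t \<in> Y"
  proof (induction rule: rtrancl_induct)
    case (step x y)
    then have "y \<in> Y"
      using component_edge_closed[OF Y] by (auto simp: edge_closed_def coxeter_edges_def)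
    then have "(x, y) \<in> coxeter_edges Y M"
      using step by (auto simp: coxeter_edges_def)
    then show ?case
      using step \<open>y \<in> Y\<close> by auto
  qed (simp add: s)
  then show ?thesis ..
qed

lemma components_disjoint:
  assumes "Y \<in> coxeter_components S M" "Z \<in> coxeter_components S M" "Y \<noteq> Z"
  shows "Y \<inter> Z = {}"
proof (rule ccontr)
  assume "Y \<inter> Z \<noteq> {}"
  then obtain x where "x \<in> Y" "x \<in> Z" by blast
  moreover have "C = (coxeter_edges S M)\<^sup>* `` {x}" if C: "C \<in> coxeter_components S M" "x \<in> C" for C
  proof -
    obtain u where u: "C = (coxeter_edges S M)\<^sup>* `` {u}"
      using C(1) unfolding coxeter_components_def quotient_def by blast
    then have "(u, x) \<in> (coxeter_edges S M)\<^sup>*" using C(2) by blast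
    then show ?thesis
      unfolding u by (rule equiv_class_eq[OF equiv_edges])
  qed
  ultimately show False using assms by blast
qed

lemma component_of:
  assumes "s \<in> S"
  obtains Y where "Y \<in> coxeter_components S M" "s \<in> Y"
proof (rule that)
  show "(coxeter_edges S M)\<^sup>* `` {s} \<in> coxeter_components S M"
    unfolding coxeter_components_def by (rule quotientI[OF assms])
qed simp

lemma spherical_iff:
  assumes "Y \<in> coxeter_components S M"
  shows "spherical Y M \<longleftrightarrow> finite (standard_parabolic S M Y)"
proof -
  obtain h where "h \<in> iso (coxeter_group Y M) (W\<lparr>carrier := standard_parabolic S M Y\<rparr>)"
    using parabolic_iso[OF component_edge_closed[OF assms]] by blast
  then have "bij_betw h (carrier (coxeter_group Y M)) (standard_parabolic S M Y)"
    by (simp add: iso_def)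
  then show ?thesis
    unfolding spherical_def by (rule bij_betw_finite)
qed

lemma nonspherical_component:
  assumes Y: "Y \<in> coxeter_components S M" and ns: "\<not> spherical Y M"
  shows "local_endos (W\<lparr>carrier := standard_parabolic S M Y\<rparr>)"
    and "standard_parabolic S M Y \<noteq> {\<one>\<^bsub>W\<^esub>}"
proof -
  interpret Y: irreducible_infinite_coxeter_system Y M
  proof
    show "coxeter_matrix Y M"
      by (rule coxeter_matrix_subset[OF component_subset[OF Y]])
    show "infinite (carrier (coxeter_group Y M))"
      using ns by (simp add: spherical_def)
  qed (rule component_connected[OF Y])
  obtain h where h: "h \<in> iso (coxeter_group Y M) (W\<lparr>carrier := standard_parabolic S M Y\<rparr>)"
    using parabolic_iso[OF component_edge_closed[OF Y]] by blast
  have grp: "group (W\<lparr>carrier := standard_parabolic S M Y\<rparr>)"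
    by (rule W.subgroup_imp_group[OF parabolic_sub[OF component_subset[OF Y]]])
  show "local_endos (W\<lparr>carrier := standard_parabolic S M Y\<rparr>)"
    by (rule group.centreless_indecomposable_imp_local_endos[OF grp
          Y.W.indecomposable_iso[OF Y.W_indecomposable h grp]
          Y.W.centre_trivial_iso[OF Y.centre_trivial h grp]])
  show "standard_parabolic S M Y \<noteq> {\<one>\<^bsub>W\<^esub>}"
    using spherical_iff[OF Y] ns by auto
qed

lemma spherical_part_edge_closed: "edge_closed (spherical_part S M)"
  unfolding edge_closed_def
proof (intro conjI ballI)
  show "spherical_part S M \<subseteq> S"
    using component_subset by (auto simp: spherical_part_def)
  fix s t assume "s \<in> spherical_part S M" and t: "t \<in> S - spherical_part S M"
  then obtain Y where Y: "Y \<in> coxeter_components S M" "spherical Y M" "s \<in> Y"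
    by (auto simp: spherical_part_def)
  then have "t \<in> S - Y"
    using t by (auto simp: spherical_part_def)
  then show "(s, t) \<notin> coxeter_edges S M"
    using component_edge_closed[OF Y(1)] Y(3) by (auto simp: edge_closed_def)
qed

text \<open>The components are finite in number and their parabolic subgroups commute, so the subgroup generated by
  finitely many finite ones is finite.\<close>
lemma finite_finite_part: "finite (finite_part S M)"
proof -
  let ?C = "{Y \<in> coxeter_components S M. spherical Y M}"
  have fin: "finite ?C"
    using finite_quotient[OF finite_S] finite_S unfolding coxeter_components_def quotient_def by auto
  have "finite (standard_parabolic S M (\<Union>C))" if "C \<subseteq> ?C" for C
    using finite_subset[OF that fin] that
  proof (induction C rule: finite_induct)
    case empty
    then show ?case by (simp add: standard_parabolic_def W.generate_empty)
  next
    case (insert Y C)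
    have Y: "Y \<in> coxeter_components S M" "spherical Y M"
      using insert.prems by auto
    have C: "\<Union>C \<subseteq> S - Y"
      using insert components_disjoint[OF _ Y(1)] component_subset by fastforce
    have "finite (generate W (gen ` Y \<union> gen ` \<Union>C))"
    proof (rule W.finite_generate_Un)
      show "gen ` Y \<subseteq> carrier W" "gen ` \<Union>C \<subseteq> carrier W"
        using component_subset[OF Y(1)] C by auto
      show "finite (generate W (gen ` Y))" "finite (generate W (gen ` \<Union>C))"
        using spherical_iff[OF Y(1)] Y(2) insert by (simp_all add: standard_parabolic_def)
      fix a b assume "a \<in> gen ` Y" "b \<in> gen ` \<Union>C"
      then show "a \<otimes>\<^bsub>W\<^esub> b = b \<otimes>\<^bsub>W\<^esub> a"
        using gen_commute[OF component_edge_closed[OF Y(1)]] C by blast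
    qed
    then show ?case
      by (simp add: standard_parabolic_def image_Un)
  qed
  then show ?thesis
    unfolding finite_part_def spherical_part_def by blast
qed

end

context coxeter_system
begin

text \<open>The projections are the retractions to the components and, for the factors of the finite part, the
  retraction to the finite part followed by the projection of its given decomposition.\<close>
lemma component_family:
  assumes X: "bij_betw X {..<b} {Y \<in> coxeter_components S M. \<not> spherical Y M}"
    and H: "direct_family (W\<lparr>carrier := finite_part S M\<rparr>) q H"
  shows "direct_family W (b + q) (\<lambda>i. if i < b then standard_parabolic S M (X i) else H (i - b))"
proof -
  let ?F = "W\<lparr>carrier := finite_part S M\<rparr>"
  define Z where "Z = spherical_part S M"
  define D where "D i = (if i < b then standard_parabolic S M (X i) else H (i - b))" for i
  have Zc: "edge_closed Z"
    unfolding Z_def by (rule spherical_part_edge_closed)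
  then have ZS: "Z \<subseteq> S"
    by (simp add: edge_closed_def)
  have FZ: "finite_part S M = standard_parabolic S M Z"
    by (simp add: finite_part_def Z_def)
  have Fsub: "subgroup (finite_part S M) W"
    unfolding FZ by (rule parabolic_sub[OF ZS])
  have grpF: "group ?F"
    by (rule W.subgroup_imp_group[OF Fsub])
  have Xc: "X i \<in> coxeter_components S M" "\<not> spherical (X i) M" if "i < b" for i
    using X that unfolding bij_betw_def by auto
  have XS: "X i \<subseteq> S" if "i < b" for i
    by (rule component_subset[OF Xc(1)[OF that]])
  have Xec: "edge_closed (X i)" if "i < b" for i
    by (rule component_edge_closed[OF Xc(1)[OF that]])
  have XX: "X k \<subseteq> S - X i" if "i < b" "k < b" "i \<noteq> k" for i k
  proof -
    have "X i \<noteq> X k"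
      using X that unfolding bij_betw_def inj_on_def by auto
    then have "X i \<inter> X k = {}"
      by (rule components_disjoint[OF Xc(1)[OF that(1)] Xc(1)[OF that(2)]])
    then show ?thesis
      using XS[OF that(2)] by blast
  qed
  have XZ: "X i \<inter> Z = {}" if i: "i < b" for i
  proof -
    have "X i \<inter> Y = {}" if Y: "Y \<in> coxeter_components S M" "spherical Y M" for Y
      by (rule components_disjoint[OF Xc(1)[OF i] Y(1)]) (use Y(2) Xc(2)[OF i] in blast)
    then show ?thesis
      unfolding Z_def spherical_part_def by blast
  qed
  have HF: "subgroup (H j) ?F" if "j < q" for j
    by (rule direct_familyD(1)[OF H that])
  have HZ: "H j \<subseteq> standard_parabolic S M Z" if "j < q" for j
    using subgroup.subset[OF HF[OF that]] by (simp add: FZ)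
  have HW: "subgroup (H j) W" if "j < q" for j
    by (rule W.incl_subgroup[OF Fsub HF[OF that]])
  have D1: "D i = standard_parabolic S M (X i)" if "i < b" for i
    using that by (simp add: D_def)
  have D2: "D i = H (i - b)" "i - b < q" if "\<not> i < b" "i < b + q" for i
    using that by (auto simp: D_def)
  have sub: "subgroup (D i) W" if "i < b + q" for i
    by (cases "i < b") (use that HW in \<open>simp_all add: D_def parabolic_sub XS\<close>)
  have commX: "x \<otimes>\<^bsub>W\<^esub> y = y \<otimes>\<^bsub>W\<^esub> x"
    if i: "i < b" and k: "k < b + q" "i \<noteq> k" and x: "x \<in> D i" and y: "y \<in> D k" for i k x y
  proof (cases "k < b")
    case True
    show ?thesis
      by (rule parabolic_commute[OF Xec[OF i] XX[OF i True k(2)]])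
        (use x y D1[OF i] D1[OF True] in simp_all)
  next
    case False
    have "Z \<subseteq> S - X i"
      using XZ[OF i] ZS by blast
    then show ?thesis
      by (rule parabolic_commute[OF Xec[OF i]])
        (use x y D1[OF i] D2[OF False k(1)] HZ in auto)
  qed
  have comm: "x \<otimes>\<^bsub>W\<^esub> y = y \<otimes>\<^bsub>W\<^esub> x"
    if i: "i < b + q" and k: "k < b + q" and ik: "i \<noteq> k" and x: "x \<in> D i" and y: "y \<in> D k" for i k x y
  proof -
    consider "i < b" | "k < b" | "\<not> i < b" "\<not> k < b" by blast
    then show ?thesis
    proof cases
      case 1
      then show ?thesis by (rule commX[OF _ k ik x y])
    next
      case 2
      then show ?thesis by (rule commX[OF _ i ik[symmetric] y x, symmetric])
    next
      case 3
      have "i - b \<noteq> k - b"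
        using 3 ik by simp
      then have "x \<otimes>\<^bsub>?F\<^esub> y = y \<otimes>\<^bsub>?F\<^esub> x"
        using direct_familyD(2)[OF H D2(2)[OF 3(1) i] D2(2)[OF 3(2) k]] x y D2(1)[OF 3(1) i] D2(1)[OF 3(2) k]
        by blast
      then show ?thesis by simp
    qed
  qed
  have DU: "(\<Union>i<b + q. D i) \<subseteq> carrier W"
    using subgroup.subset[OF sub] by blast
  have "carrier W \<subseteq> generate W (\<Union>i<b + q. D i)"
  proof -
    have "gen s \<in> generate W (\<Union>i<b + q. D i)" if s: "s \<in> S" for s
    proof -
      obtain Y where Y: "Y \<in> coxeter_components S M" "s \<in> Y"
        using s by (rule component_of)
      show ?thesis
      proof (cases "spherical Y M")
        case False
        then have "Y \<in> X ` {..<b}"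
          using X Y(1) unfolding bij_betw_def by simp
        then obtain i where i: "i < b" "Y = X i" by blast
        have "gen s \<in> D i"
          using i Y(2) unfolding D_def standard_parabolic_def by (auto intro: generate.incl)
        then show ?thesis
          using i(1) by (intro generate.incl UN_I[of i]) auto
      next
        case True
        then have "s \<in> Z"
          using Y unfolding Z_def spherical_part_def by blast
        then have "gen s \<in> finite_part S M"
          unfolding FZ standard_parabolic_def by (auto intro: generate.incl)
        moreover have "generate ?F (\<Union>j<q. H j) = generate W (\<Union>j<q. H j)"
          by (rule W.generate_consistent[OF _ Fsub]) (use HZ in \<open>auto simp: FZ\<close>)
        ultimately have "gen s \<in> generate W (\<Union>j<q. H j)"
          using direct_familyD(3)[OF H] by simp
        moreover have "(\<Union>j<q. H j) \<subseteq> (\<Union>i<b + q. D i)"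
        proof
          fix x assume "x \<in> (\<Union>j<q. H j)"
          then obtain j where "j < q" "x \<in> H j" by blast
          then have "b + j < b + q" "x \<in> D (b + j)" by (simp_all add: D_def)
          then show "x \<in> (\<Union>i<b + q. D i)" by blast
        qed
        ultimately show ?thesis
          using W.mono_generate by blast
      qed
    qed
    then have "generate W (gen ` S) \<subseteq> generate W (\<Union>i<b + q. D i)"
      by (intro W.generate_subgroup_incl W.generate_is_subgroup DU) blast
    then show ?thesis
      by (simp only: generate_gen)
  qed
  then have gen: "generate W (\<Union>i<b + q. D i) = carrier W"
    using W.generate_incl[OF DU] by blast
  have proj: "\<exists>r\<in>hom W W. (\<forall>x\<in>D i. r x = x) \<and> (\<forall>k<b + q. k \<noteq> i \<longrightarrow> (\<forall>x\<in>D k. r x = \<one>\<^bsub>W\<^esub>))"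
    if i: "i < b + q" for i
  proof (cases "i < b")
    case True
    obtain r where r: "r \<in> hom W W" "\<forall>x\<in>standard_parabolic S M (X i). r x = x"
      "\<forall>Y x. Y \<subseteq> S - X i \<and> x \<in> standard_parabolic S M Y \<longrightarrow> r x = \<one>\<^bsub>W\<^esub>"
      using ex_retraction[OF Xec[OF True]] by blast
    have "r x = \<one>\<^bsub>W\<^esub>" if k: "k < b + q" "k \<noteq> i" "x \<in> D k" for k x
    proof (cases "k < b")
      case kb: True
      show ?thesis
        using r(3) XX[OF True kb k(2)[symmetric]] k(3) D1[OF kb] by blast
    next
      case False
      have "Z \<subseteq> S - X i" "x \<in> standard_parabolic S M Z"
        using XZ[OF True] ZS HZ D2[OF False k(1)] k(3) by auto
      then show ?thesis
        using r(3) by blast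
    qed
    then show ?thesis
      using r(1,2) D1[OF True] by (intro bexI[of _ r]) auto
  next
    case False
    note Di = D2[OF False i]
    obtain r where r: "r \<in> hom W W" "\<forall>x\<in>standard_parabolic S M Z. r x = x"
      "\<forall>Y x. Y \<subseteq> S - Z \<and> x \<in> standard_parabolic S M Y \<longrightarrow> r x = \<one>\<^bsub>W\<^esub>"
      "\<forall>x\<in>carrier W. r x \<in> standard_parabolic S M Z"
      using ex_retraction[OF Zc] by blast
    obtain p where p: "p \<in> hom ?F ?F" "\<forall>x\<in>H (i - b). p x = x"
      "\<forall>k<q. k \<noteq> i - b \<longrightarrow> (\<forall>x\<in>H k. p x = \<one>\<^bsub>?F\<^esub>)"
      using direct_familyD(4)[OF H Di(2)] by blast
    have p_cl: "p x \<in> carrier W" if "x \<in> finite_part S M" for x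
      using hom_in_carrier[OF p(1), of x] that subgroup.mem_carrier[OF Fsub] by simp
    have p_mult: "p (x \<otimes>\<^bsub>W\<^esub> y) = p x \<otimes>\<^bsub>W\<^esub> p y" if "x \<in> finite_part S M" "y \<in> finite_part S M" for x y
      using hom_mult[OF p(1), of x y] that by simp
    have p_one: "p \<one>\<^bsub>W\<^esub> = \<one>\<^bsub>W\<^esub>"
      using hom_one[OF p(1) grpF grpF] by simp
    have hom: "(\<lambda>x. p (r x)) \<in> hom W W"
    proof (rule homI)
      fix x y assume xy: "x \<in> carrier W" "y \<in> carrier W"
      then have rF: "r x \<in> finite_part S M" "r y \<in> finite_part S M"
        using r(4) by (simp_all add: FZ)
      show "p (r x) \<in> carrier W"
        by (rule p_cl[OF rF(1)])
      show "p (r (x \<otimes>\<^bsub>W\<^esub> y)) = p (r x) \<otimes>\<^bsub>W\<^esub> p (r y)"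
        unfolding hom_mult[OF r(1) xy] by (rule p_mult[OF rF])
    qed
    have "p (r x) = x" if "x \<in> D i" for x
      using that r(2) HZ[OF Di(2)] p(2) Di(1) by auto
    moreover have "p (r x) = \<one>\<^bsub>W\<^esub>" if k: "k < b + q" "k \<noteq> i" "x \<in> D k" for k x
    proof (cases "k < b")
      case kb: True
      have "X k \<subseteq> S - Z" "x \<in> standard_parabolic S M (X k)"
        using XZ[OF kb] XS[OF kb] k(3) D1[OF kb] by auto
      then have "r x = \<one>\<^bsub>W\<^esub>"
        using r(3) by blast
      then show ?thesis
        by (simp add: p_one)
    next
      case kb: False
      have kq: "x \<in> H (k - b)" "k - b < q" "k - b \<noteq> i - b"
        using D2[OF kb k(1)] k False kb by auto
      then have "r x = x"
        using r(2) HZ by blast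
      then show ?thesis
        using p(3) kq by simp
    qed
    ultimately show ?thesis
      using hom by (intro bexI[of _ "\<lambda>x. p (r x)"]) auto
  qed
  have "direct_family W (b + q) D"
    unfolding direct_family_def using sub comm gen proj by (intro conjI allI impI ballI) simp_all
  then show ?thesis
    unfolding D_def .
qed

end

section \<open>Remak decompositions of Coxeter groups\<close>

text \<open>The components and the factors of the finite part form a direct family whose members have the local
  property: the former are centreless and indecomposable, the latter finite and indecomposable. The
  exchange theorem compares it with an arbitrary Remak decomposition.\<close>

theorem theorem5p2:
  fixes S :: "'s set" and M :: "'s \<Rightarrow> 's \<Rightarrow> enat"
    and X :: "nat \<Rightarrow> 's set" and H G :: "nat \<Rightarrow> 's word set set" and b q m :: nat
  assumes "coxeter_matrix S M"
    and "bij_betw X {..<b} {Y \<in> coxeter_components S M. \<not> spherical Y M}"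
    and "remak_decomposition ((coxeter_group S M)\<lparr>carrier := finite_part S M\<rparr>) q H"
    and "remak_decomposition (coxeter_group S M) m G"
  shows "m = b + q \<and>
    (\<exists>\<sigma> \<phi>. \<sigma> permutes {..<m} \<and> central_automorphism (coxeter_group S M) \<phi> \<and>
       (\<forall>i<b. \<phi> ` standard_parabolic S M (X i) = G (\<sigma> i)) \<and>
       (\<forall>j<q. \<phi> ` H j = G (\<sigma> (b + j))))"
proof -
  interpret coxeter_system S M
    by unfold_locales (rule assms(1))
  let ?F = "W\<lparr>carrier := finite_part S M\<rparr>"
  define D where "D i = (if i < b then standard_parabolic S M (X i) else H (i - b))" for i
  have Fsub: "subgroup (finite_part S M) W"
    unfolding finite_part_def
    by (rule parabolic_sub) (use spherical_part_edge_closed in \<open>simp add: edge_closed_def\<close>)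
  have grpF: "group ?F"
    by (rule W.subgroup_imp_group[OF Fsub])
  have H: "direct_family ?F q H"
    and G: "direct_family W m G"
    using assms(3,4) group.internal_direct_product_imp_direct_family[OF grpF]
      W.internal_direct_product_imp_direct_family
    unfolding remak_decomposition_def by blast+
  have D: "direct_family W (b + q) D"
    using component_family[OF assms(2) H] unfolding D_def .
  have "D i \<noteq> {\<one>\<^bsub>W\<^esub>} \<and> local_endos (W\<lparr>carrier := D i\<rparr>)" if i: "i < b + q" for i
  proof (cases "i < b")
    case True
    then have "X i \<in> coxeter_components S M" "\<not> spherical (X i) M"
      using assms(2) unfolding bij_betw_def by auto
    from nonspherical_component[OF this] show ?thesis
      using True by (simp add: D_def)
  next
    case False
    then have j: "i - b < q" "D i = H (i - b)"
      using i by (auto simp: D_def)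
    have Hj: "H (i - b) \<noteq> {\<one>\<^bsub>W\<^esub>}" "indecomposable (W\<lparr>carrier := H (i - b)\<rparr>)"
      using assms(3) j(1) unfolding remak_decomposition_def by simp_all
    have HF: "subgroup (H (i - b)) ?F"
      by (rule direct_familyD(1)[OF H j(1)])
    have "H (i - b) \<subseteq> finite_part S M"
      using subgroup.subset[OF HF] by simp
    then have "finite (H (i - b))"
      using finite_finite_part finite_subset by blast
    moreover have "group (W\<lparr>carrier := H (i - b)\<rparr>)"
      by (rule W.subgroup_imp_group[OF W.incl_subgroup[OF Fsub HF]])
    ultimately have "local_endos (W\<lparr>carrier := H (i - b)\<rparr>)"
      using group.finite_indecomposable_imp_local_endos[OF _ _ Hj(2)] by simp
    then show ?thesis
      using Hj(1) by (simp add: j(2))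
  qed
  moreover have "\<forall>j<m. G j \<noteq> {\<one>\<^bsub>W\<^esub>} \<and> indecomposable (W\<lparr>carrier := G j\<rparr>)"
    using assms(4) unfolding remak_decomposition_def by blast
  ultimately have "m = b + q \<and> (\<exists>\<sigma> \<phi>. \<sigma> permutes {..<m} \<and> central_automorphism W \<phi> \<and>
      (\<forall>i<b + q. \<phi> ` D i = G (\<sigma> i)))"
    by (intro W.krull_remak_schmidt[OF D G]) blast+
  then obtain \<sigma> \<phi> where *: "m = b + q" "\<sigma> permutes {..<m}" "central_automorphism W \<phi>"
    "\<forall>i<b + q. \<phi> ` D i = G (\<sigma> i)"
    by (elim conjE exE)
  have "\<phi> ` standard_parabolic S M (X i) = G (\<sigma> i)" if "i < b" for i
  proof -
    have "\<phi> ` D i = G (\<sigma> i)"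
      using *(4) that by simp
    then show ?thesis
      using that by (simp add: D_def)
  qed
  moreover have "\<phi> ` H j = G (\<sigma> (b + j))" if "j < q" for j
  proof -
    have "\<phi> ` D (b + j) = G (\<sigma> (b + j))"
      using *(4) that by simp
    then show ?thesis
      by (simp add: D_def)
  qed
  ultimately show ?thesis
    using *(1-3) by (intro conjI exI[of _ \<sigma>] exI[of _ \<phi>]) simp_all
qed

end
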